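(* Let $\lambda$ be a partition of $n$ and fix a removable node $(k,l)=(k_0,l_0)$ of $\lambda$. Let $(k_1,l_1),\dots,(k_N,l_N)$ ($N\ge0$) be the removable nodes of $\lambda$ strictly below $(k,l)$, ordered so that $k_0<k_1<\cdots<k_N$. Put $c_j:=t^\lambda[k_j,l_j]$, $c:=c_0$, $t_d:=t^\lambda\sigma_{c,d}$ for $d\ge c$, $e_d:=e_{t_d}$, $f_d:=f_{t_d}$. For each row index $i$ let $a_i$ (resp. $b_i$) be the last entry of row $i-1$ (resp. row $i$) of $t^\lambda$ and $R_i:=1+T_{a_i,a_i+1}+\cdots+T_{a_i,b_i-1}\in\mathcal H_n$. For $j=0,\dots,N-1$ put $\widetilde\sigma_j:=\sigma_{c_j,c_{j+1}}$ and $\widetilde\sigma_j^{\,i}:=\sigma_{c_j,c_j+i\,l_{j+1}}$; set $\varphi_j^1:=R_{k_j+1}$ and recursively, for $i=2,\dots,k_{j+1}-k_j$, $$\varphi_j^i:=\big(T_{\widetilde\sigma_j^{\,i-1}}-q\,\varphi_j^{i-1}\big)R_{k_j+i},$$ and $\mathcal F_j:=\varphi_j^{k_{j+1}-k_j}$. Let $r_j$ be the radial distance in $\lambda$ from the node $(k_j,l_j)$ to the node $(k,l)$. Define $\tilde f_0:=e_\lambda$ and recursively $$\tilde f_{j+1}:=\tilde f_j\Big(T_{\widetilde\sigma_j}+\frac{1}{[r_{j+1}]_q}\mathcal F_j\Big),\qquad j=0,\dots,N-1.$$ Then $\tilde f_N=f_n$ (the seminormal basis vector $f_{t_n}$). Moreover,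 when the recursion is multiplied out and each $e_tT_i$ is evaluated as $e_{ts_i}$, all the $e_t$ that arise have $t$ standard.
   Context: $\mathcal A=\mathbb C[q,q^{-1}]$, $\mathcal K=\mathbb C(q)$. $\mathcal H_{\mathcal A,n}$ is the Iwahori–Hecke algebra over $\mathcal A$ with generators $T_1,\dots,T_{n-1}$ and relations $T_iT_j=T_jT_i$ for $|i-j|>1$, $T_iT_jT_i=T_jT_iT_j$ for $|i-j|=1$, $(T_i-q)(T_i+1)=0$; $\mathcal H_n=\mathcal H_{\mathcal A,n}\otimes\mathcal K$. Permutations are composed left to right; $s_i=(i,i+1)$; $T_w=T_{i_1}\cdots T_{i_N}$ for a reduced expression $w=s_{i_1}\cdots s_{i_N}$. For $i\le j$, $\sigma_{i,j}=(i,i+1)(i+1,i+2)\cdots(j-1,j)$ ($\sigma_{i,i}=1$), $T_{i,j}=T_{\sigma_{i,j}}=T_i\cdots T_{j-1}$. $[k]_q=(q^k-1)/(q-1)$. Nodes $(r,c)$ = (row, column); $t[r,c]$ is the entry of $t$ in node $(r,c)$. A node is removable if deleting it leaves a partition diagram. A $\lambda$-tableau is a bijective filling of the diagram with $1,\dots,n$; standard = increasing along rows and columns. $t^\lambda$ has $1,\dots,n$ filled along rows, top first. $S_n$ acts on the right on tableaux by permuting entries; $t=t^\lambda d(t)$ defines $d(t)$. Radial distance from $(a,b)$ to $(a',b')$ is $b'-b-(a'-a)$. Specht module: $x_\lambda=\sum_{w\in S_\lambda}T_w$ ($S_\lambda$ the row stabilizer of $t^\lambda$), $x_{st}=T_{d(s)^{-1}}x_\lambda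 T_{d(t)}$, $\overline N_\lambda$ the $\mathcal A$-span of $x_{st}$ for $\mu$-tableaux $s,t$ with $\mu$ strictly dominating $\lambda$; $S^\lambda_{\mathcal A}$ is the right module generated by $x_\lambda+\overline N_\lambda$; $e_t:=x_{t^\lambda t}+\overline N_\lambda=e_{t^\lambda}T_{d(t)}$ for any $\lambda$-tableau $t$, $e_\lambda=e_{t^\lambda}$; $S^\lambda=S^\lambda_{\mathcal A}\otimes\mathcal K$. Seminormal basis: $L_m=\sum_{i=1}^{m-1}q^{-i}T_{(m-i,m)}$; residue of $(r,c)$ is $[c-r]_q$; $r_t(m)$ = residue of the node of $m$ in $t$; $\mathrm R$ = set of residues of nodes of partitions of $n$; $E_t=\prod_{m=1}^n\prod_{c'\in\mathrm R\setminus\{r_t(m)\}}\frac{L_m-c'}{r_t(m)-c'}$, $f_t=e_tE_t\in S^\lambda$. *)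

theory Defs
  imports "HOL-Computational_Algebra.Polynomial" "HOL-Computational_Algebra.Fraction_Field"
          "HOL-Combinatorics.Permutations"
begin

type_synonym K = "complex poly fract"

definition qq :: K where "qq = Fract [:0, 1:] 1"

definition qint :: "int \<Rightarrow> K" where "qint k = (qq powi k - 1) / (qq - 1)"

type_synonym perm = "nat \<Rightarrow> nat"

definition perms :: "nat \<Rightarrow> perm set" where "perms n = {w. w permutes {1..n}}"

definition tr :: "nat \<Rightarrow> nat \<Rightarrow> perm" where
  "tr a b = (\<lambda>x. if x = a then b else if x = b then a else x)"

definition sg :: "nat \<Rightarrow> perm" where "sg i = tr i (Suc i)"

text \<open>Product u v (left to right: first u, then v) is the function v o u.\<close>
definition lr :: "perm \<Rightarrow> perm \<Rightarrow> perm" where "lr u v = v \<circ> u"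

definition perm_of_word :: "nat list \<Rightarrow> perm" where
  "perm_of_word is = foldl (\<lambda>w i. lr w (sg i)) id is"

definition len :: "nat \<Rightarrow> perm \<Rightarrow> nat" where
  "len n w = card {(i, j). i \<in> {1..n} \<and> j \<in> {1..n} \<and> i < j \<and> w j < w i}"

section \<open>The Hecke algebra H_n over K, in its standard basis T_w (w in S_n)\<close>

type_synonym hecke = "perm \<Rightarrow> K"

definition hbasis :: "perm \<Rightarrow> hecke" where "hbasis w = (\<lambda>v. if v = w then 1 else 0)"
definition hone :: hecke where "hone = hbasis id"
definition hscale :: "K \<Rightarrow> hecke \<Rightarrow> hecke" where "hscale c h = (\<lambda>v. c * h v)"
definition hadd :: "hecke \<Rightarrow> hecke \<Rightarrow> hecke" where "hadd a b = (\<lambda>v. a v + b v)"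
definition hsub :: "hecke \<Rightarrow> hecke \<Rightarrow> hecke" where "hsub a b = (\<lambda>v. a v - b v)"

text \<open>Right multiplication by a generator T_i:
  T_w T_i = T_{w s_i} if l(w s_i) > l(w), and q T_{w s_i} + (q-1) T_w otherwise.\<close>
definition Tgen :: "nat \<Rightarrow> nat \<Rightarrow> hecke \<Rightarrow> hecke" where
  "Tgen n i h = (\<lambda>w. if len n (lr w (sg i)) < len n w
                       then h (lr w (sg i)) + (qq - 1) * h w
                       else qq * h (lr w (sg i)))"

definition hword :: "nat \<Rightarrow> hecke \<Rightarrow> nat list \<Rightarrow> hecke" where
  "hword n h is = foldl (\<lambda>h i. Tgen n i h) h is"

definition rw :: "nat \<Rightarrow> perm \<Rightarrow> nat list" where
  "rw n w = (SOME is. set is \<subseteq> {1..<n} \<and> perm_of_word is = w \<and> length is = len n w)"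

text \<open>Multiplication in H_n: a * T_w = a T_{i_1} ... T_{i_N} for a reduced expression.\<close>
definition hmul :: "nat \<Rightarrow> hecke \<Rightarrow> hecke \<Rightarrow> hecke" where
  "hmul n a b = (\<lambda>v. \<Sum>w\<in>perms n. b w * hword n a (rw n w) v)"

definition is_partition :: "nat \<Rightarrow> nat list \<Rightarrow> bool" where
  "is_partition n la \<longleftrightarrow> sorted_wrt (\<ge>) la \<and> (\<forall>x\<in>set la. 0 < x) \<and> sum_list la = n"

definition nodes :: "nat list \<Rightarrow> (nat \<times> nat) set" where
  "nodes la = {(r, c). 1 \<le> r \<and> r \<le> length la \<and> 1 \<le> c \<and> c \<le> la ! (r - 1)}"

definition removable :: "nat list \<Rightarrow> nat \<times> nat \<Rightarrow> bool" where
  "removable la x \<longleftrightarrow> x \<in> nodes la \<and>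
     (\<exists>mu. sorted_wrt (\<ge>) mu \<and> (\<forall>y\<in>set mu. 0 < y) \<and> nodes mu = nodes la - {x})"

definition tableau :: "nat \<Rightarrow> nat list \<Rightarrow> (nat \<times> nat \<Rightarrow> nat) \<Rightarrow> bool" where
  "tableau n la t \<longleftrightarrow> bij_betw t (nodes la) {1..n} \<and> (\<forall>x. x \<notin> nodes la \<longrightarrow> t x = 0)"

definition standard :: "nat list \<Rightarrow> (nat \<times> nat \<Rightarrow> nat) \<Rightarrow> bool" where
  "standard la t \<longleftrightarrow>
     (\<forall>r c. (r, c) \<in> nodes la \<longrightarrow> (r, Suc c) \<in> nodes la \<longrightarrow> t (r, c) < t (r, Suc c)) \<and>
     (\<forall>r c. (r, c) \<in> nodes la \<longrightarrow> (Suc r, c) \<in> nodes la \<longrightarrow> t (r, c) < t (Suc r, c))"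

definition tlam :: "nat list \<Rightarrow> nat \<times> nat \<Rightarrow> nat" where
  "tlam la = (\<lambda>(r, c). if (r, c) \<in> nodes la then sum_list (take (r - 1) la) + c else 0)"

definition tact :: "perm \<Rightarrow> (nat \<times> nat \<Rightarrow> nat) \<Rightarrow> (nat \<times> nat \<Rightarrow> nat)" where
  "tact w t = (\<lambda>x. if t x = 0 then 0 else w (t x))"

text \<open>t = t^la d(t).\<close>
definition dperm :: "nat \<Rightarrow> nat list \<Rightarrow> (nat \<times> nat \<Rightarrow> nat) \<Rightarrow> perm" where
  "dperm n la t = (\<lambda>i. if i \<in> {1..n} then t (inv_into (nodes la) (tlam la) i) else i)"

definition rowof :: "nat list \<Rightarrow> nat \<Rightarrow> nat" where
  "rowof la i = fst (inv_into (nodes la) (tlam la) i)"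

definition rowstab :: "nat \<Rightarrow> nat list \<Rightarrow> perm set" where
  "rowstab n la = {w \<in> perms n. \<forall>i\<in>{1..n}. rowof la (w i) = rowof la i}"

definition xlam :: "nat \<Rightarrow> nat list \<Rightarrow> hecke" where
  "xlam n la = (\<lambda>v. \<Sum>w\<in>rowstab n la. hbasis w v)"

definition xst :: "nat \<Rightarrow> nat list \<Rightarrow> (nat \<times> nat \<Rightarrow> nat) \<Rightarrow> (nat \<times> nat \<Rightarrow> nat) \<Rightarrow> hecke" where
  "xst n la s t = hmul n (hmul n (hbasis (inv (dperm n la s))) (xlam n la)) (hbasis (dperm n la t))"

definition dominates :: "nat list \<Rightarrow> nat list \<Rightarrow> bool" where
  "dominates mu la \<longleftrightarrow> (\<forall>k. sum_list (take k la) \<le> sum_list (take k mu))"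

definition Nbar :: "nat \<Rightarrow> nat list \<Rightarrow> hecke set" where
  "Nbar n la = {h. \<exists>F g. finite F \<and>
      F \<subseteq> {(mu, s, t). is_partition n mu \<and> dominates mu la \<and> mu \<noteq> la \<and> tableau n mu s \<and> tableau n mu t} \<and>
      h = (\<lambda>v. \<Sum>(mu, s, t)\<in>F. g (mu, s, t) * xst n mu s t v)}"

text \<open>Equality in S^la of the classes of two elements of x_la H_n.\<close>
definition specht_eq :: "nat \<Rightarrow> nat list \<Rightarrow> hecke \<Rightarrow> hecke \<Rightarrow> bool" where
  "specht_eq n la a b \<longleftrightarrow> hsub a b \<in> Nbar n la"

text \<open>Representative of e_t.\<close>
definition etab :: "nat \<Rightarrow> nat list \<Rightarrow> (nat \<times> nat \<Rightarrow> nat) \<Rightarrow> hecke" where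
  "etab n la t = xst n la (tlam la) t"

definition res :: "nat \<times> nat \<Rightarrow> K" where "res x = qint (int (snd x) - int (fst x))"

definition Rcont :: "nat \<Rightarrow> int set" where
  "Rcont n = {int c - int r | mu r c. is_partition n mu \<and> (r, c) \<in> nodes mu}"

definition Rset :: "nat \<Rightarrow> K set" where "Rset n = qint ` Rcont n"

definition resid :: "nat list \<Rightarrow> (nat \<times> nat \<Rightarrow> nat) \<Rightarrow> nat \<Rightarrow> K" where
  "resid la t m = res (inv_into (nodes la) t m)"

definition Lop :: "nat \<Rightarrow> nat \<Rightarrow> hecke" where
  "Lop n m = (\<lambda>v. \<Sum>i = 1..m - 1. inverse (qq ^ i) * hbasis (tr (m - i) m) v)"

definition Efac :: "nat \<Rightarrow> nat list \<Rightarrow> (nat \<times> nat \<Rightarrow> nat) \<Rightarrow> nat \<Rightarrow> int \<Rightarrow> hecke" where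
  "Efac n la t m d = hscale (inverse (resid la t m - qint d)) (hsub (Lop n m) (hscale (qint d) hone))"

text \<open>E_t; the factors commute, we take them in increasing order of m and of content d
  (each c' in R - {r_t(m)} is qint d for exactly one content d).\<close>
definition Eidem :: "nat \<Rightarrow> nat list \<Rightarrow> (nat \<times> nat \<Rightarrow> nat) \<Rightarrow> hecke" where
  "Eidem n la t = foldl (hmul n) hone
     [Efac n la t m d. m \<leftarrow> [1..<Suc n], d \<leftarrow> sorted_list_of_set {d \<in> Rcont n. qint d \<noteq> resid la t m}]"

definition fsn :: "nat \<Rightarrow> nat list \<Rightarrow> (nat \<times> nat \<Rightarrow> nat) \<Rightarrow> hecke" where
  "fsn n la t = hmul n (etab n la t) (Eidem n la t)"

datatype fexp = FOne | FGen nat | FScal K fexp | FAdd fexp fexp | FMul fexp fexp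

primrec feval :: "nat \<Rightarrow> fexp \<Rightarrow> hecke" where
  "feval n FOne = hone"
| "feval n (FGen i) = hbasis (sg i)"
| "feval n (FScal c e) = hscale c (feval n e)"
| "feval n (FAdd a b) = hadd (feval n a) (feval n b)"
| "feval n (FMul a b) = hmul n (feval n a) (feval n b)"

primrec fwords :: "fexp \<Rightarrow> nat list set" where
  "fwords FOne = {[]}"
| "fwords (FGen i) = {[i]}"
| "fwords (FScal c e) = fwords e"
| "fwords (FAdd a b) = fwords a \<union> fwords b"
| "fwords (FMul a b) = {u @ v | u v. u \<in> fwords a \<and> v \<in> fwords b}"

text \<open>T_{i_1} ... T_{i_m} as a formal word; T_{i,j} = fT [i..<j].\<close>
definition fT :: "nat list \<Rightarrow> fexp" where "fT is = foldr (\<lambda>i e. FMul (FGen i) e) is FOne"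

fun fsum :: "fexp list \<Rightarrow> fexp" where
  "fsum [] = FScal 0 FOne"
| "fsum [e] = e"
| "fsum (e # es) = FAdd e (fsum es)"

definition remb :: "nat list \<Rightarrow> nat \<Rightarrow> (nat \<times> nat) list" where
  "remb la k = map (\<lambda>r. (r, THE c. removable la (r, c)))
                 (sorted_list_of_set {r. k < r \<and> (\<exists>c. removable la (r, c))})"

definition knode :: "nat list \<Rightarrow> nat \<Rightarrow> nat \<Rightarrow> nat \<Rightarrow> nat \<times> nat" where
  "knode la k l j = ((k, l) # remb la k) ! j"

definition cc :: "nat list \<Rightarrow> nat \<Rightarrow> nat \<Rightarrow> nat \<Rightarrow> nat" where
  "cc la k l j = tlam la (knode la k l j)"

text \<open>a_i = last entry of row i-1, b_i = last entry of row i of t^la.\<close>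
definition arow :: "nat list \<Rightarrow> nat \<Rightarrow> nat" where "arow la i = sum_list (take (i - 1) la)"
definition brow :: "nat list \<Rightarrow> nat \<Rightarrow> nat" where "brow la i = sum_list (take i la)"

definition Rrow :: "nat list \<Rightarrow> nat \<Rightarrow> fexp" where
  "Rrow la i = fsum (map (\<lambda>m. fT [arow la i..<m]) [arow la i..<brow la i])"

fun phi :: "nat list \<Rightarrow> nat \<Rightarrow> nat \<Rightarrow> nat \<Rightarrow> nat \<Rightarrow> fexp" where
  "phi la k l j 0 = FOne"
| "phi la k l j (Suc 0) = Rrow la (fst (knode la k l j) + 1)"
| "phi la k l j (Suc (Suc i)) =
     FMul (FAdd (fT [cc la k l j..<cc la k l j + Suc i * snd (knode la k l (Suc j))])
                (FScal (- qq) (phi la k l j (Suc i))))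
          (Rrow la (fst (knode la k l j) + Suc (Suc i)))"

definition Fj :: "nat list \<Rightarrow> nat \<Rightarrow> nat \<Rightarrow> nat \<Rightarrow> fexp" where
  "Fj la k l j = phi la k l j (fst (knode la k l (Suc j)) - fst (knode la k l j))"

definition rad :: "nat list \<Rightarrow> nat \<Rightarrow> nat \<Rightarrow> nat \<Rightarrow> int" where
  "rad la k l j = int l - int (snd (knode la k l j)) - (int k - int (fst (knode la k l j)))"

definition Xfac :: "nat list \<Rightarrow> nat \<Rightarrow> nat \<Rightarrow> nat \<Rightarrow> fexp" where
  "Xfac la k l j = FAdd (fT [cc la k l j..<cc la k l (Suc j)])
                        (FScal (inverse (qint (rad la k l (Suc j)))) (Fj la k l j))"

text \<open>The product X_0 X_1 ... X_{N-1}, so that tilde f_N = e_la X_0 ... X_{N-1}.\<close>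
definition ftil_expr :: "nat list \<Rightarrow> nat \<Rightarrow> nat \<Rightarrow> fexp" where
  "ftil_expr la k l = foldl FMul FOne (map (Xfac la k l) [0..<length (remb la k)])"

end

(* Modulo N = Nbar, e = e_lambda satisfies e T_i = q e inside the rows of t^lambda and two Garnir relations for
   consecutive rows. They hold because a vector that is a q-eigenvector for a Young subgroup is a multiple
   of its symmetrizer (the Poincare polynomial is nonzero), and the symmetrizer of a composition whose sorted
   version strictly dominates lambda generates an ideal inside N.
   By the first Garnir relation e L_m = r(m) e. Hence g_d = e (T_c + 1/[rho_c]) ... (T_(d-1) + 1/[rho_(d-1)]), with rho_i
   the radial distance from the node of i + 1 in t_i to (k, l), is a simultaneous eigenvector with the
   contents of t_d. The difference e_(t_n) - g_n is a combination of vectors g_d T_(d+1) ... T_(n-1), which are killed by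
   the product of L_n - r over the contents r of the row ends below row k, a product that divides E_(t_n);
   therefore f_n = e_(t_n) E_(t_n) = g_n.
   Multiplying out the factors of g_n row by row, using T_i = q inside the rows, gives T_sigma + F_j / [r_j]; the
   cross terms between consecutive rows of equal length vanish by the second Garnir relation. *)
theory Submission
  imports Defs "HOL-Library.Function_Algebras" "HOL-Library.Multiset"
begin

section \<open>Representations of the Hecke algebra\<close>

text \<open>The eigenvector statements hold only modulo N. The argument is therefore carried out for
  a vector \<open>e\<close> of an arbitrary module satisfying the three relations, and reaches
  x_\<lambda> through a projection with kernel N. The coefficients 1/[\<rho>_i] come from the mixed
  relations between T_i and the L_m: if g L_i = [\<rho>] g and g L_{i+1} = [b] g, then g (T_i + a)
  is an eigenvector of both L_i and L_{i+1}, with the eigenvalues exchanged, as soon as a ([\<rho>]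
  - [b]) = q^b, and this says a = 1/[\<rho> - b]. No denominator vanishes, because every entry after
  c in t^\<lambda> has smaller content than c. The general theory of seminormal bases is bypassed:
  every factor of E_{t_n} fixes g_n, and the factors with m = n suffice to kill the difference. The
  second Garnir relation moves an entry down, so it does not obviously lead to a more dominant
  shape. For two rows of equal length l it gives block sizes l - 1, l + 1, and an exchange of the
  two blocks, which is invertible and preserves N, puts the longer one on top.\<close>

lemma qq_power: "qq ^ k = Fract ([:0, 1:] ^ k) 1"
  by (induction k) (auto simp: qq_def One_fract_def)

lemma qq_nonzero [simp]: "qq \<noteq> 0"
  by (simp add: qq_def Zero_fract_def eq_fract)

lemma qq_power_eq_1_iff: "qq ^ k = 1 \<longleftrightarrow> k = 0"
proof
  assume "qq ^ k = 1"
  then have "[:0, 1::complex:] ^ k = 1"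
    by (simp add: qq_power One_fract_def eq_fract)
  then have "degree ([:0, 1::complex:] ^ k) = 0" by simp
  then show "k = 0" by (simp add: degree_power_eq)
qed simp

lemma qq_powi_eq_1_iff: "qq powi k = 1 \<longleftrightarrow> k = 0"
  by (cases k rule: int_cases4)
     (auto simp: power_int_minus qq_power_eq_1_iff inverse_eq_1_iff simp flip: of_nat_Suc)

lemma qq_neq_1 [simp]: "qq \<noteq> 1"
  using qq_power_eq_1_iff[of 1] by simp

lemma qint_eq_0_iff [simp]: "qint k = 0 \<longleftrightarrow> k = 0"
  by (simp add: qint_def qq_powi_eq_1_iff)

text \<open>q is not a root of unity, so residues and contents determine each other; contents, being
  integers, can then be compared by inequalities.\<close>

lemma qint_eq_iff [simp]: "qint a = qint b \<longleftrightarrow> a = b"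
proof
  assume "qint a = qint b"
  then have "qq powi a = qq powi b" by (simp add: qint_def)
  then have "qq powi (a - b) = 1" by (simp add: power_int_diff)
  then show "a = b" by (simp add: qq_powi_eq_1_iff)
qed simp

lemma qint_0 [simp]: "qint 0 = 0" by simp

lemma qint_add_1: "qint (k + 1) = qq * qint k + 1"
  by (simp add: qint_def power_int_add field_simps)

lemma qint_minus_1: "qint (k - 1) = inverse qq * (qint k - 1)"
  using qint_add_1[of "k - 1"] by (simp add: field_simps)

lemma qint_times: "(qq - 1) * qint k + 1 = qq powi k"
  by (simp add: qint_def)

lemma qint_diff: "qint a - qint b = qq powi b * qint (a - b)"
  by (simp add: qint_def power_int_diff divide_simps)

text \<open>Linearity is separated from the Hecke relations because linearity of right and left
  multiplication is used in the proof that right multiplication satisfies those relations.\<close>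

locale linear_ops = vector_space scale
  for scale :: "K \<Rightarrow> 'v::ab_group_add \<Rightarrow> 'v" (infixr "*s" 75) +
  fixes T :: "nat \<Rightarrow> 'v \<Rightarrow> 'v"
  assumes T_add: "T i (x + y) = T i x + T i y"
    and T_scale: "T i (c *s x) = c *s T i x"
begin

lemma T_0 [simp]: "T i 0 = 0"
  using T_scale[of i 0 0] by simp

lemma T_diff: "T i (x - y) = T i x - T i y"
  using T_add[of i "x - y" y] by (simp add: algebra_simps)

lemma T_minus: "T i (- y) = - T i y"
  using T_diff[of i 0 y] by simp

lemma T_sum: "T i (\<Sum>j\<in>A. f j) = (\<Sum>j\<in>A. T i (f j))"
  by (induction A rule: infinite_finite_induct) (auto simp: T_add)

lemmas T_linear = T_add T_scale T_diff T_minus T_sum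
lemmas vec_simps = scale_right_distrib scale_left_distrib scale_right_diff_distrib scale_left_diff_distrib
  scale_sum_right

lemma fold_T_add: "fold T w (x + y) = fold T w x + fold T w y"
  by (induction w arbitrary: x y) (auto simp: T_add)

lemma fold_T_scale: "fold T w (c *s x) = c *s fold T w x"
  by (induction w arbitrary: x) (auto simp: T_scale)

lemma fold_T_0 [simp]: "fold T w 0 = 0"
  by (induction w) auto

lemma fold_T_minus: "fold T w (- x) = - fold T w x"
  by (induction w arbitrary: x) (auto simp: T_minus)

lemma fold_T_diff: "fold T w (x - y) = fold T w x - fold T w y"
  by (induction w arbitrary: x y) (auto simp: T_diff)

lemma fold_T_sum: "fold T w (\<Sum>j\<in>A. f j) = (\<Sum>j\<in>A. fold T w (f j))"
  by (induction A rule: infinite_finite_induct) (auto simp: fold_T_add)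

lemmas fold_T_linear = fold_T_add fold_T_scale fold_T_diff fold_T_minus fold_T_sum

end

text \<open>A right module: \<open>T i x\<close> stands for x T_i, so \<open>fold T w x\<close>
  multiplies by the letters of \<open>w\<close> from left to right. The relations are imposed only
  for 1 \<le> i < n; an operator with another index is just linear.\<close>

locale hecke_rep = linear_ops scale T
  for scale :: "K \<Rightarrow> 'v::ab_group_add \<Rightarrow> 'v" (infixr "*s" 75) and n :: nat and T +
  assumes T_quad: "1 \<le> i \<Longrightarrow> i < n \<Longrightarrow> T i (T i x) = (qq - 1) *s T i x + qq *s x"
    and T_comm: "1 \<le> i \<Longrightarrow> Suc i < j \<Longrightarrow> j < n \<Longrightarrow> T i (T j x) = T j (T i x)"
    and T_braid: "1 \<le> i \<Longrightarrow> Suc i < n \<Longrightarrow> T i (T (Suc i) (T i x)) = T (Suc i) (T i (T (Suc i) x))"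
begin

lemma T_comm': "1 \<le> i \<Longrightarrow> 1 \<le> j \<Longrightarrow> i < n \<Longrightarrow> j < n \<Longrightarrow> j \<noteq> Suc i \<Longrightarrow> i \<noteq> Suc j \<Longrightarrow> T i (T j x) = T j (T i x)"
  by (cases "i = j"; cases "i < j") (auto intro: T_comm T_comm[symmetric])

lemma T_fold_T_commute:
  assumes "1 \<le> i" "i < n" "\<And>j. j \<in> set w \<Longrightarrow> 1 \<le> j \<and> j < n \<and> j \<noteq> Suc i \<and> i \<noteq> Suc j"
  shows "T i (fold T w x) = fold T w (T i x)"
  using assms(3) by (induction w arbitrary: x) (auto simp: T_comm'[OF assms(1) _ assms(2)])

primrec act :: "fexp \<Rightarrow> 'v \<Rightarrow> 'v" where
  "act FOne x = x"
| "act (FGen i) x = T i x"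
| "act (FScal c e) x = c *s act e x"
| "act (FAdd a b) x = act a x + act b x"
| "act (FMul a b) x = act b (act a x)"

lemma act_add: "act e (x + y) = act e x + act e y"
  by (induction e arbitrary: x y) (auto simp: T_add vec_simps)

lemma act_scale: "act e (c *s x) = c *s act e x"
  by (induction e arbitrary: x) (auto simp: T_scale vec_simps mult.commute)

lemma act_0 [simp]: "act e 0 = 0"
  using act_scale[of e 0 0] by simp

lemma act_sum: "act e (\<Sum>j\<in>A. f j) = (\<Sum>j\<in>A. act e (f j))"
  by (induction A rule: infinite_finite_induct) (auto simp: act_add)

lemma act_fT: "act (fT w) x = fold T w x"
  by (induction w arbitrary: x) (auto simp: fT_def)

lemma act_fsum: "act (fsum es) x = (\<Sum>e\<leftarrow>es. act e x)"
  by (induction es rule: fsum.induct) auto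

text \<open>The Jucys-Murphy elements by L_1 = 0 and q L_{m+1} = T_m L_m T_m + T_m. This form makes
  sense in every module; \<open>hmul_Lop\<close> identifies it with the sum over
  transpositions.\<close>

fun L :: "nat \<Rightarrow> 'v \<Rightarrow> 'v" where
  "L 0 x = 0"
| "L (Suc 0) x = 0"
| "L (Suc (Suc m)) x = inverse qq *s (T (Suc m) (L (Suc m) (T (Suc m) x)) + T (Suc m) x)"

lemma L_Suc: "1 \<le> m \<Longrightarrow> L (Suc m) x = inverse qq *s (T m (L m (T m x)) + T m x)"
  by (cases m) auto

lemma L_add: "L m (x + y) = L m x + L m y"
proof (induction m arbitrary: x y)
  case (Suc m)
  then show ?case
    by (cases m) (simp_all add: L_Suc T_add vec_simps)
qed simp

lemma L_scale: "L m (c *s x) = c *s L m x"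
proof (induction m arbitrary: x)
  case (Suc m)
  then show ?case
    by (cases m) (simp_all add: L_Suc T_scale vec_simps mult.commute)
qed simp

lemma L_0 [simp]: "L m 0 = 0"
  using L_scale[of m 0 0] by simp

lemma L_diff: "L m (x - y) = L m x - L m y"
  using L_add[of m "x - y" y] by (simp add: algebra_simps)

lemma L_sum: "L m (\<Sum>j\<in>A. f j) = (\<Sum>j\<in>A. L m (f j))"
  by (induction A rule: infinite_finite_induct) (auto simp: L_add)

lemma L_T_comm_above:
  "1 \<le> m \<Longrightarrow> m < i \<Longrightarrow> i < n \<Longrightarrow> L m (T i x) = T i (L m x)"
proof (induction m arbitrary: x)
  case (Suc m)
  show ?case
  proof (cases m)
    case (Suc k)
    then show ?thesis
      using Suc.prems Suc.IH by (simp add: L_Suc T_scale T_add T_comm'[of _ i])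
  qed simp
qed simp

text \<open>The recursion for L settles every case except L_{i+2}. That one is expanded down to L_i:
  since T_{i+1} commutes with L_i, the braid relation carries T_i across the leading term.\<close>

lemma L_T_comm_below:
  "1 \<le> i \<Longrightarrow> Suc i < m \<Longrightarrow> m \<le> n \<Longrightarrow> L m (T i x) = T i (L m x)"
proof (induction m arbitrary: x)
  case (Suc m)
  have [simp]: "qq * (inverse qq * c) = c" for c by (simp add: field_simps)
  show ?case
  proof (cases "m = Suc i")
    case False
    then show ?thesis
      using Suc.prems Suc.IH by (simp add: L_Suc T_scale T_add T_comm'[of _ i])
  next
    case m: True
    have br: "T i (T m (T i y)) = T m (T i (T m y))" for y
      using Suc.prems m T_braid[of i y] by simp
    have lc: "L i (T m y) = T m (L i y)" for y
      using Suc.prems m by (intro L_T_comm_above) auto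
    have quad: "T i (T i y) = (qq - 1) *s T i y + qq *s y" "T m (T m y) = (qq - 1) *s T m y + qq *s y" for y
      using Suc.prems m by (auto intro!: T_quad)
    have Lm: "L m y = inverse qq *s (T i (L i (T i y)) + T i y)" for y
      using m Suc.prems by (simp add: L_Suc)
    have LS: "L (Suc m) y = inverse qq *s (T m (L m (T m y)) + T m y)" for y
      using m by (simp add: L_Suc)
    have "T m (T i (L i (T i (T m (T i x))))) = T i (T m (T i (L i (T i (T m x)))))"
      by (simp add: br lc)
    \<comment> \<open>The terms without L_i: by the braid and quadratic relations both sides are the
      same combination of products of three and two generators, symmetric in T_i and T_m.\<close>
    moreover have "inverse qq *s T m (T i (T m (T i x))) + T m (T i x) = inverse qq *s T i (T m (T i (T m x))) + T i (T m x)"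
    proof -
      have "T m (T i (T m (T i x))) = T m (T m (T i (T m x)))" by (simp add: br)
      also have "\<dots> = (qq - 1) *s T m (T i (T m x)) + qq *s T i (T m x)" by (simp add: quad)
      finally have 1: "T m (T i (T m (T i x))) = (qq - 1) *s T m (T i (T m x)) + qq *s T i (T m x)" .
      have "T i (T m (T i (T m x))) = T m (T i (T m (T m x)))" by (simp add: br)
      also have "\<dots> = (qq - 1) *s T m (T i (T m x)) + qq *s T m (T i x)" by (simp add: quad T_linear)
      finally have 2: "T i (T m (T i (T m x))) = (qq - 1) *s T m (T i (T m x)) + qq *s T m (T i x)" .
      show ?thesis unfolding 1 2 by (simp add: vec_simps)
    qed
    moreover have "L (Suc m) (T i x) = inverse qq *s (inverse qq *s T m (T i (L i (T i (T m (T i x)))))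
        + (inverse qq *s T m (T i (T m (T i x))) + T m (T i x)))"
      by (simp only: LS Lm T_add T_scale scale_right_distrib add.assoc)
    moreover have "T i (L (Suc m) x) = inverse qq *s (inverse qq *s T i (T m (T i (L i (T i (T m x)))))
        + (inverse qq *s T i (T m (T i (T m x))) + T i (T m x)))"
      by (simp only: LS Lm T_add T_scale scale_right_distrib add.assoc)
    ultimately show ?thesis
      by simp
  qed
qed simp

lemma L_T_comm:
  "1 \<le> i \<Longrightarrow> i < n \<Longrightarrow> m \<le> n \<Longrightarrow> m \<noteq> i \<Longrightarrow> m \<noteq> Suc i \<Longrightarrow> L m (T i x) = T i (L m x)"
  by (cases "m = 0"; cases "m < i") (auto intro: L_T_comm_above L_T_comm_below)

text \<open>T_i intertwines L_i and L_{i+1} up to lower terms, which the quadratic relation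
  produces. These terms determine the coefficients of the seminormal vectors.\<close>

lemma L_Suc_T:
  assumes "1 \<le> i" "i < n"
  shows "L (Suc i) (T i x) = T i (L i x) + x + (qq - 1) *s L (Suc i) x"
proof -
  have "L (Suc i) (T i x) = inverse qq *s ((qq - 1) *s T i (L i (T i x)) + qq *s T i (L i x) + ((qq - 1) *s T i x + qq *s x))"
    using assms by (simp add: L_Suc T_quad T_add T_scale L_add L_scale)
  also have "\<dots> = T i (L i x) + x + (qq - 1) *s L (Suc i) x"
    using assms by (simp add: L_Suc scale_right_distrib ac_simps)
  finally show ?thesis .
qed

lemma L_T:
  assumes "1 \<le> i" "i < n"
  shows "L i (T i x) = T i (L (Suc i) x) - (qq - 1) *s L (Suc i) x - x"
proof -
  have "T i (L (Suc i) x) = inverse qq *s ((qq - 1) *s T i (L i (T i x)) + qq *s L i (T i x) + ((qq - 1) *s T i x + qq *s x))"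
    using assms by (simp add: L_Suc T_quad T_add T_scale)
  also have "\<dots> = (qq - 1) *s L (Suc i) x + L i (T i x) + x"
    using assms by (simp add: L_Suc scale_right_distrib ac_simps)
  finally show ?thesis
    by (simp add: algebra_simps)
qed

lemma L_L_comm: "1 \<le> m \<Longrightarrow> m < k \<Longrightarrow> k \<le> n \<Longrightarrow> L k (L m x) = L m (L k x)"
proof (induction m arbitrary: x)
  case (Suc m)
  then show ?case
    by (cases m) (auto simp: L_Suc L_scale L_add L_T_comm_below)
qed simp

end

section \<open>Partitions and Garnir elements\<close>

abbreviation psum :: "nat list \<Rightarrow> nat \<Rightarrow> nat" where
  "psum la r \<equiv> sum_list (take r la)"

lemma psum_Suc: "r < length la \<Longrightarrow> psum la (Suc r) = psum la r + la ! r"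
  by (simp add: take_Suc_conv_app_nth)

lemma psum_mono: "r \<le> r' \<Longrightarrow> psum la r \<le> psum la r'"
  by (metis le_add1 le_Suc_ex sum_list_append take_add)

definition econt :: "nat list \<Rightarrow> nat \<Rightarrow> int" where
  "econt la m = (let x = inv_into (nodes la) (tlam la) m in int (snd x) - int (fst x))"

locale partition =
  fixes n :: nat and la :: "nat list"
  assumes part: "is_partition n la"
begin

lemma parts_pos: "r < length la \<Longrightarrow> 0 < la ! r"
  using part by (auto simp: is_partition_def)

lemma parts_antimono: "r \<le> r' \<Longrightarrow> r' < length la \<Longrightarrow> la ! r' \<le> la ! r"
  using part by (cases "r = r'") (auto simp: is_partition_def sorted_wrt_iff_nth_less)

lemma psum_length: "psum la (length la) = n"
  using part by (simp add: is_partition_def)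

lemma psum_le: "psum la r \<le> n"
  using psum_mono[of r "max r (length la)" la] psum_length by (simp add: max_def split: if_splits)

lemma psum_strict_mono: "r < r' \<Longrightarrow> r' \<le> length la \<Longrightarrow> psum la r < psum la r'"
  using psum_mono[of "Suc r" r' la] psum_Suc[of r la] parts_pos[of r] by simp

lemma psum_less_iff: "r \<le> length la \<Longrightarrow> r' \<le> length la \<Longrightarrow> psum la r < psum la r' \<longleftrightarrow> r < r'"
  by (metis linorder_not_less psum_mono psum_strict_mono)

lemma entry_cases:
  assumes "1 \<le> m" "m \<le> n"
  obtains r s where "r < length la" "1 \<le> s" "s \<le> la ! r" "m = psum la r + s"
proof -
  have "\<exists>r<length la. \<exists>s. 1 \<le> s \<and> s \<le> la ! r \<and> m = psum la r + s" if "m \<le> psum la k" "k \<le> length la" for k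
    using that
  proof (induction k)
    case (Suc k)
    show ?case
    proof (cases "m \<le> psum la k")
      case False
      then show ?thesis
        using Suc.prems by (intro exI[of _ k] conjI exI[of _ "m - psum la k"]) (auto simp: psum_Suc)
    qed (use Suc in auto)
  qed (use assms in auto)
  from this[of "length la"] show thesis
    using assms psum_length that by auto
qed

lemma row_unique:
  assumes "r < length la" "r' < length la" "psum la r < m" "m \<le> psum la (Suc r)" "psum la r' < m" "m \<le> psum la (Suc r')"
  shows "r = r'"
  using psum_mono[of "Suc r" r' la] psum_mono[of "Suc r'" r la] assms
  by (cases r r' rule: linorder_cases) auto

lemma nodes_iff: "(r, s) \<in> nodes la \<longleftrightarrow> 1 \<le> r \<and> r \<le> length la \<and> 1 \<le> s \<and> s \<le> la ! (r - 1)"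
  by (auto simp: nodes_def)

lemma tlam_node: "(Suc r, s) \<in> nodes la \<Longrightarrow> tlam la (Suc r, s) = psum la r + s"
  by (simp add: tlam_def)

lemma tlam_bij: "bij_betw (tlam la) (nodes la) {1..n}"
proof (rule bij_betwI')
  fix x y assume xy: "x \<in> nodes la" "y \<in> nodes la"
  obtain r s r' s' where [simp]: "x = (Suc r, s)" "y = (Suc r', s')"
    using xy by (cases x; cases y; cases "fst x"; cases "fst y") (auto simp: nodes_def)
  show "tlam la x = tlam la y \<longleftrightarrow> x = y"
  proof
    assume eq: "tlam la x = tlam la y"
    have "r = r'"
      by (rule row_unique[of _ _ "tlam la x"])
         (use xy eq in \<open>simp_all add: tlam_node[of _ s] psum_Suc nodes_iff\<close>, simp_all add: tlam_def nodes_iff psum_Suc)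
    then show "x = y" using eq xy by (simp add: tlam_node)
  qed simp
next
  fix x assume x: "x \<in> nodes la"
  then obtain r s where [simp]: "x = (Suc r, s)"
    by (cases x; cases "fst x") (auto simp: nodes_def)
  have "psum la (Suc r) \<le> n" by (rule psum_le)
  then show "tlam la x \<in> {1..n}"
    using x by (auto simp: tlam_node nodes_iff psum_Suc)
next
  fix m assume "m \<in> {1..n}"
  then obtain r s where "r < length la" "1 \<le> s" "s \<le> la ! r" "m = psum la r + s"
    by (elim entry_cases[of m, rotated 2]) auto
  then show "\<exists>x\<in>nodes la. m = tlam la x"
    by (intro bexI[of _ "(Suc r, s)"]) (auto simp: tlam_node nodes_iff)
qed

lemma tlam_inv: "r < length la \<Longrightarrow> 1 \<le> s \<Longrightarrow> s \<le> la ! r \<Longrightarrow> inv_into (nodes la) (tlam la) (psum la r + s) = (Suc r, s)"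
  using tlam_bij inv_into_f_eq[of "tlam la" "nodes la" "(Suc r, s)"]
  by (auto simp: bij_betw_def nodes_iff tlam_node)

lemma econt_entry: "r < length la \<Longrightarrow> 1 \<le> s \<Longrightarrow> s \<le> la ! r \<Longrightarrow> econt la (psum la r + s) = int s - int r - 1"
  by (simp add: econt_def tlam_inv)

lemma econt_row_end: "r < length la \<Longrightarrow> econt la (psum la (Suc r)) = int (la ! r) - int r - 1"
  using econt_entry[of r "la ! r"] parts_pos[of r] by (simp add: psum_Suc)

text \<open>Going down one row, the length does not grow and the row index does, so the contents of
  the row ends strictly decrease.\<close>

lemma econt_row_end_inj:
  assumes "r < length la" "r' < length la" "econt la (psum la (Suc r)) = econt la (psum la (Suc r'))"
  shows "r = r'"
  using assms parts_antimono[of r r'] parts_antimono[of r' r]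
  by (cases r r' rule: linorder_cases) (auto simp: econt_row_end)

text \<open>An entry after the end of row k lies in a lower row that is not longer. This makes all
  the radial distances in denominators positive.\<close>

lemma econt_below:
  assumes "1 \<le> k" "k \<le> length la" "psum la k < m" "m \<le> n"
  shows "econt la m < econt la (psum la k)"
proof -
  obtain r s where rs: "r < length la" "1 \<le> s" "s \<le> la ! r" "m = psum la r + s"
    using assms by (elim entry_cases[of m, rotated 2]) auto
  have "psum la k < psum la (Suc r)"
    using rs assms by (simp add: psum_Suc)
  then have "k \<le> r"
    using psum_less_iff[of k "Suc r"] rs assms by simp
  moreover obtain k' where [simp]: "k = Suc k'" using assms by (cases k) auto
  ultimately show ?thesis
    using rs assms parts_antimono[of k' r] by (simp add: econt_entry econt_row_end)
qed

end

section \<open>Garnir sums and the Jucys-Murphy eigenvalue of a new row\<close>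

context hecke_rep
begin

text \<open>The word is that of a cycle, and conjugation by the cycle shifts the generators it
  covers by one; a single braid relation does it, all other letters being far away.\<close>

lemma T_fold_rev_upt:
  assumes "1 \<le> j" "j < i" "i < m" "m \<le> n"
  shows "T i (fold T (rev [j..<m]) x) = fold T (rev [j..<m]) (T (i - 1) x)"
proof -
  obtain h where h: "i = Suc h" using assms by (cases i) auto
  have split: "[j..<m] = [j..<h] @ [h, i] @ [Suc i..<m]"
    using assms h upt_add_eq_append[of j h "m - h"] by (simp add: upt_conv_Cons)
  have "T h (fold T (rev [Suc i..<m]) y) = fold T (rev [Suc i..<m]) (T h y)" for y
    using assms h by (intro T_fold_T_commute) auto
  moreover have "T i (fold T (rev [j..<h]) y) = fold T (rev [j..<h]) (T i y)" for y
    using assms h by (intro T_fold_T_commute) auto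
  ultimately show ?thesis
    unfolding split using assms h T_braid[of h, symmetric] by simp
qed

lemma T_fold_upt:
  assumes "1 \<le> j" "j \<le> i" "Suc i < m" "m \<le> n"
  shows "T i (fold T [j..<m] x) = fold T [j..<m] (T (Suc i) x)"
proof -
  have split: "[j..<m] = [j..<i] @ [i, Suc i] @ [Suc (Suc i)..<m]"
    using assms upt_add_eq_append[of j i "m - i"] by (simp add: upt_conv_Cons)
  have "T i (fold T [Suc (Suc i)..<m] y) = fold T [Suc (Suc i)..<m] (T i y)" for y
    using assms by (intro T_fold_T_commute) auto
  moreover have "T (Suc i) (fold T [j..<i] y) = fold T [j..<i] (T (Suc i) y)" for y
    using assms by (intro T_fold_T_commute) auto
  ultimately show ?thesis
    unfolding split using assms T_braid[of i] by simp
qed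

text \<open>The two exceptional summands have the form y and y T_i, and y (1 + T_i) is multiplied by
  q by the quadratic relation. Both orientations are allowed since descending and ascending Garnir
  words order the pair differently.\<close>

lemma T_eigen_sum:
  assumes i: "1 \<le> i" "i < n" and A: "finite A" "i \<in> A" "Suc i \<in> A"
    and other: "\<And>j. j \<in> A \<Longrightarrow> j \<noteq> i \<Longrightarrow> j \<noteq> Suc i \<Longrightarrow> T i (f j) = qq *s f j"
    and pair: "T i (f i) = f (Suc i) \<or> T i (f (Suc i)) = f i"
  shows "T i (\<Sum>j\<in>A. f j) = qq *s (\<Sum>j\<in>A. f j)"
proof -
  have sp: "(\<Sum>j\<in>A. h j) = h i + (h (Suc i) + (\<Sum>j\<in>A - {i} - {Suc i}. h j))" for h :: "nat \<Rightarrow> 'v"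
    using A by (subst sum.remove[of A i], simp, simp, subst sum.remove[of _ "Suc i"]) auto
  have "T i (\<Sum>j\<in>A - {i} - {Suc i}. f j) = qq *s (\<Sum>j\<in>A - {i} - {Suc i}. f j)"
    by (simp add: T_sum scale_sum_right other)
  moreover have "T i (f i) + T i (f (Suc i)) = qq *s f i + qq *s f (Suc i)"
    using pair
  proof
    assume eq: "T i (f i) = f (Suc i)"
    show ?thesis using T_quad[OF i, of "f i"] by (simp add: eq scale_left_diff_distrib)
  next
    assume eq: "T i (f (Suc i)) = f i"
    show ?thesis using T_quad[OF i, of "f (Suc i)"] by (simp add: eq scale_left_diff_distrib)
  qed
  ultimately show ?thesis
    by (subst (1 2) sp) (simp add: T_add scale_right_distrib add.assoc[symmetric])
qed

text \<open>The words s_{m-1} ... s_j run through coset representatives of the symmetric group on p,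
  ..., m - 1 in the one on p, ..., m. The Garnir sum thus extends the symmetry of x from a block to
  the block with \<open>m\<close> appended.\<close>

lemma garnir_down_eigen:
  assumes "1 \<le> p" "m \<le> n" "p \<le> i" "i < m" and row: "\<And>i. p \<le> i \<Longrightarrow> Suc i < m \<Longrightarrow> T i x = qq *s x"
  shows "T i (\<Sum>j=p..m. fold T (rev [j..<m]) x) = qq *s (\<Sum>j=p..m. fold T (rev [j..<m]) x)"
proof (rule T_eigen_sum)
  fix j assume j: "j \<in> {p..m}" "j \<noteq> i" "j \<noteq> Suc i"
  show "T i (fold T (rev [j..<m]) x) = qq *s fold T (rev [j..<m]) x"
  proof (cases "j < i")
    case True
    then have "T i (fold T (rev [j..<m]) x) = fold T (rev [j..<m]) (T (i - 1) x)"
      using assms j by (intro T_fold_rev_upt) auto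
    also have "T (i - 1) x = qq *s x"
      using True assms j by (intro row) auto
    finally show ?thesis by (simp add: fold_T_scale)
  next
    case False
    then have "T i (fold T (rev [j..<m]) x) = fold T (rev [j..<m]) (T i x)"
      using assms j by (intro T_fold_T_commute) auto
    also have "T i x = qq *s x"
      using False assms j by (intro row) auto
    finally show ?thesis by (simp add: fold_T_scale)
  qed
qed (use assms in \<open>auto simp: upt_rec[of i]\<close>)

text \<open>The mirror image: the coset representatives s_a ... s_{j-1} extend the block a + 1, ...,
  b by the entry \<open>a\<close> in front.\<close>

lemma garnir_up_eigen:
  assumes "1 \<le> a" "b \<le> n" "a \<le> i" "i < b" and row: "\<And>i. a < i \<Longrightarrow> i < b \<Longrightarrow> T i x = qq *s x"
  shows "T i (\<Sum>j=a..b. fold T [a..<j] x) = qq *s (\<Sum>j=a..b. fold T [a..<j] x)"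
proof (rule T_eigen_sum)
  fix j assume j: "j \<in> {a..b}" "j \<noteq> i" "j \<noteq> Suc i"
  show "T i (fold T [a..<j] x) = qq *s fold T [a..<j] x"
  proof (cases "i < j")
    case True
    then have "T i (fold T [a..<j] x) = fold T [a..<j] (T (Suc i) x)"
      using assms j by (intro T_fold_upt) auto
    also have "T (Suc i) x = qq *s x"
      using True assms j by (intro row) auto
    finally show ?thesis by (simp add: fold_T_scale)
  next
    case False
    then have "T i (fold T [a..<j] x) = fold T [a..<j] (T i x)"
      using assms j by (intro T_fold_T_commute) auto
    also have "T i x = qq *s x"
      using False assms j by (intro row) auto
    finally show ?thesis by (simp add: fold_T_scale)
  qed
qed (use assms in auto)

lemma L_row_step:
  assumes "1 \<le> m" "L m x = qint k *s x" "T m x = qq *s x"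
  shows "L (Suc m) x = qint (k + 1) *s x"
  using assms by (simp add: L_Suc L_scale T_scale qint_add_1 vec_simps)

text \<open>The vectors v_j = x T_(m-1) ... T_j satisfy v_j L_j = [k] v_j + const (v_p + ... + v_(j-1)); for j = m
  the Garnir relation evaluates the sum to - x.\<close>
lemma L_row_change:
  assumes "1 \<le> p" "p < m" "m \<le> n" and row: "\<And>i. p \<le> i \<Longrightarrow> Suc i < m \<Longrightarrow> T i x = qq *s x"
    and Lp: "L p x = qint k *s x" and garnir: "(\<Sum>j=p..m. fold T (rev [j..<m]) x) = 0"
  shows "L m x = qint (k - 1) *s x"
proof -
  define v where "v j = fold T (rev [j..<m]) x" for j
  \<comment> \<open>This is q^{k-1} = [k] - [k-1], the amount by which the eigenvalue has to
    drop.\<close>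
  define c where "c = inverse qq * (1 + (qq - 1) * qint k)"
  have v_Suc: "T j (v (Suc j)) = v j" if "j < m" for j
    using that by (simp add: v_def upt_rec[of j])
  have vm: "v m = x" by (simp add: v_def)
  have sum0: "v p + (\<Sum>j=Suc p..m. v j) = 0"
    using garnir assms by (simp add: v_def sum.atLeast_Suc_atMost)
  have commute: "L p (v j) = qint k *s v j" if "p < j" "j \<le> m" for j
    using that
  proof (induction "m - j" arbitrary: j)
    case 0
    then show ?case using vm Lp by simp
  next
    case (Suc d)
    then have "L p (v (Suc j)) = qint k *s v (Suc j)" by (intro Suc.hyps) auto
    moreover have "L p (T j (v (Suc j))) = T j (L p (v (Suc j)))"
      using Suc assms by (intro L_T_comm_above) auto
    ultimately show ?case using v_Suc[of j] Suc by (simp add: T_scale)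
  qed
  have down: "T j (v i) = qq *s v i" if "p \<le> i" "i < j" "j < m" for i j
  proof -
    have "T j (v i) = fold T (rev [i..<m]) (T (j - 1) x)"
      unfolding v_def using that assms by (intro T_fold_rev_upt) auto
    also have "T (j - 1) x = qq *s x" using that by (intro row) auto
    finally show ?thesis by (simp add: v_def fold_T_scale)
  qed
  have "L j (v j) = qint k *s v j + c *s (\<Sum>i=p..<j. v i)" if "p \<le> j" "j \<le> m" for j
    using that
  proof (induction j rule: dec_induct)
    case base
    \<comment> \<open>L_p commutes with T_j for j > p but not with T_p, so v_p is out of reach of
      \<open>commute\<close>. The Garnir relation rewrites it in terms of the other v_j, all of
      which have eigenvalue [k].\<close>
    have vp: "v p = - (\<Sum>j=Suc p..m. v j)"
      using sum0 by (simp add: eq_neg_iff_add_eq_0)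
    have "L p (v p) = - (\<Sum>j=Suc p..m. L p (v j))"
      unfolding vp using L_diff[of p 0] by (simp add: L_sum)
    also have "\<dots> = - (\<Sum>j=Suc p..m. qint k *s v j)"
      using commute by simp
    also have "\<dots> = qint k *s v p"
      unfolding vp by (simp add: scale_sum_right)
    finally show ?case by simp
  next
    case (step j)
    have "L (Suc j) (v (Suc j)) = inverse qq *s (T j (L j (v j)) + v j)"
      using step assms v_Suc[of j] by (simp add: L_Suc)
    also have "L j (v j) = qint k *s v j + c *s (\<Sum>i=p..<j. v i)"
      using step by simp
    also have "T j \<dots> = qint k *s T j (T j (v (Suc j))) + c *s (\<Sum>i=p..<j. qq *s v i)"
      using step down by (simp add: T_linear v_Suc)
    also have "T j (T j (v (Suc j))) = (qq - 1) *s v j + qq *s v (Suc j)"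
      using step assms v_Suc[of j] T_quad[of j "v (Suc j)"] by simp
    also have "inverse qq *s (qint k *s ((qq - 1) *s v j + qq *s v (Suc j)) + c *s (\<Sum>i=p..<j. qq *s v i) + v j)
      = qint k *s v (Suc j) + (c *s v j + c *s (\<Sum>i=p..<j. v i))"
    proof -
      have "inverse qq *s (qint k *s ((qq - 1) *s v j + qq *s v (Suc j)) + c *s (\<Sum>i=p..<j. qq *s v i) + v j)
        = (inverse qq * (qint k * (qq - 1)) + inverse qq) *s v j + (inverse qq * (qint k * qq)) *s v (Suc j)
          + (inverse qq * (c * qq)) *s (\<Sum>i=p..<j. v i)"
        by (simp only: scale_sum_right[symmetric] scale_right_distrib scale_left_distrib scale_scale ac_simps)
      also have "inverse qq * (qint k * (qq - 1)) + inverse qq = c" by (simp add: c_def algebra_simps)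
      also have "inverse qq * (qint k * qq) = qint k" by simp
      also have "inverse qq * (c * qq) = c" by simp
      finally show ?thesis by (simp add: ac_simps)
    qed
    also have "c *s v j + c *s (\<Sum>i=p..<j. v i) = c *s (\<Sum>i=p..<Suc j. v i)"
      using step by (simp add: scale_right_distrib add.commute)
    finally show ?case .
  qed
  from this[of m] have "L m x = qint k *s x + c *s (\<Sum>i=p..<m. v i)"
    using assms vm by simp
  also have "(\<Sum>i=p..<m. v i) = - x"
    using garnir assms unfolding v_def[symmetric]
    by (simp add: atLeastLessThanSuc_atLeastAtMost[symmetric] vm eq_neg_iff_add_eq_0)
  also have "qint k *s x + c *s (- x) = (qint k - c) *s x"
    by (simp add: scale_left_diff_distrib)
  also have "qint k - c = qint (k - 1)"
    unfolding qint_minus_1 c_def by (simp add: field_simps)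
  finally show ?thesis .
qed

end

section \<open>Seminormal vectors\<close>

text \<open>\<open>e\<close> models the class of x_\<lambda> modulo N. Rows are counted from 0 by
  \<open>r\<close> but from 1 by \<open>k\<close>, so \<open>psum la k\<close> is the last entry of
  row k. \<open>garnir_down\<close> lets the first entry of the lower row move up and yields the
  eigenvalues of the L_m on e; \<open>garnir_up\<close> lets the last entry of the upper row move
  down and removes the cross terms between equal rows.\<close>

locale seminormal = hecke_rep scale n T + partition n la
  for scale :: "K \<Rightarrow> 'v::ab_group_add \<Rightarrow> 'v" (infixr "*s" 75) and n T la +
  fixes e :: 'v and k :: nat
  assumes row: "r < length la \<Longrightarrow> psum la r < i \<Longrightarrow> i < psum la (Suc r) \<Longrightarrow> T i e = qq *s e"
    and garnir_down: "Suc r < length la \<Longrightarrow>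
      (\<Sum>j=psum la r + 1..psum la (Suc r) + 1. fold T (rev [j..<psum la (Suc r) + 1]) e) = 0"
    and garnir_up: "Suc r < length la \<Longrightarrow> la ! Suc r = la ! r \<Longrightarrow>
      (\<Sum>j=psum la (Suc r)..psum la (Suc (Suc r)). fold T [psum la (Suc r)..<j] e) = 0"
    and k: "1 \<le> k" "k \<le> length la"
begin

definition "c = psum la k"
definition "\<rho> = econt la c"

lemma c_bounds: "1 \<le> c" "c \<le> n"
  using psum_strict_mono[of 0 k] psum_le[of k] k by (auto simp: c_def)

lemma rho_greater: "c < m \<Longrightarrow> m \<le> n \<Longrightarrow> econt la m < \<rho>"
  unfolding c_def \<rho>_def using econt_below k by blast

text \<open>Along a row the content grows by one, because T_i acts by q. From the first entry of a
  row to the first entry of the next it drops by one, by \<open>L_row_change\<close>.\<close>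

lemma L_e: "1 \<le> m \<Longrightarrow> m \<le> n \<Longrightarrow> L m e = qint (econt la m) *s e"
proof -
  have row_step: "L (psum la r + s) e = qint (econt la (psum la r + s)) *s e"
    if "r < length la" "1 \<le> s" "s \<le> la ! r" "L (psum la r + 1) e = qint (- int r) *s e" for r s
    using that(2,3)
  proof (induction s rule: dec_induct)
    case base
    then show ?case using that econt_entry[of r 1] by simp
  next
    case (step s)
    have "L (Suc (psum la r + s)) e = qint (econt la (psum la r + s) + 1) *s e"
      using step that by (intro L_row_step row[of r]) (auto simp: psum_Suc)
    then show ?case
      using step that econt_entry[of r "Suc s"] by (simp add: econt_entry)
  qed
  have first: "L (psum la r + 1) e = qint (- int r) *s e" if "r < length la" for r
    using that
  proof (induction r)
    case (Suc r)
    have "L (psum la (Suc r) + 1) e = qint (- int r - 1) *s e"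
    proof (rule L_row_change)
      show "psum la (Suc r) + 1 \<le> n"
        using psum_strict_mono[of "Suc r" "Suc (Suc r)"] psum_le[of "Suc (Suc r)"] Suc.prems by auto
      show "psum la r + 1 < psum la (Suc r) + 1"
        using psum_strict_mono[of r "Suc r"] Suc.prems by auto
      show "T i e = qq *s e" if "psum la r + 1 \<le> i" "Suc i < psum la (Suc r) + 1" for i
        using that Suc.prems by (intro row[of r]) auto
      show "L (psum la r + 1) e = qint (- int r) *s e"
        using Suc by simp
      show "(\<Sum>j=psum la r + 1..psum la (Suc r) + 1. fold T (rev [j..<psum la (Suc r) + 1]) e) = 0"
        using Suc.prems by (rule garnir_down)
    qed simp
    then show ?case by simp
  qed simp
  assume "1 \<le> m" "m \<le> n"
  then obtain r s where "r < length la" "1 \<le> s" "s \<le> la ! r" "m = psum la r + s"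
    by (rule entry_cases)
  then show ?thesis using row_step first by simp
qed

text \<open>The product of the first \<open>j\<close> factors of g_n, as an operator on all vectors:
  below it is also applied to a vanishing Garnir sum. The denominator uses t^\<lambda>, since in
  t_{c+j} the entry c + j + 1 still occupies its original node.\<close>

primrec G :: "nat \<Rightarrow> 'v \<Rightarrow> 'v" where
  "G 0 x = x"
| "G (Suc j) x = T (c + j) (G j x) + inverse (qint (\<rho> - econt la (Suc (c + j)))) *s G j x"

lemma G_add: "G j (x + y) = G j x + G j y"
  by (induction j) (auto simp: T_add vec_simps)

lemma G_scale: "G j (a *s x) = a *s G j x"
  by (induction j) (auto simp: T_scale vec_simps mult.commute)

lemma G_0 [simp]: "G j 0 = 0"
  by (induction j) auto

lemma G_sum: "G j (\<Sum>i\<in>A. f i) = (\<Sum>i\<in>A. G j (f i))"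
  by (induction A rule: infinite_finite_induct) (auto simp: G_add)

lemma T_G_commute: "c + j < i \<Longrightarrow> i < n \<Longrightarrow> T i (G j x) = G j (T i x)"
  using c_bounds by (induction j arbitrary: x) (auto simp: T_add T_scale T_comm'[of i "c + _"])

lemma fold_T_G_commute: "(\<And>i. i \<in> set w \<Longrightarrow> c + j < i \<and> i < n) \<Longrightarrow> fold T w (G j x) = G j (fold T w x)"
  by (induction w arbitrary: x) (auto simp: T_G_commute)

lemma row_G: "r < length la \<Longrightarrow> psum la r < i \<Longrightarrow> i < psum la (Suc r) \<Longrightarrow> c + j < i \<Longrightarrow> T i (G j e) = qq *s G j e"
  using psum_le[of "Suc r"] by (simp add: T_G_commute row G_scale)

text \<open>The contents of the tableau t_(c+j), obtained from t^la by moving c to the entry c + j.\<close>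
definition "wt j m = (if m = c + j then \<rho> else if c \<le> m \<and> m < c + j then econt la (Suc m) else econt la m)"

text \<open>Only L_i and L_{i+1} with i = c + j see the new factor. Their mixed relations with T_i
  leave the correction (q-1) [b] + 1 = q^b, which the coefficient a = 1/[\<rho> - b] absorbs by a
  ([\<rho>] - [b]) = q^b; the effect is an exchange of the two eigenvalues.\<close>

lemma L_G: "1 \<le> m \<Longrightarrow> m \<le> n \<Longrightarrow> c + j \<le> n \<Longrightarrow> L m (G j e) = qint (wt j m) *s G j e"
proof (induction j arbitrary: m)
  case 0
  then show ?case by (simp add: L_e wt_def \<rho>_def)
next
  case (Suc j)
  define i where "i = c + j"
  define g where "g = G j e"
  define b where "b = econt la (Suc i)"
  define a where "a = inverse (qint (\<rho> - b))"
  have i: "1 \<le> i" "i < n" using Suc.prems c_bounds by (auto simp: i_def)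
  have b: "b < \<rho>" using rho_greater[of "Suc i"] i c_bounds by (simp add: b_def i_def)
  have G: "G (Suc j) e = T i g + a *s g" by (simp add: i_def g_def a_def b_def)
  have Li: "L i g = qint \<rho> *s g" and LSi: "L (Suc i) g = qint b *s g"
    using Suc.IH[of i] Suc.IH[of "Suc i"] i by (auto simp: g_def wt_def i_def b_def)
  have "a * (qint \<rho> - qint b) = qq powi b"
    using b by (simp add: a_def qint_diff)
  also have "\<dots> = (qq - 1) * qint b + 1" by (simp add: qint_times)
  finally have key: "a * qint \<rho> = a * qint b + ((qq - 1) * qint b + 1)"
    by (simp add: algebra_simps)
  consider "m = i" | "m = Suc i" | "m \<noteq> i" "m \<noteq> Suc i" by blast
  then show ?case
  proof cases
    case 1
    have "L i (G (Suc j) e) = qint b *s T i g - (qq - 1) *s qint b *s g - g + a *s qint \<rho> *s g"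
      unfolding G using i by (simp add: L_add L_scale L_T Li LSi T_scale)
    also have "a *s qint \<rho> *s g = a *s qint b *s g + ((qq - 1) *s qint b *s g + g)"
      by (simp add: key scale_left_distrib)
    finally have "L i (G (Suc j) e) = qint b *s (T i g + a *s g)"
      by (simp add: scale_right_distrib mult.commute)
    then show ?thesis unfolding G[symmetric] using 1 by (simp add: wt_def i_def b_def)
  next
    case 2
    have "L (Suc i) (G (Suc j) e) = qint \<rho> *s T i g + (a *s qint b *s g + ((qq - 1) *s qint b *s g + g))"
      unfolding G using i by (simp add: L_add L_scale L_Suc_T Li LSi T_scale)
    also have "a *s qint b *s g + ((qq - 1) *s qint b *s g + g) = a *s qint \<rho> *s g"
      by (simp add: key scale_left_distrib)
    finally have "L (Suc i) (G (Suc j) e) = qint \<rho> *s (T i g + a *s g)"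
      by (simp add: scale_right_distrib mult.commute)
    then show ?thesis unfolding G[symmetric] using 2 by (simp add: wt_def i_def)
  next
    case 3
    have "L m g = qint (wt j m) *s g"
      unfolding g_def using Suc by simp
    moreover have "L m (T i g) = T i (L m g)"
      using 3 i Suc.prems by (intro L_T_comm) auto
    moreover have "wt (Suc j) m = wt j m"
      using 3 by (auto simp: wt_def i_def)
    ultimately show ?thesis
      unfolding G by (simp add: L_add L_scale T_scale scale_right_distrib mult.commute)
  qed
qed

section \<open>Killing the difference between e_{t_n} and g_n\<close>

definition "D d x = L n x - qint d *s x"

lemma D_scale: "D d (a *s x) = a *s D d x"
  by (simp add: D_def L_scale vec_simps mult.commute)

lemma D_add: "D d (x + y) = D d x + D d y"
  by (simp add: D_def L_add vec_simps algebra_simps)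

lemma D_0 [simp]: "D d 0 = 0" by (simp add: D_def)

lemma fold_D_0 [simp]: "fold D ds 0 = 0"
  by (induction ds) auto

lemma fold_D_scale: "fold D ds (a *s x) = a *s fold D ds x"
  by (induction ds arbitrary: x) (auto simp: D_scale)

lemma fold_D_sum: "fold D ds (\<Sum>i\<in>A. f i) = (\<Sum>i\<in>A. fold D ds (f i))"
proof (induction ds arbitrary: f)
  case (Cons d ds)
  have "D d (\<Sum>i\<in>A. f i) = (\<Sum>i\<in>A. D d (f i))"
    by (induction A rule: infinite_finite_induct) (auto simp: D_add)
  then show ?case by (simp add: Cons.IH)
qed simp

lemma D_commute: "D d \<circ> D d' = D d' \<circ> D d"
  by (auto simp: fun_eq_iff D_def L_diff L_scale scale_right_diff_distrib mult.commute)

lemma fold_D_remove1: "d \<in> set ds \<Longrightarrow> fold D ds x = fold D (remove1 d ds) (D d x)"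
  using fold_multiset_equiv[of ds D "d # remove1 d ds"] D_commute by simp

text \<open>Moving L_m back through T_{m-1}, ..., T_p leaves L_p in front. Each crossing of a T_i
  adds the word with T_i deleted, weighted by 1 + (q-1) [y(i+1)] = q^{y(i+1)}.\<close>

lemma L_fold_upt:
  assumes "1 \<le> p" "p \<le> m" "m \<le> n" and L: "\<And>i. p \<le> i \<Longrightarrow> i \<le> n \<Longrightarrow> L i x = qint (y i) *s x"
  shows "L m (fold T [p..<m] x) = qint (y p) *s fold T [p..<m] x
    + (\<Sum>i=p..<m. (1 + (qq - 1) * qint (y (Suc i))) *s fold T [Suc i..<m] (fold T [p..<i] x))"
  using assms(2,3)
proof (induction m rule: dec_induct)
  case base
  then show ?case using L[of p] by simp
next
  case (step m)
  define z where "z = fold T [p..<m] x"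
  have "L (Suc m) (fold T w x) = fold T w (L (Suc m) x)" if "set w \<subseteq> {p..<m}" for w
    using that
  proof (induction w rule: rev_induct)
    case (snoc i w)
    then show ?case using assms step by (simp add: L_T_comm_below)
  qed simp
  then have z: "L (Suc m) z = qint (y (Suc m)) *s z"
    using L[of "Suc m"] step by (simp add: z_def fold_T_scale)
  have "L (Suc m) (fold T [p..<Suc m] x) = L (Suc m) (T m z)"
    using step by (simp add: z_def)
  also have "\<dots> = T m (L m z) + (1 + (qq - 1) * qint (y (Suc m))) *s z"
    using step assms by (simp add: L_Suc_T z scale_left_distrib add.assoc)
  also have "L m z = qint (y p) *s z
    + (\<Sum>i=p..<m. (1 + (qq - 1) * qint (y (Suc i))) *s fold T [Suc i..<m] (fold T [p..<i] x))"
    using step by (simp add: z_def)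
  finally show ?case
    using step by (simp add: T_add T_scale T_sum z_def add.assoc)
qed

text \<open>From position \<open>p\<close> on, \<open>x\<close> cannot be told apart from e. The
  point of the notion is its stability under the deleted words of \<open>L_fold_upt\<close> (see
  \<open>tame_fold\<close>), which makes an induction on n - p possible.\<close>

definition "tame p x \<longleftrightarrow> (\<forall>m. p \<le> m \<longrightarrow> m \<le> n \<longrightarrow> L m x = qint (econt la m) *s x) \<and>
  (\<forall>i r. p \<le> i \<longrightarrow> r < length la \<longrightarrow> psum la r < i \<longrightarrow> i < psum la (Suc r) \<longrightarrow> T i x = qq *s x)"

lemma tame_mono: "tame p x \<Longrightarrow> p \<le> p' \<Longrightarrow> tame p' x"
  unfolding tame_def by (meson order_trans)

lemma tame_fold:
  assumes "tame p x" "1 \<le> p" "p \<le> i" "i < n"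
  shows "tame (Suc i) (fold T [p..<i] x)"
  unfolding tame_def
proof (intro conjI allI impI)
  fix m assume m: "Suc i \<le> m" "m \<le> n"
  have "L m (fold T w x) = fold T w (L m x)" if "set w \<subseteq> {p..<i}" for w
    using that
  proof (induction w rule: rev_induct)
    case (snoc j w)
    then show ?case using assms m by (simp add: L_T_comm_below)
  qed simp
  then show "L m (fold T [p..<i] x) = qint (econt la m) *s fold T [p..<i] x"
    using assms m by (simp add: tame_def fold_T_scale)
next
  fix j r assume j: "Suc i \<le> j" "r < length la" "psum la r < j" "j < psum la (Suc r)"
  have "T j (fold T [p..<i] x) = fold T [p..<i] (T j x)"
    using j assms psum_le[of "Suc r"] by (intro T_fold_T_commute) auto
  also have "T j x = qq *s x"
    using assms(1,3) j unfolding tame_def by (meson Suc_leD order_trans)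
  finally show "T j (fold T [p..<i] x) = qq *s fold T [p..<i] x"
    by (simp add: fold_T_scale)
qed

text \<open>The row ends have pairwise distinct contents, so each factor D can be used once for the
  row end that the moving entry passes.\<close>
lemma fold_D_kill:
  assumes "tame p x" "r < length la" "psum la r < p" "p \<le> psum la (Suc r)"
    and "\<And>r'. r \<le> r' \<Longrightarrow> r' < length la \<Longrightarrow> econt la (psum la (Suc r')) \<in> set ds"
  shows "fold D ds (fold T [p..<n] x) = 0"
  using assms
proof (induction "n - p" arbitrary: p x r ds rule: less_induct)
  case less
  have p: "1 \<le> p" "p \<le> n" using less.prems psum_le[of "Suc r"] by auto
  define d where "d = econt la (psum la (Suc r))"
  have d: "d \<in> set ds" unfolding d_def using less.prems(2,5) by simp
  consider "p = n" | "p < n" "p < psum la (Suc r)" | "p < n" "p = psum la (Suc r)"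
    using less.prems p by linarith
  then show ?case
  proof cases
    case 1
    then have "psum la (Suc r) = n" using less.prems psum_le[of "Suc r"] by simp
    then have "D d x = 0"
      using less.prems(1) p 1 by (simp add: D_def tame_def d_def)
    then show ?thesis using fold_D_remove1[OF d] 1 by simp
  next
    case 2
    \<comment> \<open>Inside a row the first letter of the word only contributes a factor q, and the
      start can be advanced towards the row end.\<close>
    then have "T p x = qq *s x"
      using less.prems unfolding tame_def by blast
    moreover have "fold D ds (fold T [Suc p..<n] x) = 0"
      using 2 less.prems by (intro less.hyps[of _ _ r]) (auto intro: tame_mono)
    ultimately show ?thesis
      using 2 by (simp add: upt_conv_Cons fold_T_scale fold_D_scale)
  next
    case 3
    \<comment> \<open>At a row end, \<open>D d\<close> for its content d cancels the leading term.
      What remains are deleted words, which start again in strictly lower rows; the contents of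
      those row ends differ from d and are still in \<open>remove1 d ds\<close>.\<close>
    have "D d (fold T [p..<n] x) =
      (\<Sum>i=p..<n. (1 + (qq - 1) * qint (econt la (Suc i))) *s fold T [Suc i..<n] (fold T [p..<i] x))"
      using L_fold_upt[of p n x "econt la"] less.prems(1) p 3 by (simp add: D_def tame_def d_def)
    moreover have "fold D (remove1 d ds) (fold T [Suc i..<n] (fold T [p..<i] x)) = 0" if i: "i \<in> {p..<n}" for i
    proof -
      obtain r' s where r': "r' < length la" "1 \<le> s" "s \<le> la ! r'" "Suc i = psum la r' + s"
        using i by (elim entry_cases[of "Suc i", rotated 2]) auto
      then have bounds: "psum la r' < Suc i" "Suc i \<le> psum la (Suc r')"
        by (auto simp: psum_Suc)
      then have "psum la (Suc r) < psum la (Suc r')" using 3 i by auto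
      then have rr': "r < r'" using psum_less_iff[of "Suc r" "Suc r'"] r' less.prems by simp
      show ?thesis
      proof (rule less.hyps)
        show "tame (Suc i) (fold T [p..<i] x)"
          using i less.prems p by (intro tame_fold) auto
        show "econt la (psum la (Suc r'')) \<in> set (remove1 d ds)" if "r' \<le> r''" "r'' < length la" for r''
        proof -
          have "econt la (psum la (Suc r'')) \<noteq> d"
            using econt_row_end_inj[of r r''] that rr' less.prems unfolding d_def by auto
          moreover have "econt la (psum la (Suc r'')) \<in> set ds"
            using that rr' by (intro less.prems) auto
          ultimately show ?thesis by simp
        qed
      qed (use i r' bounds in auto)
    qed
    ultimately show ?thesis
      by (simp add: fold_D_remove1[OF d] fold_D_sum fold_D_scale)
  qed
qed

lemma tame_G: "c + j \<le> n \<Longrightarrow> tame (Suc (c + j)) (G j e)"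
  using c_bounds unfolding tame_def by (auto simp: L_G wt_def intro!: row_G)

text \<open>The action of the factor of E_{t_n} belonging to the entry and content in
  \<open>md\<close>; \<open>wt (n - c)\<close> is the content function of t_n.\<close>

definition "Efac_op md x =
  inverse (qint (wt (n - c) (fst md)) - qint (snd md)) *s (L (fst md) x - qint (snd md) *s x)"

lemma fold_Efac_G:
  assumes "\<forall>(m, d) \<in> set es. 1 \<le> m \<and> m \<le> n \<and> d \<noteq> wt (n - c) m"
  shows "fold Efac_op es (G (n - c) e) = G (n - c) e"
  using assms
proof (induction es)
  case (Cons md es)
  have "Efac_op md (G (n - c) e) = G (n - c) e"
    using Cons.prems c_bounds
    by (cases md) (auto simp: Efac_op_def L_G scale_left_diff_distrib[symmetric])
  then show ?case using Cons by simp
qed simp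

lemma Efac_op_linear: "Efac_op md (x - y) = Efac_op md x - Efac_op md y" "Efac_op md (a *s x) = a *s Efac_op md x"
  by (auto simp: Efac_op_def L_diff L_scale vec_simps algebra_simps)

lemma fold_Efac_diff: "fold Efac_op es (x - y) = fold Efac_op es x - fold Efac_op es y"
  by (induction es arbitrary: x y) (auto simp: Efac_op_linear)

lemma fold_Efac_scale: "fold Efac_op es (a *s x) = a *s fold Efac_op es x"
  by (induction es arbitrary: x) (auto simp: Efac_op_linear)

lemma fold_Efac_0 [simp]: "fold Efac_op es 0 = 0"
  using fold_Efac_scale[of es 0 0] by simp

lemma Efac_op_n: "\<exists>a. \<forall>x. fold Efac_op (map (Pair n) ds) x = a *s fold D ds x"
proof (induction ds)
  case Nil
  then show ?case by (intro exI[of _ 1]) simp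
next
  case (Cons d ds)
  then obtain a where "\<And>x. fold Efac_op (map (Pair n) ds) x = a *s fold D ds x" by blast
  moreover have "Efac_op (n, d) x = inverse (qint (wt (n - c) n) - qint d) *s D d x" for x
    by (simp add: Efac_op_def D_def)
  ultimately show ?case
    by (intro exI[of _ "inverse (qint (wt (n - c) n) - qint d) * a"]) (simp add: fold_Efac_scale)
qed

lemma D_Efac_commute:
  assumes "1 \<le> m" "m < n"
  shows "D d (Efac_op (m, d') x) = Efac_op (m, d') (D d x)"
  using L_L_comm[OF assms, of x]
  by (simp add: D_def Efac_op_def L_diff L_scale vec_simps mult.commute mult.left_commute algebra_simps)

lemma fold_D_Efac_commute:
  assumes "\<forall>(m, d) \<in> set es. 1 \<le> m \<and> m < n"
  shows "fold D ds (fold Efac_op es x) = fold Efac_op es (fold D ds x)"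
proof -
  have 1: "fold D ds (Efac_op (m, d) x) = Efac_op (m, d) (fold D ds x)" if "1 \<le> m" "m < n" for m d x
    using that by (induction ds arbitrary: x) (auto simp: D_Efac_commute)
  show ?thesis
    using assms by (induction es arbitrary: x) (auto simp: 1)
qed

text \<open>The lists \<open>ds m\<close> stand for the contents occurring in E_{t_n}. The first
  assumption makes every factor act on g_n as (r - c')/(r - c') = 1, with r the residue of the entry
  in t_n; the second supplies the factors that kill the error terms.\<close>

lemma seminormal_vector:
  assumes wt: "\<And>m. 1 \<le> m \<Longrightarrow> m \<le> n \<Longrightarrow> wt (n - c) m \<notin> set (ds m)"
    and ends: "\<And>r. k \<le> r \<Longrightarrow> r < length la \<Longrightarrow> econt la (psum la (Suc r)) \<in> set (ds n)"
  shows "fold Efac_op (concat (map (\<lambda>m. map (Pair m) (ds m)) [1..<Suc n])) (fold T [c..<n] e) = G (n - c) e"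
proof -
  define es where "es = concat (map (\<lambda>m. map (Pair m) (ds m)) [1..<Suc n])"
  define es' where "es' = concat (map (\<lambda>m. map (Pair m) (ds m)) [1..<n])"
  have es: "es = es' @ map (Pair n) (ds n)"
    using c_bounds by (simp add: es_def es'_def)
  have kill: "fold Efac_op es (fold T [Suc (c + j)..<n] (G j e)) = 0" if j: "c + j < n" for j
  proof -
    obtain r s where r: "r < length la" "1 \<le> s" "s \<le> la ! r" "Suc (c + j) = psum la r + s"
      using j by (elim entry_cases[of "Suc (c + j)", rotated 2]) auto
    then have bounds: "psum la r < Suc (c + j)" "Suc (c + j) \<le> psum la (Suc r)"
      by (auto simp: psum_Suc)
    then have "psum la k < psum la (Suc r)" by (simp add: c_def)
    then have kr: "k \<le> r" using psum_less_iff[of k "Suc r"] r k by simp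
    have zero: "fold D (ds n) (fold T [Suc (c + j)..<n] (G j e)) = 0"
      using j kr r bounds by (intro fold_D_kill[of _ _ r] tame_G ends) auto
    obtain a where "\<And>x. fold Efac_op (map (Pair n) (ds n)) x = a *s fold D (ds n) x"
      using Efac_op_n by blast
    then have "fold Efac_op es (fold T [Suc (c + j)..<n] (G j e))
      = a *s fold D (ds n) (fold Efac_op es' (fold T [Suc (c + j)..<n] (G j e)))"
      by (simp add: es)
    \<comment> \<open>The factors for m = n stand last in the product, but the L_m commute, so they
      may be applied first.\<close>
    also have "\<dots> = a *s fold Efac_op es' (fold D (ds n) (fold T [Suc (c + j)..<n] (G j e)))"
      by (subst fold_D_Efac_commute) (auto simp: es'_def)
    finally show ?thesis by (simp add: zero)
  qed
  have "fold Efac_op es (fold T [c + j..<n] (G j e)) = fold Efac_op es (fold T [c..<n] e)" if "c + j \<le> n" for j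
    using that
  proof (induction j)
    case (Suc j)
    \<comment> \<open>Telescoping from the left: replacing the next T_i by T_i + 1/[\<rho>_i]
      changes the vector by a multiple of one that \<open>kill\<close> annihilates.\<close>
    have eq: "fold T [c + Suc j..<n] (G (Suc j) e) = fold T [c + j..<n] (G j e)
       - (- inverse (qint (\<rho> - econt la (Suc (c + j))))) *s fold T [Suc (c + j)..<n] (G j e)"
      using Suc.prems by (simp add: upt_conv_Cons[of "c + j"] fold_T_add fold_T_scale)
    show ?case
      unfolding eq fold_Efac_diff fold_Efac_scale using Suc kill[of j] by simp
  qed simp
  from this[of "n - c"] have "fold Efac_op es (fold T [c..<n] e) = fold Efac_op es (G (n - c) e)"
    using c_bounds by simp
  also have "\<dots> = G (n - c) e"
    using wt by (intro fold_Efac_G) (auto simp: es_def)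
  finally show ?thesis by (simp add: es_def)
qed

section \<open>Multiplying out the factors row by row\<close>

lemma qint_inverse_step:
  assumes "0 < a"
  shows "inverse (qint (a + 1)) * (qq + inverse (qint a)) = inverse (qint a)"
proof -
  have "qint a \<noteq> 0" "qint (a + 1) \<noteq> 0" using assms by simp_all
  then have "inverse (qint (a + 1)) * ((qq * qint a + 1) * inverse (qint a)) = inverse (qint a)"
    by (simp flip: qint_add_1)
  then show ?thesis
    using \<open>qint a \<noteq> 0\<close> by (simp add: distrib_right mult.assoc)
qed

text \<open>A word that stops before position a + s - 1 leaves T_{a+s} acting by q, the entries of
  the row being untouched there. The old coefficient 1/[b+1] is thus multiplied by q + 1/[b] and
  becomes 1/[b], the same coefficient as that of the newly truncated word; so one common coefficient
  survives for the whole row.\<close>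

lemma G_row:
  assumes "r < length la" "k \<le> r" "c + j = psum la r" "s \<le> la ! r"
  shows "G (j + s) e = fold T [c + j..<c + j + s] (G j e)
    + inverse (qint (\<rho> + int r + 1 - int s)) *s (\<Sum>m<s. fold T [c + j..<c + j + m] (G j e))"
  using assms(4)
proof (induction s)
  case (Suc s)
  define u where "u = G j e"
  define a where "a = c + j"
  define R where "R = (\<Sum>m<s. fold T [a..<a + m] u)"
  define b where "b = \<rho> + int r + 1 - int (Suc s)"
  have an: "a + s < n" using psum_le[of "Suc r"] assms(1,3) Suc.prems by (simp add: a_def psum_Suc)
  have ct: "econt la (Suc (a + s)) = int (Suc s) - int r - 1"
    using econt_entry[of r "Suc s"] assms Suc.prems by (simp add: a_def)
  have b: "0 < b"
    using rho_greater[of "Suc (a + s)"] an ct by (simp add: b_def a_def)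
  have "T (a + s) (fold T [a..<a + m] u) = qq *s fold T [a..<a + m] u" if "m < s" for m
  proof -
    have "T (a + s) (fold T [a..<a + m] u) = fold T [a..<a + m] (T (a + s) u)"
      using that an c_bounds by (intro T_fold_T_commute) (auto simp: a_def)
    also have "T (a + s) u = qq *s u"
      unfolding u_def using that assms Suc.prems
      by (intro row_G[of r]) (auto simp: a_def psum_Suc)
    finally show ?thesis by (simp add: fold_T_scale)
  qed
  then have R: "T (a + s) R = qq *s R"
    by (simp add: R_def T_sum scale_sum_right)
  have "G (j + Suc s) e = T (a + s) (G (j + s) e) + inverse (qint b) *s G (j + s) e"
    using ct by (simp add: a_def b_def add.assoc algebra_simps)
  also have "G (j + s) e = fold T [a..<a + s] u + inverse (qint (b + 1)) *s R"
    using Suc by (simp add: a_def u_def R_def b_def algebra_simps)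
  also have "T (a + s) (fold T [a..<a + s] u + inverse (qint (b + 1)) *s R)
      + inverse (qint b) *s (fold T [a..<a + s] u + inverse (qint (b + 1)) *s R)
    = fold T [a..<a + Suc s] u + inverse (qint b) *s fold T [a..<a + s] u
      + (inverse (qint (b + 1)) * (qq + inverse (qint b))) *s R"
    by (simp add: T_add T_scale R scale_right_distrib scale_left_distrib distrib_left mult.commute)
  also have "\<dots> = fold T [a..<a + Suc s] u + inverse (qint b) *s (\<Sum>m<Suc s. fold T [a..<a + m] u)"
    using qint_inverse_step[OF b] by (simp add: R_def scale_right_distrib add.commute)
  finally show ?case by (simp only: a_def u_def b_def)
qed simp

end

primrec gens :: "fexp \<Rightarrow> nat set" where
  "gens FOne = {}"
| "gens (FGen i) = {i}"
| "gens (FScal a x) = gens x"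
| "gens (FAdd x y) = gens x \<union> gens y"
| "gens (FMul x y) = gens x \<union> gens y"

lemma gens_fT: "gens (fT w) = set w"
  by (induction w) (auto simp: fT_def)

lemma gens_fsum: "gens (fsum es) = \<Union> (gens ` set es)"
  by (induction es rule: fsum.induct) auto

text \<open>phi of Defs in terms of the row number K = k_j and the common length l of the rows below it.\<close>
fun row_phi :: "nat list \<Rightarrow> nat \<Rightarrow> nat \<Rightarrow> nat \<Rightarrow> fexp" where
  "row_phi la K l 0 = FOne"
| "row_phi la K l (Suc 0) = Rrow la (Suc K)"
| "row_phi la K l (Suc (Suc i)) =
     FMul (FAdd (fT [psum la K..<psum la K + Suc i * l]) (FScal (- qq) (row_phi la K l (Suc i))))
          (Rrow la (K + Suc (Suc i)))"

lemma psum_equal_rows: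
  assumes "K + i \<le> length la" "\<And>r. K \<le> r \<Longrightarrow> r < K + i \<Longrightarrow> la ! r = l"
  shows "psum la (K + i) = psum la K + i * l"
  using assms by (induction i) (auto simp: psum_Suc)

lemma gens_Rrow: "gens (Rrow la (Suc r)) \<subseteq> {i. psum la r \<le> i \<and> Suc i < psum la (Suc r)}"
  by (auto simp: Rrow_def gens_fsum gens_fT arow_def brow_def)

text \<open>The bound on \<open>Suc j\<close> leaves a gap: the index just before the row end
  \<open>psum la (K + i)\<close> does not occur, so the expression commutes with every generator
  from that row end on.\<close>

lemma gens_row_phi:
  assumes "K + i \<le> length la" "\<And>r. K \<le> r \<Longrightarrow> r < K + i \<Longrightarrow> la ! r = l" "0 < l"
  shows "gens (row_phi la K l i) \<subseteq> {j. psum la K \<le> j \<and> Suc j < psum la (K + i)}"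
  using assms
proof (induction la K l i rule: row_phi.induct)
  case (2 la K l)
  then show ?case using gens_Rrow[of la K] by simp
next
  case (3 la K l i)
  have ps: "psum la (K + Suc i) = psum la K + Suc i * l" "psum la (K + Suc (Suc i)) = psum la K + Suc (Suc i) * l"
    using 3 by (intro psum_equal_rows; simp)+
  have "gens (row_phi la K l (Suc i)) \<subseteq> {j. psum la K \<le> j \<and> Suc j < psum la (K + Suc i)}"
    using 3 by simp
  moreover have "gens (Rrow la (Suc (K + Suc i))) \<subseteq> {j. psum la (K + Suc i) \<le> j \<and> Suc j < psum la (Suc (K + Suc i))}"
    by (rule gens_Rrow)
  ultimately show ?case
    using \<open>0 < l\<close> ps by (auto simp: gens_fT)
qed simp

context hecke_rep
begin

lemma act_fold_commute:
  assumes "\<forall>i\<in>gens x. \<forall>j\<in>set w. 1 \<le> i \<and> Suc i < j \<and> j < n"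
  shows "act x (fold T w v) = fold T w (act x v)"
  using assms
proof (induction x arbitrary: v)
  case (FGen i)
  show ?case
  proof (cases "w = []")
    case False
    then obtain j where "j \<in> set w" by (cases w) auto
    then have "1 \<le> i" "i < n" using FGen by auto
    then show ?thesis using FGen by (simp, intro T_fold_T_commute) auto
  qed simp
next
  case (FAdd x y)
  have "act x (fold T w v) = fold T w (act x v)" "act y (fold T w v) = fold T w (act y v)"
    by (rule FAdd.IH, use FAdd.prems in \<open>unfold gens.simps, blast\<close>)+
  then show ?case by (simp add: fold_T_add)
next
  case (FMul x y)
  have "act x (fold T w v) = fold T w (act x v)" "act y (fold T w v) = fold T w (act y v)" for v
    by (rule FMul.IH, use FMul.prems in \<open>unfold gens.simps, blast\<close>)+
  then show ?case by simp
qed (auto simp: fold_T_scale)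

lemma act_Rrow: "act (Rrow la (Suc r)) v = (\<Sum>m=psum la r..<psum la (Suc r). fold T [psum la r..<m] v)"
  by (simp add: Rrow_def act_fsum act_fT arow_def brow_def o_def interv_sum_list_conv_sum_set_nat)

end

context seminormal
begin

text \<open>Induction on the number of equal rows: \<open>G_row\<close> treats each row, and the
  second Garnir relation recombines the result into the recursion of \<open>row_phi\<close>.\<close>

lemma G_rows:
  assumes K: "k \<le> K" "K + i \<le> length la" "1 \<le> i" and j: "c + j = psum la K"
    and eq: "\<And>r. K \<le> r \<Longrightarrow> r < K + i \<Longrightarrow> la ! r = l" and l: "0 < l"
  shows "G (j + i * l) e = fold T [c + j..<c + j + i * l] (G j e)
    + inverse (qint (\<rho> - int l + int K + int i)) *s act (row_phi la K l i) (G j e)"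
  using K(3,2) eq
proof (induction i rule: dec_induct)
  case base
  have "psum la (Suc K) = c + j + l"
    using base j by (simp add: psum_Suc)
  then show ?case
    using G_row[of K j l] base K j sum.shift_bounds_nat_ivl[of "\<lambda>m. fold T [c + j..<m] (G j e)" 0 "c + j" l]
    by (simp add: act_Rrow lessThan_atLeast0 algebra_simps flip: j)
next
  case (step i)
  define u where "u = G j e"
  define a where "a = c + j + i * l"
  define x where "x = \<rho> - int l + int K + int i"
  define f where "f = act (row_phi la K l i) u"
  define R where "R v = (\<Sum>m<l. fold T [a..<a + m] v)" for v
  have lK: "la ! (K + i) = l" "K + i < length la" "la ! (K + i - 1) = l" using step by auto
  have pK: "psum la (K + i) = a"
    using step psum_equal_rows[of K i la l] j by (simp add: a_def)
  have pK': "psum la (Suc (K + i)) = a + l"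
    using lK pK by (simp add: psum_Suc)
  have an: "a + l \<le> n" using psum_le[of "Suc (K + i)"] pK' by simp
  have il: "1 \<le> i * l" using step l by (cases i) auto
  have ca: "c + j < a" using il by (simp add: a_def)
  have ct: "econt la a = int l - int (K + i)"
    using econt_row_end[of "K + i - 1"] lK step pK by (cases "K + i") auto
  have x: "0 < x"
    using rho_greater[of a] an il ct c_bounds by (simp add: x_def a_def)
  have R_add: "R (v + w) = R v + R w" and R_scale: "R (b *s v) = b *s R v" for v w b
    by (auto simp: R_def fold_T_linear sum.distrib scale_sum_right)
  have IH: "G (j + i * l) e = fold T [c + j..<a] u + inverse (qint x) *s f"
    using step by (simp add: u_def a_def x_def f_def)
  \<comment> \<open>The Garnir relation for the last two rows concerns positions from
    \<open>a\<close> on. Its words commute with \<open>G j\<close> and with the generators of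
    \<open>row_phi\<close>, so applying both operators to the vanishing sum gives a relation for
    \<open>f\<close>.\<close>
  have gar: "R f + fold T [a..<a + l] f = 0"
  proof -
    have g: "gens (row_phi la K l i) \<subseteq> {j. psum la K \<le> j \<and> Suc j < a}"
      using gens_row_phi[of K i la l] step l pK by simp
    have comm: "act (row_phi la K l i) (G j (fold T [a..<m] e)) = fold T [a..<m] f" if "m \<le> a + l" for m
    proof -
      have "G j (fold T [a..<m] e) = fold T [a..<m] u"
        unfolding u_def using that an ca by (intro fold_T_G_commute[symmetric]) auto
      then show ?thesis
        unfolding f_def using that an g j c_bounds by (subst act_fold_commute[symmetric]) auto
    qed
    have "(\<Sum>m=a..a + l. fold T [a..<m] e) = 0"
      using garnir_up[of "K + i - 1"] step lK pK pK' by (cases "K + i") auto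
    then have "act (row_phi la K l i) (G j (\<Sum>m=a..a + l. fold T [a..<m] e)) = 0"
      by simp
    then have "(\<Sum>m=a..a + l. fold T [a..<m] f) = 0"
      by (simp add: G_sum act_sum comm)
    also have "(\<Sum>m=a..a + l. fold T [a..<m] f) = (\<Sum>m\<le>l. fold T [a..<a + m] f)"
      using sum.shift_bounds_cl_nat_ivl[of "\<lambda>m. fold T [a..<m] f" 0 a l] by (simp add: atMost_atLeast0 add.commute)
    also have "\<dots> = R f + fold T [a..<a + l] f"
      by (simp add: R_def lessThan_Suc_atMost[symmetric])
    finally show ?thesis .
  qed
  have act_Suc: "act (row_phi la K l (Suc i)) u = R (fold T [c + j..<a] u) - qq *s R f"
  proof -
    obtain i' where i': "i = Suc i'" using step by (cases i) auto
    have "act (Rrow la (Suc (K + i))) v = R v" for v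
      unfolding act_Rrow pK pK' R_def
      using sum.shift_bounds_nat_ivl[of "\<lambda>m. fold T [a..<m] v" 0 a l] by (simp add: atLeast0LessThan add.commute)
    then show ?thesis
      using i' R_add[of _ "- _"] R_scale[of "- qq"]
      by (simp add: R_add act_fT f_def a_def j scale_minus_left)
  qed
  have "G (j + Suc i * l) e = G ((j + i * l) + l) e" by (simp add: algebra_simps)
  also have "\<dots> = fold T [a..<a + l] (G (j + i * l) e) + inverse (qint (x + 1)) *s R (G (j + i * l) e)"
    using G_row[of "K + i" "j + i * l" l] lK K(1) pK
    by (simp add: a_def x_def R_def algebra_simps)
  also have "\<dots> = fold T [a..<a + l] (fold T [c + j..<a] u)
      + inverse (qint (x + 1)) *s R (fold T [c + j..<a] u)
      + (inverse (qint x) *s fold T [a..<a + l] f + (inverse (qint (x + 1)) * inverse (qint x)) *s R f)"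
    by (simp add: IH fold_T_add fold_T_scale R_add R_scale scale_right_distrib algebra_simps)
  \<comment> \<open>The origin of -q in the recursion of \<phi>: the Garnir relation turns the first
    term into -R f/[x], and 1/[x] - 1/([x] [x+1]) = q/[x+1].\<close>
  also have "inverse (qint x) *s fold T [a..<a + l] f + (inverse (qint (x + 1)) * inverse (qint x)) *s R f
    = - ((inverse (qint (x + 1)) * qq) *s R f)"
  proof -
    have "inverse (qint x) *s fold T [a..<a + l] f = - (inverse (qint x) *s R f)"
      using gar by (simp add: add_eq_0_iff)
    moreover have "inverse (qint x) *s R f = (inverse (qint (x + 1)) * qq) *s R f + (inverse (qint (x + 1)) * inverse (qint x)) *s R f"
      using qint_inverse_step[OF x] by (simp add: distrib_left flip: scale_left_distrib)
    ultimately show ?thesis by simp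
  qed
  also have "fold T [a..<a + l] (fold T [c + j..<a] u) = fold T [c + j..<a + l] u"
    using upt_add_eq_append[of "c + j" a l] by (simp add: a_def)
  finally have "G (j + Suc i * l) e
    = fold T [c + j..<a + l] u + inverse (qint (x + 1)) *s act (row_phi la K l (Suc i)) u"
    by (simp add: act_Suc scale_right_diff_distrib)
  then show ?case
    by (simp add: u_def a_def x_def add_ac)
qed

end

section \<open>Reduced words and the standard basis\<close>

lemma sg_apply: "sg i x = (if x = i then Suc i else if x = Suc i then i else x)"
  by (simp add: sg_def tr_def)

lemma sg_sg [simp]: "sg i (sg i x) = x"
  by (simp add: sg_apply)

lemma lr_apply: "lr u v x = v (u x)"
  by (simp add: lr_def)

lemma lr_assoc: "lr (lr u v) w = lr u (lr v w)"
  by (simp add: lr_def o_assoc)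

lemma lr_id [simp]: "lr id w = w" "lr w id = w" "lr w (\<lambda>a. a) = w"
  by (simp_all add: lr_def fun_eq_iff)

lemma lr_sg_sg [simp]: "lr (sg i) (sg i) = id" "lr (lr w (sg i)) (sg i) = w" "lr (sg i) (lr (sg i) w) = w"
  by (simp_all add: fun_eq_iff lr_apply)

lemma lr_sg_eq_iff: "lr v (sg i) = w \<longleftrightarrow> v = lr w (sg i)" "lr (sg i) v = w \<longleftrightarrow> v = lr (sg i) w"
  by auto

lemma sg_less_iff:
  assumes "\<not> (x = i \<and> y = Suc i)" "\<not> (x = Suc i \<and> y = i)"
  shows "sg i x < sg i y \<longleftrightarrow> x < y"
  using assms unfolding sg_apply by (auto split: if_splits)

lemma sg_perms: "1 \<le> i \<Longrightarrow> i < n \<Longrightarrow> sg i \<in> perms n"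
proof -
  assume "1 \<le> i" "i < n"
  moreover have "sg i = transpose i (Suc i)"
    by (simp add: fun_eq_iff sg_apply transpose_def)
  ultimately show ?thesis
    using permutes_swap_id[of i "{1..n}" "Suc i"] by (simp add: perms_def)
qed

lemma id_perms [simp]: "id \<in> perms n"
  by (simp add: perms_def)

lemma lr_perms: "u \<in> perms n \<Longrightarrow> v \<in> perms n \<Longrightarrow> lr u v \<in> perms n"
  by (simp add: perms_def lr_def permutes_compose)

lemma inv_perms: "w \<in> perms n \<Longrightarrow> inv w \<in> perms n"
  by (simp add: perms_def permutes_inv)

lemma finite_perms [simp]: "finite (perms n)"
  by (simp add: perms_def finite_permutations)

lemma lr_sg_perms_iff:
  assumes "1 \<le> i" "i < n"
  shows "lr w (sg i) \<in> perms n \<longleftrightarrow> w \<in> perms n" "lr (sg i) w \<in> perms n \<longleftrightarrow> w \<in> perms n"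
proof -
  have "w \<in> perms n" if "lr w (sg i) \<in> perms n"
    using lr_perms[OF that sg_perms[OF assms]] unfolding lr_sg_sg .
  moreover have "w \<in> perms n" if "lr (sg i) w \<in> perms n"
    using lr_perms[OF sg_perms[OF assms] that] unfolding lr_sg_sg .
  ultimately show "lr w (sg i) \<in> perms n \<longleftrightarrow> w \<in> perms n" "lr (sg i) w \<in> perms n \<longleftrightarrow> w \<in> perms n"
    using lr_perms sg_perms[OF assms] by blast+
qed

lemma perms_inj: "w \<in> perms n \<Longrightarrow> w x = w y \<longleftrightarrow> x = y"
  using permutes_inj[of w] by (auto simp: perms_def inj_def)

lemma perms_inv_eq: "w \<in> perms n \<Longrightarrow> inv w x = y \<longleftrightarrow> w y = x"
  using permutes_inverses[of w "{1..n}"] by (auto simp: perms_def)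

lemma perms_inv_inv: "w \<in> perms n \<Longrightarrow> inv (inv w) = w"
  by (simp add: perms_def permutes_inv_inv)

lemma perms_in_iff: "w \<in> perms n \<Longrightarrow> w x \<in> {1..n} \<longleftrightarrow> x \<in> {1..n}"
  using permutes_in_image[of w "{1..n}" x] by (simp add: perms_def)

lemma inv_lr_sg:
  assumes "w \<in> perms n"
  shows "inv (lr w (sg i)) = lr (sg i) (inv w)" "inv (lr (sg i) w) = lr (inv w) (sg i)"
proof -
  have "inv w (w x) = x" "w (inv w x) = x" for x
    using assms permutes_inverses[of w "{1..n}"] by (auto simp: perms_def)
  then show "inv (lr w (sg i)) = lr (sg i) (inv w)" "inv (lr (sg i) w) = lr (inv w) (sg i)"
    by (auto intro!: inv_equality simp: lr_apply)
qed

definition inversions :: "nat \<Rightarrow> perm \<Rightarrow> (nat \<times> nat) set" where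
  "inversions n w = {(i, j). i \<in> {1..n} \<and> j \<in> {1..n} \<and> i < j \<and> w j < w i}"

lemma len_inversions: "len n w = card (inversions n w)"
  by (simp add: len_def inversions_def)

lemma finite_inversions [simp]: "finite (inversions n w)"
  by (rule finite_subset[of _ "{1..n} \<times> {1..n}"]) (auto simp: inversions_def)

lemma len_id [simp]: "len n id = 0"
  by (auto simp: len_def card_eq_0_iff)

text \<open>With products read from left to right, \<open>lr w (sg i)\<close> exchanges the values i
  and i + 1 of w. Right descents are therefore read off \<open>inv w\<close>, left descents off
  \<open>w\<close>; exactly the pair of positions of these two values becomes an inversion.\<close>

lemma len_lr_sg_up:
  assumes w: "w \<in> perms n" and i: "1 \<le> i" "i < n" and up: "inv w i < inv w (Suc i)"
  shows "len n (lr w (sg i)) = Suc (len n w)"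
proof -
  define a b where "a = inv w i" and "b = inv w (Suc i)"
  have wa: "w x = i \<longleftrightarrow> x = a" "w x = Suc i \<longleftrightarrow> x = b" for x
    using perms_inv_eq[OF w, of i x] perms_inv_eq[OF w, of "Suc i" x] by (auto simp: a_def b_def)
  have ab: "a \<in> {1..n}" "b \<in> {1..n}" "a < b"
    using i up perms_in_iff[OF inv_perms[OF w], of i] perms_in_iff[OF inv_perms[OF w], of "Suc i"]
    by (simp_all add: a_def b_def)
  have "(x, y) \<in> inversions n (lr w (sg i)) \<longleftrightarrow> (x, y) \<in> insert (a, b) (inversions n w)" for x y
  proof (cases "x = a \<and> y = b \<or> x = b \<and> y = a")
    case True
    then show ?thesis
      using ab wa[of a] wa[of b] by (auto simp: inversions_def lr_apply sg_apply)
  next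
    case False
    then have "sg i (w y) < sg i (w x) \<longleftrightarrow> w y < w x"
      using wa by (intro sg_less_iff) auto
    then show ?thesis
      using False by (auto simp: inversions_def lr_apply)
  qed
  then have "inversions n (lr w (sg i)) = insert (a, b) (inversions n w)"
    by auto
  moreover have "(a, b) \<notin> inversions n w"
    using wa(1)[of a] wa(2)[of b] by (auto simp: inversions_def)
  ultimately show ?thesis
    by (simp add: len_inversions)
qed

lemma len_lr_sg_down:
  assumes w: "w \<in> perms n" and i: "1 \<le> i" "i < n" and down: "inv w (Suc i) < inv w i"
  shows "len n w = Suc (len n (lr w (sg i)))"
  using len_lr_sg_up[of "lr w (sg i)" n i] assms
  by (simp add: lr_sg_perms_iff inv_lr_sg[OF w] sg_apply lr_apply)

lemma len_inv:
  assumes "w \<in> perms n"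
  shows "len n (inv w) = len n w"
proof -
  have w: "inv w (w x) = x" "w (inv w x) = x" for x
    using assms permutes_inverses[of w "{1..n}"] by (auto simp: perms_def)
  have "bij_betw (\<lambda>(a, b). (w b, w a)) (inversions n w) (inversions n (inv w))"
  proof (rule bij_betw_byWitness[where f' = "\<lambda>(a, b). (inv w b, inv w a)"])
    show "(\<lambda>(a, b). (w b, w a)) ` inversions n w \<subseteq> inversions n (inv w)"
      using w(1) perms_in_iff[OF assms] by (auto simp only: inversions_def mem_Collect_eq case_prod_conv)
    show "(\<lambda>(a, b). (inv w b, inv w a)) ` inversions n (inv w) \<subseteq> inversions n w"
      using w(2) perms_in_iff[OF inv_perms[OF assms]] by (auto simp only: inversions_def mem_Collect_eq case_prod_conv)
  qed (auto simp: w)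
  then show ?thesis
    by (simp add: len_inversions bij_betw_same_card)
qed

lemma len_sg_lr_up:
  assumes w: "w \<in> perms n" and i: "1 \<le> i" "i < n" and up: "w i < w (Suc i)"
  shows "len n (lr (sg i) w) = Suc (len n w)"
proof -
  have "lr (sg i) w \<in> perms n" using w i by (simp add: lr_sg_perms_iff)
  then have "len n (lr (sg i) w) = len n (lr (inv w) (sg i))"
    by (simp add: len_inv inv_lr_sg(2)[OF w, symmetric])
  also have "\<dots> = Suc (len n w)"
    using len_lr_sg_up[OF inv_perms[OF w] i] up by (simp add: perms_inv_inv[OF w] len_inv[OF w])
  finally show ?thesis .
qed

lemma len_sg_lr_down:
  assumes w: "w \<in> perms n" and i: "1 \<le> i" "i < n" and down: "w (Suc i) < w i"
  shows "len n w = Suc (len n (lr (sg i) w))"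
  using len_sg_lr_up[of "lr (sg i) w" n i] assms
  by (simp add: lr_sg_perms_iff sg_apply lr_apply)

lemma len_lr_sg_less_iff:
  assumes "w \<in> perms n" "1 \<le> i" "i < n"
  shows "len n (lr w (sg i)) < len n w \<longleftrightarrow> inv w (Suc i) < inv w i"
  using len_lr_sg_up[OF assms] len_lr_sg_down[OF assms] perms_inj[OF inv_perms[OF assms(1)], of i "Suc i"]
  by (cases "inv w i" "inv w (Suc i)" rule: linorder_cases) auto

lemma len_sg_lr_less_iff:
  assumes "w \<in> perms n" "1 \<le> i" "i < n"
  shows "len n (lr (sg i) w) < len n w \<longleftrightarrow> w (Suc i) < w i"
  using len_sg_lr_up[OF assms] len_sg_lr_down[OF assms] perms_inj[OF assms(1), of i "Suc i"]
  by (cases "w i" "w (Suc i)" rule: linorder_cases) auto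

lemma ex_descent:
  assumes w: "w \<in> perms n" and "w \<noteq> id"
  obtains i where "1 \<le> i" "i < n" "inv w (Suc i) < inv w i"
proof (rule ccontr)
  note that' = that
  assume "\<not> thesis"
  then have asc: "inv w i < inv w (Suc i)" if "1 \<le> i" "i < n" for i
    using that perms_inj[OF inv_perms[OF w], of i "Suc i"] \<open>\<not> thesis\<close> that'[of i] by force
  have "i \<le> inv w i" if "1 \<le> i" "i \<le> n" for i
    using that
  proof (induction i rule: dec_induct)
    case base
    then show ?case using perms_in_iff[OF inv_perms[OF w], of 1] by auto
  next
    case (step i)
    then show ?case using asc[of i] by simp
  qed
  then have "inv w = id"
    using inv_perms[OF w] by (intro permutes_natset_ge) (auto simp: perms_def)
  then show False
    using \<open>w \<noteq> id\<close> perms_inv_inv[OF w] by simp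
qed

lemma perm_of_word_Nil [simp]: "perm_of_word [] = id"
  by (simp add: perm_of_word_def)

lemma perm_of_word_append: "perm_of_word (u @ v) = lr (perm_of_word u) (perm_of_word v)"
proof -
  have fold: "foldl (\<lambda>w i. lr w (sg i)) x v = lr x (foldl (\<lambda>w i. lr w (sg i)) id v)" for x
    by (induction v rule: rev_induct) (auto simp: lr_assoc)
  show ?thesis unfolding perm_of_word_def foldl_append by (rule fold)
qed

lemma perm_of_word_single [simp]: "perm_of_word [i] = sg i"
  by (simp add: perm_of_word_def)

lemma perm_of_word_Cons: "perm_of_word (i # is) = lr (sg i) (perm_of_word is)"
  by (metis append_Cons append_Nil perm_of_word_append perm_of_word_single)

lemma perm_of_word_perms: "set is \<subseteq> {1..<n} \<Longrightarrow> perm_of_word is \<in> perms n"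
proof (induction "is")
  case (Cons i "is")
  then have "sg i \<in> perms n" "perm_of_word is \<in> perms n" using sg_perms[of i n] by auto
  then show ?case unfolding perm_of_word_Cons by (rule lr_perms)
qed simp

lemma len_perm_of_word: "set is \<subseteq> {1..<n} \<Longrightarrow> len n (perm_of_word is) \<le> length is"
proof (induction "is" rule: rev_induct)
  case (snoc i "is")
  then have "perm_of_word is \<in> perms n" by (intro perm_of_word_perms) auto
  from len_lr_sg_up[OF this, of i] len_lr_sg_down[OF this, of i] perms_inj[OF inv_perms[OF this], of i "Suc i"] snoc
  show ?case
    by (cases "inv (perm_of_word is) i" "inv (perm_of_word is) (Suc i)" rule: linorder_cases)
       (auto simp: perm_of_word_append)
qed simp

definition reduced :: "nat \<Rightarrow> nat list \<Rightarrow> bool" where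
  "reduced n is \<longleftrightarrow> set is \<subseteq> {1..<n} \<and> length is = len n (perm_of_word is)"

lemma reduced_snoc:
  assumes "reduced n is" "1 \<le> i" "i < n" "inv (perm_of_word is) i < inv (perm_of_word is) (Suc i)"
  shows "reduced n (is @ [i])"
proof -
  have s: "set is \<subseteq> {1..<n}" "length is = len n (perm_of_word is)"
    using assms(1) by (auto simp only: reduced_def)
  show ?thesis
    unfolding reduced_def perm_of_word_append perm_of_word_single
      len_lr_sg_up[OF perm_of_word_perms[OF s(1)] assms(2-4)]
    using s assms(2,3) by simp
qed

lemma reduced_Cons:
  assumes "reduced n is" "1 \<le> i" "i < n" "perm_of_word is i < perm_of_word is (Suc i)"
  shows "reduced n (i # is)"
proof -
  have s: "set is \<subseteq> {1..<n}" "length is = len n (perm_of_word is)"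
    using assms(1) by (auto simp only: reduced_def)
  show ?thesis
    unfolding reduced_def perm_of_word_Cons
      len_sg_lr_up[OF perm_of_word_perms[OF s(1)] assms(2-4)]
    using s assms(2,3) by simp
qed

lemma reduced_snocD:
  assumes "reduced n (is @ [i])"
  shows "reduced n is" "1 \<le> i" "i < n" "inv (perm_of_word is) i < inv (perm_of_word is) (Suc i)"
proof -
  have i: "1 \<le> i" "i < n" and s: "set is \<subseteq> {1..<n}" using assms by (auto simp: reduced_def)
  then have p: "perm_of_word is \<in> perms n" by (intro perm_of_word_perms)
  have l: "len n (lr (perm_of_word is) (sg i)) = Suc (length is)"
    using assms by (simp add: reduced_def perm_of_word_append)
  have "\<not> len n (lr (perm_of_word is) (sg i)) < len n (perm_of_word is)"
    using l len_perm_of_word[OF s] by simp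
  then have up: "inv (perm_of_word is) i < inv (perm_of_word is) (Suc i)"
    using len_lr_sg_less_iff[OF p i] perms_inj[OF inv_perms[OF p], of i "Suc i"] by force
  then show "reduced n is"
    using len_lr_sg_up[OF p i up] l s by (simp add: reduced_def)
  show "1 \<le> i" "i < n" "inv (perm_of_word is) i < inv (perm_of_word is) (Suc i)" by fact+
qed

lemma reduced_ConsD:
  assumes "reduced n (i # is)"
  shows "reduced n is" "1 \<le> i" "i < n" "perm_of_word is i < perm_of_word is (Suc i)"
proof -
  have i: "1 \<le> i" "i < n" and s: "set is \<subseteq> {1..<n}" using assms by (auto simp: reduced_def)
  then have p: "perm_of_word is \<in> perms n" by (intro perm_of_word_perms)
  have l: "len n (lr (sg i) (perm_of_word is)) = Suc (length is)"
    using assms by (simp add: reduced_def perm_of_word_Cons)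
  have "\<not> len n (lr (sg i) (perm_of_word is)) < len n (perm_of_word is)"
    using l len_perm_of_word[OF s] by simp
  then have up: "perm_of_word is i < perm_of_word is (Suc i)"
    using len_sg_lr_less_iff[OF p i] perms_inj[OF p, of i "Suc i"] by force
  then show "reduced n is"
    using len_sg_lr_up[OF p i up] l s by (simp add: reduced_def)
  show "1 \<le> i" "i < n" "perm_of_word is i < perm_of_word is (Suc i)" by fact+
qed

lemma ex_reduced: "w \<in> perms n \<Longrightarrow> \<exists>is. reduced n is \<and> perm_of_word is = w"
proof (induction "len n w" arbitrary: w rule: less_induct)
  case less
  show ?case
  proof (cases "w = id")
    case True
    then show ?thesis by (intro exI[of _ "[]"]) (simp add: reduced_def)
  next
    case False
    then obtain i where i: "1 \<le> i" "i < n" "inv w (Suc i) < inv w i"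
      using ex_descent less.prems by blast
    define v where "v = lr w (sg i)"
    have v: "v \<in> perms n" "w = lr v (sg i)" "len n v < len n w"
      using i less.prems len_lr_sg_down[of w n i] by (auto simp: v_def lr_sg_perms_iff)
    obtain "is" where "reduced n is" "perm_of_word is = v"
      using less.hyps[OF v(3,1)] by blast
    moreover have "inv v i < inv v (Suc i)"
      using i less.prems by (simp add: v_def inv_lr_sg sg_apply lr_apply)
    ultimately show ?thesis
      using i v by (intro exI[of _ "is @ [i]"]) (auto simp: perm_of_word_append intro: reduced_snoc)
  qed
qed

lemma rw_reduced:
  assumes "w \<in> perms n"
  shows "reduced n (rw n w)" "perm_of_word (rw n w) = w"
proof -
  have "\<exists>is. set is \<subseteq> {1..<n} \<and> perm_of_word is = w \<and> length is = len n w"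
    using ex_reduced[OF assms] by (auto simp: reduced_def)
  from someI_ex[OF this] show "reduced n (rw n w)" "perm_of_word (rw n w) = w"
    by (auto simp: rw_def reduced_def)
qed

section \<open>Right and left multiplication on the standard basis\<close>

interpretation hv: vector_space hscale
  by unfold_locales (auto simp: hscale_def fun_eq_iff algebra_simps)

lemma hadd_plus: "hadd a b = a + b"
  by (simp add: hadd_def plus_fun_def)

lemma hsub_minus: "hsub a b = a - b"
  by (simp add: hsub_def fun_diff_def)

lemma sum_apply: "(\<Sum>i\<in>A. f i) x = (\<Sum>i\<in>A. f i x)"
  by (induction A rule: infinite_finite_induct) auto

text \<open>TR n i and TL n i are right and left multiplication by T_i. Functions supported outside of S_n
  are scaled by q, so that the relations hold on the whole function type.\<close>
definition TR :: "nat \<Rightarrow> nat \<Rightarrow> hecke \<Rightarrow> hecke" where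
  "TR n i h = (\<lambda>w. if w \<in> perms n then Tgen n i h w else qq * h w)"

definition TL :: "nat \<Rightarrow> nat \<Rightarrow> hecke \<Rightarrow> hecke" where
  "TL n i h = (\<lambda>w. if w \<in> perms n then
     (if len n (lr (sg i) w) < len n w then h (lr (sg i) w) + (qq - 1) * h w else qq * h (lr (sg i) w))
     else qq * h w)"

interpretation TR: linear_ops hscale "TR n" for n
  by unfold_locales (auto simp: TR_def Tgen_def hscale_def fun_eq_iff algebra_simps)

interpretation TL: linear_ops hscale "TL n" for n
  by unfold_locales (auto simp: TL_def hscale_def fun_eq_iff algebra_simps)

text \<open>If s_j w = w s_i, both sides are the same computation with two coefficients. Otherwise
  multiplication on one side does not change whether the other side is a descent, so the two
  operators use independent cases of their definitions.\<close>

lemma TR_TL_commute: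
  assumes i: "1 \<le> i" "i < n" and j: "1 \<le> j" "j < n"
  shows "TR n i (TL n j h) = TL n j (TR n i h)"
proof
  fix w
  show "TR n i (TL n j h) w = TL n j (TR n i h) w"
  proof (cases "w \<in> perms n")
    case w: True
    have p: "lr w (sg i) \<in> perms n" "lr (sg j) w \<in> perms n"
      using w i j by (simp_all add: lr_sg_perms_iff)
    show ?thesis
    proof (cases "lr (sg j) w = lr w (sg i)")
      case True
      then have "lr (sg j) (lr w (sg i)) = w" "lr (lr (sg j) w) (sg i) = w"
        by (metis lr_sg_sg(2,3))+
      then show ?thesis
        using True w p by (simp add: TR_def TL_def Tgen_def)
    next
      case False
      have wj: "w (sg j x) = lr (sg j) w x" "sg i (w x) = lr w (sg i) x" for x
        by (simp_all add: lr_apply)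
      have 1: "len n (lr (sg j) (lr w (sg i))) < len n (lr w (sg i)) \<longleftrightarrow> len n (lr (sg j) w) < len n w"
      proof -
        have "lr (sg j) w = lr w (sg i)" if "{w j, w (Suc j)} = {i, Suc i}"
        proof
          fix x
          have "w x \<noteq> i \<and> w x \<noteq> Suc i" if "x \<noteq> j" "x \<noteq> Suc j"
            using that \<open>{w j, w (Suc j)} = {i, Suc i}\<close> perms_inj[OF w] by (metis doubleton_eq_iff)
          then show "lr (sg j) w x = lr w (sg i) x"
            using that by (auto simp: lr_apply sg_apply doubleton_eq_iff)
        qed
        then have "{w j, w (Suc j)} \<noteq> {i, Suc i}" using False by blast
        then have "sg i (w (Suc j)) < sg i (w j) \<longleftrightarrow> w (Suc j) < w j"
          by (intro sg_less_iff) auto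
        then show ?thesis
          using w p i j by (simp add: len_sg_lr_less_iff lr_apply)
      qed
      have 2: "len n (lr (lr (sg j) w) (sg i)) < len n (lr (sg j) w) \<longleftrightarrow> len n (lr w (sg i)) < len n w"
      proof -
        have "lr (sg j) w = lr w (sg i)" if *: "{inv w i, inv w (Suc i)} = {j, Suc j}"
        proof
          fix x
          have "w j = i \<and> w (Suc j) = Suc i \<or> w j = Suc i \<and> w (Suc j) = i"
            using * perms_inv_eq[OF w] by (auto simp: doubleton_eq_iff)
          moreover have "w x \<noteq> w j \<and> w x \<noteq> w (Suc j)" if "x \<noteq> j" "x \<noteq> Suc j"
            using that perms_inj[OF w] by simp
          ultimately show "lr (sg j) w x = lr w (sg i) x"
            by (auto simp: lr_apply sg_apply)
        qed
        then have "{inv w i, inv w (Suc i)} \<noteq> {j, Suc j}" using False by blast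
        then have "sg j (inv w (Suc i)) < sg j (inv w i) \<longleftrightarrow> inv w (Suc i) < inv w i"
          by (intro sg_less_iff) auto
        then show ?thesis
          using w p i j by (simp add: len_lr_sg_less_iff inv_lr_sg[OF w] lr_apply)
      qed
      show ?thesis
        using w p 1 2 by (simp add: TR_def TL_def Tgen_def lr_assoc algebra_simps)
    qed
  qed (simp add: TR_def TL_def)
qed

lemma fold_TR_TL_commute:
  assumes "set u \<subseteq> {1..<n}" "set v \<subseteq> {1..<n}"
  shows "fold (TR n) u (fold (TL n) v h) = fold (TL n) v (fold (TR n) u h)"
proof -
  have 1: "TR n i (fold (TL n) v h) = fold (TL n) v (TR n i h)" if "1 \<le> i" "i < n" for i h
    using assms(2) that by (induction v arbitrary: h) (auto simp: TR_TL_commute)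
  show ?thesis
    using assms(1) by (induction u arbitrary: h) (auto simp: 1)
qed

lemma TR_hbasis_up:
  assumes "w \<in> perms n" "1 \<le> i" "i < n" "inv w i < inv w (Suc i)"
  shows "TR n i (hbasis w) = hbasis (lr w (sg i))"
proof -
  have "len n (lr w (sg i)) = Suc (len n w)" by (intro len_lr_sg_up assms)
  moreover have "lr w (sg i) \<in> perms n" using assms by (simp add: lr_sg_perms_iff)
  ultimately show ?thesis
    using assms by (auto simp: TR_def Tgen_def hbasis_def fun_eq_iff[of "_ :: hecke"] lr_sg_eq_iff)
qed

lemma TL_hbasis_up:
  assumes "w \<in> perms n" "1 \<le> i" "i < n" "w i < w (Suc i)"
  shows "TL n i (hbasis w) = hbasis (lr (sg i) w)"
proof -
  have "len n (lr (sg i) w) = Suc (len n w)" by (intro len_sg_lr_up assms)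
  moreover have "lr (sg i) w \<in> perms n" using assms by (simp add: lr_sg_perms_iff)
  ultimately show ?thesis
    using assms by (auto simp: TL_def hbasis_def fun_eq_iff[of "_ :: hecke"] lr_sg_eq_iff)
qed

lemma fold_TR_hone: "reduced n is \<Longrightarrow> fold (TR n) is hone = hbasis (perm_of_word is)"
proof (induction "is" rule: rev_induct)
  case (snoc i "is")
  note r = reduced_snocD[OF snoc.prems]
  have "perm_of_word is \<in> perms n" using r(1) by (intro perm_of_word_perms) (simp add: reduced_def)
  then show ?case using snoc r by (simp add: TR_hbasis_up perm_of_word_append)
qed (simp add: hone_def)

lemma fold_TL_hone: "reduced n is \<Longrightarrow> fold (TL n) (rev is) hone = hbasis (perm_of_word is)"
proof (induction "is")
  case (Cons i "is")
  note r = reduced_ConsD[OF Cons.prems]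
  have "perm_of_word is \<in> perms n" using r(1) by (intro perm_of_word_perms) (simp add: reduced_def)
  then show ?case using Cons r by (simp add: TL_hbasis_up perm_of_word_Cons)
qed (simp add: hone_def)

definition supp :: "nat \<Rightarrow> hecke \<Rightarrow> bool" where
  "supp n h \<longleftrightarrow> (\<forall>w. w \<notin> perms n \<longrightarrow> h w = 0)"

lemma supp_TR: "supp n h \<Longrightarrow> supp n (TR n i h)"
  by (simp add: supp_def TR_def)

lemma supp_fold_TR: "supp n h \<Longrightarrow> supp n (fold (TR n) w h)"
  by (induction w arbitrary: h) (auto intro: supp_TR)

lemma supp_hbasis: "w \<in> perms n \<Longrightarrow> supp n (hbasis w)"
  by (auto simp: supp_def hbasis_def)

lemma supp_add: "supp n a \<Longrightarrow> supp n b \<Longrightarrow> supp n (a + b)"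
  by (simp add: supp_def)

lemma supp_scale: "supp n a \<Longrightarrow> supp n (hscale c a)"
  by (simp add: supp_def hscale_def)

lemma supp_sum: "(\<And>i. i \<in> A \<Longrightarrow> supp n (f i)) \<Longrightarrow> supp n (sum f A)"
  by (auto simp: supp_def sum_apply)

lemma supp_expand:
  assumes "supp n h"
  shows "h = (\<Sum>w\<in>perms n. hscale (h w) (hbasis w))"
proof
  fix v
  have "(\<Sum>w\<in>perms n. hscale (h w) (hbasis w)) v = (\<Sum>w\<in>perms n. if v = w then h w else 0)"
    by (simp add: sum_apply hscale_def hbasis_def if_distrib cong: if_cong)
  also have "\<dots> = h v" using assms by (auto simp: supp_def)
  finally show "h v = (\<Sum>w\<in>perms n. hscale (h w) (hbasis w)) v" by simp
qed

text \<open>Since T_v is a product of left multiplications applied to 1, which commute with right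
  multiplications, right multiplication by a reduced word depends only on its product.\<close>
lemma fold_TR_reduced_eq:
  assumes r: "reduced n is" "reduced n is'" and eq: "perm_of_word is = perm_of_word is'"
  shows "fold (TR n) is h = fold (TR n) is' h"
proof -
  have s: "set is \<subseteq> {1..<n}" "set is' \<subseteq> {1..<n}" using r by (auto simp: reduced_def)
  have basis: "fold (TR n) is (hbasis v) = fold (TR n) is' (hbasis v)" if v: "v \<in> perms n" for v
  proof -
    have rv: "reduced n (rw n v)" "perm_of_word (rw n v) = v" by (rule rw_reduced[OF v])+
    then have sv: "set (rev (rw n v)) \<subseteq> {1..<n}" by (auto simp: reduced_def)
    have "hbasis v = fold (TL n) (rev (rw n v)) hone"
      using fold_TL_hone[OF rv(1)] rv(2) by simp
    then show ?thesis
      using fold_TR_TL_commute[OF s(1) sv] fold_TR_TL_commute[OF s(2) sv] fold_TR_hone[OF r(1)] fold_TR_hone[OF r(2)] eq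
      by simp
  qed
  \<comment> \<open>Off S_n each letter only multiplies by q, so there just the common length of the
    two words counts.\<close>
  define h1 where "h1 = (\<lambda>w. if w \<in> perms n then h w else 0)"
  define h2 where "h2 = (\<lambda>w. if w \<in> perms n then 0 else h w)"
  have h: "h = h1 + h2" by (auto simp: h1_def h2_def fun_eq_iff)
  have "supp n h1" by (simp add: supp_def h1_def)
  then have "h1 = (\<Sum>w\<in>perms n. hscale (h1 w) (hbasis w))" by (rule supp_expand)
  then have 1: "fold (TR n) is h1 = fold (TR n) is' h1"
    by (metis (no_types, lifting) TR.fold_T_scale TR.fold_T_sum basis sum.cong)
  have 2: "fold (TR n) w h2 = hscale (qq ^ length w) h2" if "set w \<subseteq> {1..<n}" for w
    using that
  proof (induction w rule: rev_induct)
    case (snoc i w)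
    have "TR n i h2 = hscale qq h2"
      using snoc.prems by (auto simp: TR_def Tgen_def h2_def hscale_def fun_eq_iff[of "_ :: hecke"] lr_sg_perms_iff)
    then show ?case using snoc by (simp add: TR.T_scale mult.commute)
  qed simp
  have "length is = length is'" using r eq by (simp add: reduced_def)
  then show ?thesis
    unfolding h TR.fold_T_add using 1 2 s by simp
qed

lemma reduced_Nil: "reduced n []"
  by (simp add: reduced_def)

lemma reduced_single: "1 \<le> i \<Longrightarrow> i < n \<Longrightarrow> reduced n [i]"
  by (intro reduced_Cons reduced_Nil) auto

text \<open>The quadratic relation is read off the coefficients; commutation and braid relations
  compare two reduced words of one permutation.\<close>

interpretation TR: hecke_rep hscale n "TR n" for n
proof
  fix i x assume i: "1 \<le> i" "i < n"
  show "TR n i (TR n i x) = hscale (qq - 1) (TR n i x) + hscale qq x"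
  proof
    fix w
    have "len n (lr w (sg i)) < len n w \<longleftrightarrow> \<not> len n w < len n (lr w (sg i))" if "w \<in> perms n"
      using len_lr_sg_up[OF that i] len_lr_sg_down[OF that i] perms_inj[OF inv_perms[OF that], of i "Suc i"]
      by (cases "inv w i" "inv w (Suc i)" rule: linorder_cases) auto
    then show "TR n i (TR n i x) w = (hscale (qq - 1) (TR n i x) + hscale qq x) w"
      using i by (auto simp: TR_def Tgen_def hscale_def lr_sg_perms_iff algebra_simps)
  qed
next
  fix i j x assume ij: "1 \<le> i" "Suc i < j" "j < n"
  have "fold (TR n) [i, j] x = fold (TR n) [j, i] x"
  proof (rule fold_TR_reduced_eq)
    show "reduced n [i, j]" "reduced n [j, i]"
      using ij by (auto intro!: reduced_Cons reduced_Nil simp: sg_apply)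
    show "perm_of_word [i, j] = perm_of_word [j, i]"
      using ij by (auto simp: perm_of_word_Cons fun_eq_iff lr_apply sg_apply)
  qed
  then show "TR n i (TR n j x) = TR n j (TR n i x)" by simp
next
  fix i x assume i: "1 \<le> i" "Suc i < n"
  have "fold (TR n) [i, Suc i, i] x = fold (TR n) [Suc i, i, Suc i] x"
  proof (rule fold_TR_reduced_eq)
    show "reduced n [i, Suc i, i]" "reduced n [Suc i, i, Suc i]"
      using i by (auto intro!: reduced_Cons reduced_Nil simp: perm_of_word_Cons lr_apply sg_apply)
    show "perm_of_word [i, Suc i, i] = perm_of_word [Suc i, i, Suc i]"
      by (auto simp: perm_of_word_Cons fun_eq_iff lr_apply sg_apply)
  qed
  then show "TR n i (TR n (Suc i) (TR n i x)) = TR n (Suc i) (TR n i (TR n (Suc i) x))" by simp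
qed

definition mul_T :: "nat \<Rightarrow> hecke \<Rightarrow> perm \<Rightarrow> hecke" where
  "mul_T n a w = fold (TR n) (rw n w) a"

lemma mul_T_word: "reduced n is \<Longrightarrow> mul_T n a (perm_of_word is) = fold (TR n) is a"
  unfolding mul_T_def
  by (intro fold_TR_reduced_eq rw_reduced perm_of_word_perms) (auto simp: reduced_def)

lemma mul_T_id [simp]: "mul_T n a id = a"
  using mul_T_word[OF reduced_Nil] by simp

lemma mul_T_hone: "w \<in> perms n \<Longrightarrow> mul_T n hone w = hbasis w"
  unfolding mul_T_def using fold_TR_hone rw_reduced by metis

lemma supp_mul_T: "supp n a \<Longrightarrow> supp n (mul_T n a w)"
  by (simp add: mul_T_def supp_fold_TR)

lemma mul_T_up:
  assumes w: "w \<in> perms n" and i: "1 \<le> i" "i < n" and up: "inv w i < inv w (Suc i)"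
  shows "mul_T n a (lr w (sg i)) = TR n i (mul_T n a w)"
  using mul_T_word[of n "rw n w @ [i]" a] rw_reduced[OF w] i up
  by (simp add: reduced_snoc perm_of_word_append mul_T_def)

lemma mul_T_down:
  assumes w: "w \<in> perms n" and i: "1 \<le> i" "i < n" and down: "inv w (Suc i) < inv w i"
  shows "TR n i (mul_T n a w) = hscale (qq - 1) (mul_T n a w) + hscale qq (mul_T n a (lr w (sg i)))"
proof -
  have "mul_T n a (lr (lr w (sg i)) (sg i)) = TR n i (mul_T n a (lr w (sg i)))"
    using assms by (intro mul_T_up) (auto simp: lr_sg_perms_iff inv_lr_sg[OF w] lr_apply sg_apply)
  then show ?thesis using TR.T_quad[OF i, of "mul_T n a (lr w (sg i))"] by simp
qed

lemma Tgen_eq_TR: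
  assumes "supp n h" "1 \<le> i" "i < n"
  shows "Tgen n i h = TR n i h"
  using assms by (auto simp: TR_def Tgen_def supp_def fun_eq_iff[of "_ :: hecke"] lr_sg_perms_iff)

lemma hword_eq:
  assumes "supp n a" "set is \<subseteq> {1..<n}"
  shows "hword n a is = fold (TR n) is a"
  using assms(2)
proof (induction "is" rule: rev_induct)
  case (snoc i "is")
  then show ?case using Tgen_eq_TR[of n "fold (TR n) is a" i] assms(1)
    by (simp add: hword_def supp_fold_TR)
qed (simp add: hword_def)

text \<open>\<open>hmul\<close> is built from \<open>Tgen\<close>, which is compared with
  \<open>TR\<close> on functions supported in S_n; this is why \<open>supp\<close> accompanies left
  factors from here on.\<close>

lemma hmul_eq:
  assumes "supp n a"
  shows "hmul n a b = (\<Sum>w\<in>perms n. hscale (b w) (mul_T n a w))"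
proof
  fix v
  have "hword n a (rw n w) = mul_T n a w" if "w \<in> perms n" for w
    using hword_eq[OF assms] rw_reduced(1)[OF that] by (simp add: mul_T_def reduced_def)
  then show "hmul n a b v = (\<Sum>w\<in>perms n. hscale (b w) (mul_T n a w)) v"
    by (simp add: hmul_def sum_apply hscale_def)
qed

lemma supp_hmul: "supp n a \<Longrightarrow> supp n (hmul n a b)"
  by (simp add: hmul_eq supp_sum supp_scale supp_mul_T)

lemma hmul_add: "hmul n a (b + c) = hmul n a b + hmul n a c"
  by (auto simp: hmul_def fun_eq_iff algebra_simps sum.distrib)

lemma hmul_scale: "hmul n a (hscale x b) = hscale x (hmul n a b)"
  by (auto simp: hmul_def fun_eq_iff hscale_def sum_distrib_left mult.assoc)

lemma hmul_diff: "hmul n a (b - c) = hmul n a b - hmul n a c"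
  by (auto simp: hmul_def fun_eq_iff algebra_simps sum_subtractf)

lemma hmul_sum: "hmul n a (\<Sum>i\<in>A. f i) = (\<Sum>i\<in>A. hmul n a (f i))"
proof (induction A rule: infinite_finite_induct)
  case empty
  show ?case by (auto simp: hmul_def fun_eq_iff)
next
  case (infinite A)
  then show ?case by (auto simp: hmul_def fun_eq_iff)
next
  case (insert x F)
  then show ?case by (simp only: sum.insert hmul_add not_False_eq_True)
qed

lemma hmul_hbasis:
  assumes "supp n a" "w \<in> perms n"
  shows "hmul n a (hbasis w) = mul_T n a w"
proof -
  have "hmul n a (hbasis w) = (\<Sum>v\<in>perms n. if v = w then mul_T n a v else 0)"
    unfolding hmul_eq[OF assms(1)] by (intro sum.cong) (auto simp: hbasis_def)
  then show ?thesis using assms(2) by simp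
qed

lemma hmul_hone: "supp n a \<Longrightarrow> hmul n a hone = a"
  by (simp add: hone_def hmul_hbasis)

lemma supp_hone: "supp n hone"
  by (simp add: hone_def supp_hbasis)

lemma hone_hmul: "supp n b \<Longrightarrow> hmul n hone b = b"
  using supp_expand[of n b] by (simp add: hmul_eq supp_hone mul_T_hone)

lemma hmul_sg: "supp n a \<Longrightarrow> 1 \<le> i \<Longrightarrow> i < n \<Longrightarrow> hmul n a (hbasis (sg i)) = TR n i a"
  using mul_T_word[OF reduced_single, of i n a] by (simp add: hmul_hbasis sg_perms)

text \<open>The core of associativity. On a basis element T_w, the ascent and descent rules for T_w
  T_i and for (a T_w) T_i have the same form.\<close>

lemma hmul_TR:
  assumes a: "supp n a" and b: "supp n b" and i: "1 \<le> i" "i < n"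
  shows "hmul n a (TR n i b) = TR n i (hmul n a b)"
proof -
  have basis: "hmul n a (TR n i (hbasis w)) = TR n i (hmul n a (hbasis w))" if w: "w \<in> perms n" for w
  proof (cases "inv w i < inv w (Suc i)")
    case True
    then show ?thesis
      using a w i by (simp add: TR_hbasis_up hmul_hbasis lr_sg_perms_iff mul_T_up)
  next
    case False
    then have down: "inv w (Suc i) < inv w i"
      using perms_inj[OF inv_perms[OF w], of i "Suc i"] by simp
    have "TR n i (hbasis w) = hscale (qq - 1) (hbasis w) + hscale qq (hbasis (lr w (sg i)))"
      using mul_T_down[OF w i down, of hone] w i by (simp add: mul_T_hone lr_sg_perms_iff)
    then show ?thesis
      using mul_T_down[OF w i down, of a] a w i by (simp add: hmul_add hmul_scale hmul_hbasis lr_sg_perms_iff)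
  qed
  show ?thesis
    by (subst (1 2) supp_expand[OF b]) (simp add: TR.T_sum TR.T_scale hmul_sum hmul_scale basis)
qed

lemma hmul_fold_TR:
  assumes a: "supp n a" and b: "supp n b" and "set w \<subseteq> {1..<n}"
  shows "hmul n a (fold (TR n) w b) = fold (TR n) w (hmul n a b)"
  using assms(3)
proof (induction w rule: rev_induct)
  case (snoc i w)
  then show ?case using hmul_TR[OF a supp_fold_TR[OF b], of i w] by simp
qed simp

lemma hmul_assoc:
  assumes a: "supp n a" and b: "supp n b"
  shows "hmul n (hmul n a b) c = hmul n a (hmul n b c)"
proof -
  have "hmul n a (mul_T n b w) = mul_T n (hmul n a b) w" if "w \<in> perms n" for w
    unfolding mul_T_def using rw_reduced(1)[OF that] by (intro hmul_fold_TR a b) (simp add: reduced_def)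
  then show ?thesis
    by (simp add: hmul_eq[OF supp_hmul[OF a]] hmul_eq[OF b] hmul_sum hmul_scale)
qed

lemma hmul_feval:
  assumes "supp n a" "gens x \<subseteq> {1..<n}"
  shows "supp n (feval n x)" "hmul n a (feval n x) = TR.act n x a"
proof -
  have supp: "supp n (feval n x)" if "gens x \<subseteq> {1..<n}" for x
    using that by (induction x) (auto simp: supp_hone hadd_plus sg_perms intro: supp_scale supp_add supp_hmul supp_hbasis)
  then show "supp n (feval n x)" using assms by simp
  show "hmul n a (feval n x) = TR.act n x a"
    using assms
  proof (induction x arbitrary: a)
    case (FMul x y)
    have "hmul n a (feval n (FMul x y)) = hmul n (hmul n a (feval n x)) (feval n y)"
      using FMul.prems supp[of x] by (simp add: hmul_assoc)
    then show ?case using FMul by (simp add: supp_hmul flip: FMul.IH(1))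
  qed (simp_all add: hmul_hone hmul_sg hmul_scale hadd_plus hmul_add)
qed

section \<open>Jucys-Murphy elements in the standard basis\<close>

lemma perm_tr: "i < m \<Longrightarrow> lr (lr (sg m) (tr i m)) (sg m) = tr i (Suc m)"
  by (auto simp: fun_eq_iff lr_apply sg_apply tr_def)

lemma tr_perms:
  assumes "1 \<le> i" "i \<le> n" "1 \<le> j" "j \<le> n"
  shows "tr i j \<in> perms n"
proof -
  have "tr i j = transpose i j" by (simp add: fun_eq_iff tr_def transpose_def)
  then show ?thesis using permutes_swap_id[of i "{1..n}" j] assms by (simp add: perms_def)
qed

text \<open>(i, m+1) = s_m (i, m) s_m with lengths adding up, hence T_{(i,m+1)} = T_m T_{(i,m)}
  T_m.\<close>

lemma mul_T_tr:
  assumes "1 \<le> i" "i < m" "m < n"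
  shows "mul_T n a (tr i (Suc m)) = TR n m (mul_T n (TR n m a) (tr i m))"
proof -
  have p: "tr i m \<in> perms n" using assms by (intro tr_perms) auto
  define w where "w = rw n (tr i m)"
  have w: "reduced n w" "perm_of_word w = tr i m"
    using rw_reduced[OF p] by (simp_all add: w_def)
  have invp: "inv (tr i m) = tr i m"
    by (intro inv_equality) (auto simp: tr_def)
  have "inv (tr i m) m < inv (tr i m) (Suc m)"
    unfolding invp using assms by (simp add: tr_def)
  then have "reduced n (w @ [m])"
    using assms w by (intro reduced_snoc) simp_all
  then have "reduced n (m # w @ [m])"
    using assms w by (intro reduced_Cons) (auto simp: perm_of_word_append lr_apply sg_apply tr_def)
  moreover have "perm_of_word (m # w @ [m]) = tr i (Suc m)"
    using perm_tr[OF assms(2)] w by (simp add: perm_of_word_Cons perm_of_word_append lr_assoc)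
  ultimately show ?thesis
    using mul_T_word[of n "m # w @ [m]" a] by (simp add: mul_T_def w_def)
qed

lemma mul_T_tr_Suc:
  assumes "1 \<le> m" "m < n"
  shows "mul_T n a (tr m (Suc m)) = TR n m a"
  using mul_T_word[OF reduced_single[OF assms], of a] by (simp add: sg_def)

lemma Lop_sum: "Lop n m = (\<Sum>i=1..m - 1. hscale (inverse (qq ^ i)) (hbasis (tr (m - i) m)))"
  by (simp add: Lop_def fun_eq_iff sum_apply hscale_def)

text \<open>In the sum for L_{m+1} the term of the simple transposition is q^{-1} T_m, and by
  \<open>mul_T_tr\<close> the remaining terms make up q^{-1} T_m L_m T_m.\<close>

lemma hmul_Lop:
  assumes "supp n a" "m \<le> n"
  shows "hmul n a (Lop n m) = TR.L n m a"
proof -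
  have eq: "hmul n a (Lop n m) = (\<Sum>i=1..m - 1. hscale (inverse (qq ^ i)) (mul_T n a (tr (m - i) m)))"
    if "supp n a" "m \<le> n" for a m
    using that by (auto simp: Lop_sum hmul_sum hmul_scale hmul_hbasis tr_perms intro!: sum.cong)
  show ?thesis
    using assms
  proof (induction m arbitrary: a)
    case 0
    then show ?case by (simp add: eq)
  next
    case (Suc m)
    show ?case
    proof (cases "m = 0")
      case True
      then show ?thesis using Suc.prems by (simp add: eq)
    next
      case False
      have "hmul n a (Lop n (Suc m)) = (\<Sum>i=1..m. hscale (inverse (qq ^ i)) (mul_T n a (tr (Suc m - i) (Suc m))))"
        using Suc.prems by (simp add: eq)
      also have "\<dots> = hscale (inverse qq) (mul_T n a (tr m (Suc m)))
          + (\<Sum>i=Suc 1..m. hscale (inverse (qq ^ i)) (mul_T n a (tr (Suc m - i) (Suc m))))"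
        using False by (subst sum.atLeast_Suc_atMost) auto
      also have "(\<Sum>i=Suc 1..m. hscale (inverse (qq ^ i)) (mul_T n a (tr (Suc m - i) (Suc m))))
        = (\<Sum>i=1..m - 1. hscale (inverse (qq ^ Suc i)) (mul_T n a (tr (m - i) (Suc m))))"
        using sum.shift_bounds_cl_Suc_ivl[of "\<lambda>i. hscale (inverse (qq ^ i)) (mul_T n a (tr (Suc m - i) (Suc m)))" 1 "m - 1"] False
        by simp
      also have "\<dots> = (\<Sum>i=1..m - 1. hscale (inverse qq) (TR n m (hscale (inverse (qq ^ i)) (mul_T n (TR n m a) (tr (m - i) m)))))"
        using Suc.prems by (intro sum.cong) (auto simp: mul_T_tr TR.T_scale)
      also have "\<dots> = hscale (inverse qq) (TR n m (hmul n (TR n m a) (Lop n m)))"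
        using Suc.prems by (simp add: eq supp_TR TR.T_sum hv.scale_sum_right)
      also have "hmul n (TR n m a) (Lop n m) = TR.L n m (TR n m a)"
        using Suc by (simp add: supp_TR)
      finally show ?thesis
        using False Suc.prems by (simp add: TR.L_Suc mul_T_tr_Suc hv.scale_right_distrib add.commute)
    qed
  qed
qed

section \<open>The ideal of more dominant shapes\<close>

context hecke_rep
begin

text \<open>eig p ks x: x is a q-eigenvector of the generators inside the consecutive blocks of sizes ks
  that start after position p.\<close>
primrec eig :: "nat \<Rightarrow> nat list \<Rightarrow> 'v \<Rightarrow> bool" where
  "eig p [] x \<longleftrightarrow> True"
| "eig p (a # ks) x \<longleftrightarrow> (\<forall>i. p < i \<longrightarrow> i < p + a \<longrightarrow> T i x = qq *s x) \<and> eig (p + a) ks x"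

lemma eig_append: "eig p (ks @ ls) x \<longleftrightarrow> eig p ks x \<and> eig (p + sum_list ks) ls x"
  by (induction ks arbitrary: p) (auto simp: add.assoc)

lemma eig_mono:
  "eig p ks x \<Longrightarrow> (\<And>i. p < i \<Longrightarrow> i < p + sum_list ks \<Longrightarrow> T i x = qq *s x \<Longrightarrow> T i y = qq *s y) \<Longrightarrow> eig p ks y"
  by (induction ks arbitrary: p) auto

lemma eigI:
  assumes "\<And>r i. r < length ks \<Longrightarrow> p + psum ks r < i \<Longrightarrow> i < p + psum ks (Suc r) \<Longrightarrow> T i x = qq *s x"
  shows "eig p ks x"
  using assms
proof (induction ks arbitrary: p)
  case (Cons a ks)
  have "T i x = qq *s x" if "p < i" "i < p + a" for i
    using Cons.prems[of 0 i] that by simp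
  moreover have "eig (p + a) ks x"
    using Cons.prems[of "Suc _"] by (intro Cons.IH) (auto simp: add.assoc)
  ultimately show ?case by simp
qed simp

lemma eigD:
  "eig p ks x \<Longrightarrow> r < length ks \<Longrightarrow> p + psum ks r < i \<Longrightarrow> i < p + psum ks (Suc r) \<Longrightarrow> T i x = qq *s x"
proof (induction ks arbitrary: p r)
  case (Cons a ks)
  show ?case
  proof (cases r)
    case 0
    then show ?thesis using Cons.prems by simp
  next
    case (Suc r')
    then show ?thesis using Cons.prems Cons.IH[of "p + a" r'] by (simp add: add.assoc)
  qed
qed simp

text \<open>swap p a b is right multiplication by T_w, where w exchanges the block of length a after position p
  with the following block of length b.\<close>
definition "pass b j = fold T [j..<j + b]"

primrec swap :: "nat \<Rightarrow> nat \<Rightarrow> nat \<Rightarrow> 'v \<Rightarrow> 'v" where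
  "swap p 0 b x = x"
| "swap p (Suc a) b x = pass b (Suc p) (swap (Suc p) a b x)"

lemma T_pass_commute:
  "1 \<le> i \<Longrightarrow> i < n \<Longrightarrow> 1 \<le> j \<Longrightarrow> j + b \<le> n \<Longrightarrow> Suc i < j \<or> j + b < i \<Longrightarrow> T i (pass b j x) = pass b j (T i x)"
  unfolding pass_def by (intro T_fold_T_commute) auto

lemma T_pass: "1 \<le> j \<Longrightarrow> j \<le> i \<Longrightarrow> Suc i < j + b \<Longrightarrow> j + b \<le> n \<Longrightarrow> T i (pass b j x) = pass b j (T (Suc i) x)"
  unfolding pass_def by (intro T_fold_upt) auto

text \<open>Two neighbouring entries travel past the same block; the generator exchanging them is
  T_j before the journey and T_{j+b} after it.\<close>

lemma T_pass_pass:
  "1 \<le> j \<Longrightarrow> Suc (j + b) \<le> n \<Longrightarrow> 1 \<le> b \<Longrightarrow> T (j + b) (pass b j (pass b (Suc j) x)) = pass b j (pass b (Suc j) (T j x))"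
proof (induction b arbitrary: x)
  case (Suc b)
  have split: "pass (Suc b) i y = T (i + b) (pass b i y)" for i y
    by (simp add: pass_def)
  let ?t = "T (j + b)" and ?u = "T (Suc (j + b))"
  have u: "pass b j (?u y) = ?u (pass b j y)" for y
    using Suc.prems by (intro T_pass_commute[symmetric]) auto
  have braid: "?u (?t (?u y)) = ?t (?u (?t y))" for y
    using Suc.prems by (intro T_braid[symmetric]) auto
  have "?t (pass b j (pass b (Suc j) x)) = pass b j (pass b (Suc j) (T j x))"
  proof (cases "b = 0")
    case False
    then show ?thesis using Suc by simp
  qed (simp add: pass_def)
  then show ?case
    using braid by (simp add: split u)
qed simp

lemma T_swap_first:
  "p < i \<Longrightarrow> i < p + b \<Longrightarrow> p + a + b \<le> n \<Longrightarrow> T i (swap p a b x) = swap p a b (T (i + a) x)"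
proof (induction a arbitrary: p i)
  case (Suc a)
  then have "T i (swap p (Suc a) b x) = pass b (Suc p) (T (Suc i) (swap (Suc p) a b x))"
    by (simp add: T_pass)
  then show ?case using Suc.IH[of "Suc p" "Suc i"] Suc.prems by simp
qed simp

lemma T_swap_commute:
  "1 \<le> i \<Longrightarrow> i < n \<Longrightarrow> p + a + b \<le> n \<Longrightarrow> i < p \<or> p + a + b < i \<Longrightarrow> T i (swap p a b x) = swap p a b (T i x)"
proof (induction a arbitrary: p)
  case (Suc a)
  have "T i (pass b (Suc p) y) = pass b (Suc p) (T i y)" for y
    using Suc.prems by (intro T_pass_commute) auto
  then show ?case using Suc.IH[of "Suc p"] Suc.prems by auto
qed simp

lemma T_swap_second:
  "p + b < i \<Longrightarrow> i < p + a + b \<Longrightarrow> p + a + b \<le> n \<Longrightarrow> 1 \<le> b \<Longrightarrow> T i (swap p a b x) = swap p a b (T (i - b) x)"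
proof (induction a arbitrary: p)
  case (Suc a)
  show ?case
  proof (cases "i = Suc (p + b)")
    case True
    then obtain a' where a: "a = Suc a'" using Suc.prems by (cases a) auto
    have "T (Suc p + b) (pass b (Suc p) (pass b (Suc (Suc p)) y)) = pass b (Suc p) (pass b (Suc (Suc p)) (T (Suc p) y))" for y
      using Suc.prems a by (intro T_pass_pass) auto
    moreover have "T (Suc p) (swap (Suc (Suc p)) a' b x) = swap (Suc (Suc p)) a' b (T (Suc p) x)"
      using Suc.prems a by (intro T_swap_commute) auto
    ultimately show ?thesis using True a by simp
  next
    case False
    have "T i (pass b (Suc p) y) = pass b (Suc p) (T i y)" for y
      using Suc.prems False by (intro T_pass_commute) auto
    then show ?thesis using Suc False by simp
  qed
qed simp

lemma swap_scale: "swap p a b (c *s x) = c *s swap p a b x"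
  by (induction a arbitrary: p) (auto simp: pass_def fold_T_scale)

text \<open>Exchanging the two blocks conjugates the Young subgroup of one composition into that of
  the other, generator by generator, so it carries q-eigenvectors to q-eigenvectors.\<close>

lemma eig_swap:
  assumes eig: "eig 0 (ks @ a # b # ls) x" and n: "sum_list (ks @ a # b # ls) = n" and b: "1 \<le> b"
  shows "eig 0 (ks @ b # a # ls) (swap (sum_list ks) a b x)"
proof -
  define p where "p = sum_list ks"
  have pn: "p + a + b \<le> n" using n by (simp add: p_def)
  have x: "eig 0 ks x" "\<And>i. p < i \<Longrightarrow> i < p + a \<Longrightarrow> T i x = qq *s x"
    "\<And>i. p + a < i \<Longrightarrow> i < p + a + b \<Longrightarrow> T i x = qq *s x" "eig (p + a + b) ls x"
    using eig by (auto simp: eig_append p_def)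
  have "eig 0 ks (swap p a b x)"
  proof (rule eig_mono[OF x(1)])
    fix i assume "0 < i" "i < 0 + sum_list ks" "T i x = qq *s x"
    then show "T i (swap p a b x) = qq *s swap p a b x"
      using pn by (subst T_swap_commute) (auto simp: p_def swap_scale)
  qed
  moreover have "T i (swap p a b x) = qq *s swap p a b x" if "p < i" "i < p + b" for i
    using that pn x(3)[of "i + a"] by (simp add: T_swap_first swap_scale)
  moreover have "T i (swap p a b x) = qq *s swap p a b x" if "p + b < i" "i < p + b + a" for i
    using that pn b x(2)[of "i - b"] by (simp add: T_swap_second swap_scale)
  moreover have "eig (p + b + a) ls (swap p a b x)"
  proof -
    have "eig (p + a + b) ls (swap p a b x)"
    proof (rule eig_mono[OF x(4)])
      fix i assume "p + a + b < i" "i < p + a + b + sum_list ls" "T i x = qq *s x"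
      then show "T i (swap p a b x) = qq *s swap p a b x"
        using n pn by (subst T_swap_commute) (auto simp: p_def swap_scale)
    qed
    then show ?thesis by (simp add: ac_simps)
  qed
  ultimately show ?thesis
    by (simp add: eig_append p_def)
qed

lemma T_inverse:
  assumes "1 \<le> i" "i < n"
  shows "x = inverse qq *s (T i (T i x) - (qq - 1) *s T i x)"
  using T_quad[OF assms, of x] by simp

text \<open>Each T_i is invertible with inverse a polynomial in T_i, so an invariant subspace is
  also invariant under the inverses.\<close>

lemma swap_in_subspaceD:
  assumes N: "subspace N" "\<And>i x. 1 \<le> i \<Longrightarrow> i < n \<Longrightarrow> x \<in> N \<Longrightarrow> T i x \<in> N"
    and "p + a + b \<le> n" "swap p a b x \<in> N"
  shows "x \<in> N"
proof -
  have T: "x \<in> N" if "1 \<le> i" "i < n" "T i x \<in> N" for i x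
    by (subst T_inverse[OF that(1,2)]) (intro subspace_scale subspace_diff N that)
  have fold: "x \<in> N" if "fold T w x \<in> N" "set w \<subseteq> {1..<n}" for w x
    using that by (induction w arbitrary: x) (auto intro: T)
  show ?thesis
    using assms(3,4)
  proof (induction a arbitrary: p)
    case (Suc a)
    have "swap (Suc p) a b x \<in> N"
    proof (rule fold)
      show "fold T [Suc p..<Suc p + b] (swap (Suc p) a b x) \<in> N"
        using Suc.prems by (simp add: pass_def)
      show "set [Suc p..<Suc p + b] \<subseteq> {1..<n}"
        using Suc.prems by auto
    qed
    then show ?case using Suc by (intro Suc.IH[of "Suc p"]) auto
  qed simp
qed

end

lemma supp_swap: "supp n x \<Longrightarrow> supp n (TR.swap n p a b x)"
  by (induction a arbitrary: p) (auto simp: TR.pass_def supp_fold_TR)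

text \<open>The insertion step of insertion sort; every exchange puts a larger part earlier and can
  only increase partial sums. \<open>P\<close> passes from the sorted list back to the unsorted one,
  the direction in which an eigenvector is exchanged, placed in N, and exchanged back. The prefix
  \<open>us\<close> is left free so that the induction can work below the head of the list.\<close>

lemma insert_descending:
  assumes swap: "\<And>us a b vs. a < b \<Longrightarrow> P (us @ b # a # vs) \<Longrightarrow> P (us @ a # b # vs)"
    and "sorted_wrt (\<ge>) ys"
  shows "\<exists>zs. sorted_wrt (\<ge>) zs \<and> mset zs = mset (x # ys) \<and> (\<forall>k. psum (x # ys) k \<le> psum zs k)
    \<and> (\<forall>us. P (us @ zs) \<longrightarrow> P (us @ x # ys))"
  using assms(2)
proof (induction ys)
  case Nil
  then show ?case by (intro exI[of _ "[x]"]) auto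
next
  case (Cons y ys)
  show ?case
  proof (cases "x < y")
    case False
    then show ?thesis using Cons.prems by (intro exI[of _ "x # y # ys"]) auto
  next
    case True
    from Cons obtain zs where zs: "sorted_wrt (\<ge>) zs" "mset zs = mset (x # ys)"
      "\<And>k. psum (x # ys) k \<le> psum zs k" "\<And>us. P (us @ zs) \<Longrightarrow> P (us @ x # ys)"
      by auto
    have "set zs = insert x (set ys)"
      using zs(2) by (metis list.simps(15) set_mset_mset)
    then have "sorted_wrt (\<ge>) (y # zs)"
      using zs(1) Cons.prems True by auto
    moreover have "psum (x # y # ys) k \<le> psum (y # zs) k" for k
    proof (cases k)
      case (Suc k')
      have "psum (x # y # ys) k \<le> y + psum (x # ys) k'"
        using True Suc by (cases k') auto
      then show ?thesis using zs(3)[of k'] Suc by simp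
    qed simp
    moreover have "P (us @ x # y # ys)" if "P (us @ y # zs)" for us
      using swap[OF True, of us ys] zs(4)[of "us @ [y]"] that by simp
    ultimately show ?thesis
      using zs(2) by (intro exI[of _ "y # zs"]) auto
  qed
qed

lemma sort_descending:
  assumes swap: "\<And>us a b vs. a < b \<Longrightarrow> P (us @ b # a # vs) \<Longrightarrow> P (us @ a # b # vs)"
  shows "\<exists>zs. sorted_wrt (\<ge>) zs \<and> mset zs = mset xs \<and> (\<forall>k. psum xs k \<le> psum zs k)
    \<and> (\<forall>us. P (us @ zs) \<longrightarrow> P (us @ xs))"
proof (induction xs)
  case (Cons x xs)
  then obtain ys where ys: "sorted_wrt (\<ge>) ys" "mset ys = mset xs" "\<And>k. psum xs k \<le> psum ys k"
    "\<And>us. P (us @ ys) \<Longrightarrow> P (us @ xs)" by blast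
  obtain zs where zs: "sorted_wrt (\<ge>) zs" "mset zs = mset (x # ys)" "\<And>k. psum (x # ys) k \<le> psum zs k"
    "\<And>us. P (us @ zs) \<Longrightarrow> P (us @ x # ys)"
    using insert_descending[where P = P, OF swap ys(1), of x] by blast
  have "psum (x # xs) k \<le> psum zs k" for k
    using zs(3)[of k] ys(3)[of "k - 1"] by (cases k) auto
  moreover have "P (us @ x # xs)" if "P (us @ zs)" for us
    using zs(4)[OF that] ys(4)[of "us @ [x]"] by simp
  ultimately show ?case
    using zs ys(2) by (intro exI[of _ zs]) auto
qed (auto intro: exI[of _ "[]"])

text \<open>In a descending list the zeros come last. Zeros do occur: moving a box out of a row of
  length one empties the row.\<close>

lemma psum_filter_positive:
  "sorted_wrt (\<ge>) (xs :: nat list) \<Longrightarrow> psum (filter (\<lambda>x. 0 < x) xs) k = psum xs k"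
proof (induction xs arbitrary: k)
  case (Cons x xs)
  have zero: "psum ys k = 0" if "\<forall>y\<in>set ys. y = 0" for ys :: "nat list" and k
    using that by (auto simp: sum_list_eq_0_iff dest: in_set_takeD)
  show ?case
  proof (cases "x = 0")
    case True
    then show ?thesis using Cons.prems zero[of "x # xs" k] by (auto simp: filter_empty_conv)
  next
    case False
    then show ?thesis using Cons by (cases k) auto
  qed
qed simp

section \<open>Row stabilizers and their symmetrizers\<close>

context partition
begin

lemma rowof_entry: "r < length la \<Longrightarrow> 1 \<le> s \<Longrightarrow> s \<le> la ! r \<Longrightarrow> rowof la (psum la r + s) = Suc r"
  by (simp add: rowof_def tlam_inv)

lemma rowof_mono:
  assumes "1 \<le> i" "i \<le> j" "j \<le> n"
  shows "rowof la i \<le> rowof la j"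
proof -
  obtain r s where i: "r < length la" "1 \<le> s" "s \<le> la ! r" "i = psum la r + s"
    using assms by (elim entry_cases[of i, rotated 2]) auto
  obtain r' s' where j: "r' < length la" "1 \<le> s'" "s' \<le> la ! r'" "j = psum la r' + s'"
    using assms by (elim entry_cases[of j, rotated 2]) auto
  have "psum la r < psum la (Suc r')"
    using i j assms by (simp add: psum_Suc)
  then show ?thesis
    using psum_less_iff[of r "Suc r'"] i j by (simp add: rowof_entry)
qed

lemma same_rowD:
  assumes "1 \<le> i" "i < n" "rowof la i = rowof la (Suc i)"
  shows "\<exists>r<length la. psum la r < i \<and> i < psum la (Suc r)"
proof -
  obtain r s where i: "r < length la" "1 \<le> s" "s \<le> la ! r" "i = psum la r + s"
    using assms by (elim entry_cases[of i, rotated 2]) auto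
  obtain r' s' where j: "r' < length la" "1 \<le> s'" "s' \<le> la ! r'" "Suc i = psum la r' + s'"
    using assms by (elim entry_cases[of "Suc i", rotated 2]) auto
  have "rowof la i = Suc r" "rowof la (Suc i) = Suc r'"
    using i j rowof_entry[of r s] rowof_entry[of r' s'] by simp_all
  then show ?thesis
    using i j assms(3) by (intro exI[of _ r]) (auto simp: psum_Suc)
qed

lemma same_rowI: "r < length la \<Longrightarrow> psum la r < i \<Longrightarrow> i < psum la (Suc r) \<Longrightarrow> rowof la i = rowof la (Suc i)"
  using rowof_entry[of r "i - psum la r"] rowof_entry[of r "Suc i - psum la r"] by (simp add: psum_Suc)

lemma rowstab_sub: "rowstab n la \<subseteq> perms n"
  by (auto simp: rowstab_def)

lemma finite_rowstab [simp]: "finite (rowstab n la)"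
  by (rule finite_subset[OF rowstab_sub]) simp

lemma rowstab_lr_sg:
  assumes "1 \<le> i" "i < n" "rowof la i = rowof la (Suc i)"
  shows "lr w (sg i) \<in> rowstab n la \<longleftrightarrow> w \<in> rowstab n la"
proof -
  have "rowof la (sg i x) = rowof la x" for x
    using assms(3) by (simp add: sg_apply)
  then show ?thesis
    using assms by (simp add: rowstab_def lr_sg_perms_iff lr_apply)
qed

lemma xlam_apply: "xlam n la w = (if w \<in> rowstab n la then 1 else 0)"
  by (simp add: xlam_def hbasis_def)

lemma supp_xlam: "supp n (xlam n la)"
  using rowstab_sub by (auto simp: supp_def xlam_apply)

lemma TR_xlam:
  assumes "1 \<le> i" "i < n" "rowof la i = rowof la (Suc i)"
  shows "TR n i (xlam n la) = hscale qq (xlam n la)"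
  using rowstab_lr_sg[OF assms] by (auto simp: TR_def Tgen_def xlam_apply hscale_def fun_eq_iff[of "_ :: hecke"])

lemma eig_xlam: "TR.eig n 0 la (xlam n la)"
proof (rule TR.eigI)
  fix r i assume ri: "r < length la" "0 + psum la r < i" "i < 0 + psum la (Suc r)"
  show "TR n i (xlam n la) = hscale qq (xlam n la)"
    using ri psum_le[of "Suc r"] by (intro TR_xlam same_rowI[of r]) auto
qed

lemma mul_T_rowstab:
  assumes eig: "TR.eig n 0 la y" and w: "w \<in> rowstab n la"
  shows "mul_T n y w = hscale (qq ^ len n w) y"
  using w
proof (induction "len n w" arbitrary: w rule: less_induct)
  case less
  have wp: "w \<in> perms n" using less.prems rowstab_sub by blast
  show ?case
  proof (cases "w = id")
    case False
    obtain i where i: "1 \<le> i" "i < n" "inv w (Suc i) < inv w i"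
      using ex_descent[OF wp False] by blast
    have ws: "w (inv w x) = x" for x
      using wp permutes_inverses[of w "{1..n}"] by (simp add: perms_def)
    have inw: "inv w i \<in> {1..n}" "inv w (Suc i) \<in> {1..n}"
      using perms_in_iff[OF inv_perms[OF wp], of i] perms_in_iff[OF inv_perms[OF wp], of "Suc i"] i by auto
    \<comment> \<open>\<open>inv w\<close> preserves rows and the row number is monotone in the
      entry, so a right descent of \<open>w\<close> has both values in one row; the length induction
      therefore stays in the row stabilizer.\<close>
    have "rowof la (inv w x) = rowof la x" if "inv w x \<in> {1..n}" for x
    proof -
      have "rowof la (w (inv w x)) = rowof la (inv w x)"
        using less.prems that unfolding rowstab_def by blast
      then show ?thesis using ws by simp
    qed
    then have "rowof la (Suc i) \<le> rowof la i"
      using rowof_mono[of "inv w (Suc i)" "inv w i"] inw i by simp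
    then have row: "rowof la i = rowof la (Suc i)"
      using rowof_mono[of i "Suc i"] i by simp
    define v where "v = lr w (sg i)"
    have v: "v \<in> rowstab n la" "v \<in> perms n" "w = lr v (sg i)"
      using rowstab_lr_sg[OF i(1,2) row] less.prems rowstab_sub by (auto simp: v_def)
    have len: "len n w = Suc (len n v)"
      unfolding v_def using wp i by (intro len_lr_sg_down) auto
    have "inv v i < inv v (Suc i)"
      unfolding v_def using i by (simp add: inv_lr_sg[OF wp] lr_apply sg_apply)
    then have "mul_T n y w = TR n i (mul_T n y v)"
      using mul_T_up[OF v(2) i(1,2), of y] v(3) by simp
    also have "mul_T n y v = hscale (qq ^ len n v) y"
      using v len by (intro less.hyps) auto
    also have "TR n i \<dots> = hscale (qq ^ len n v) (hscale qq y)"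
      using same_rowD[OF i(1,2) row] TR.eigD[OF eig, of _ i] by (auto simp: TR.T_scale)
    finally show ?thesis by (simp add: len mult.commute)
  qed simp
qed

text \<open>At q = 1 the polynomial takes the value of the order of the row stabilizer.\<close>

lemma poincare_nonzero: "(\<Sum>w\<in>rowstab n la. qq ^ len n w) \<noteq> 0"
proof -
  define p where "p = (\<Sum>w\<in>rowstab n la. [:0, 1::complex:] ^ len n w)"
  have "(\<Sum>w\<in>A. Fract ([:0, 1::complex:] ^ len n w) 1) = Fract (\<Sum>w\<in>A. [:0, 1:] ^ len n w) 1" for A
    by (induction A rule: infinite_finite_induct) (auto simp: Zero_fract_def)
  then have "(\<Sum>w\<in>rowstab n la. qq ^ len n w) = Fract p 1"
    by (simp add: p_def qq_power)
  moreover have "poly p 1 = of_nat (card (rowstab n la))"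
    by (simp add: p_def poly_sum)
  moreover have "id \<in> rowstab n la" by (simp add: rowstab_def)
  then have "card (rowstab n la) \<noteq> 0" by (auto simp: card_eq_0_iff)
  ultimately show ?thesis by (auto simp: Zero_fract_def eq_fract)
qed

lemma eig_imp_multiple:
  assumes "supp n y" "TR.eig n 0 la y"
  shows "y = hscale (inverse (\<Sum>w\<in>rowstab n la. qq ^ len n w)) (hmul n y (xlam n la))"
proof -
  have "hmul n y (xlam n la) = (\<Sum>w\<in>perms n. if w \<in> rowstab n la then mul_T n y w else 0)"
    unfolding hmul_eq[OF assms(1)] by (intro sum.cong) (auto simp: xlam_apply)
  also have "\<dots> = (\<Sum>w\<in>rowstab n la. hscale (qq ^ len n w) y)"
    using rowstab_sub by (simp add: sum.inter_restrict[symmetric] Int_absorb1 mul_T_rowstab[OF assms(2)])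
  also have "\<dots> = hscale (\<Sum>w\<in>rowstab n la. qq ^ len n w) y"
    by (simp add: hv.scale_sum_left)
  finally show ?thesis using poincare_nonzero by simp
qed

lemma dperm_perms:
  assumes "tableau n la t"
  shows "dperm n la t \<in> perms n"
proof -
  have "bij_betw (inv_into (nodes la) (tlam la)) {1..n} (nodes la)"
    by (rule bij_betw_inv_into[OF tlam_bij])
  then have "bij_betw (t \<circ> inv_into (nodes la) (tlam la)) {1..n} {1..n}"
    using assms by (auto simp: tableau_def intro: bij_betw_trans)
  then have "bij_betw (dperm n la t) {1..n} {1..n}"
    by (subst bij_betw_cong[of _ _ "t \<circ> inv_into (nodes la) (tlam la)"]) (simp_all add: dperm_def)
  then show ?thesis
    unfolding perms_def by (auto intro!: bij_imp_permutes simp: dperm_def)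
qed

lemma tlam_nonzero: "x \<in> nodes la \<Longrightarrow> tlam la x \<noteq> 0"
  using bij_betw_apply[OF tlam_bij, of x] by auto

lemma tlam_outside: "x \<notin> nodes la \<Longrightarrow> tlam la x = 0"
  by (cases x) (simp add: tlam_def)

lemma tact_tlam:
  assumes "u \<in> perms n"
  shows "tableau n la (tact u (tlam la))" "dperm n la (tact u (tlam la)) = u"
proof -
  have eq: "tact u (tlam la) x = (u \<circ> tlam la) x" if "x \<in> nodes la" for x
    using tlam_nonzero[OF that] by (simp add: tact_def)
  have "bij_betw u {1..n} {1..n}"
    using assms by (auto simp: perms_def permutes_imp_bij)
  then have "bij_betw (u \<circ> tlam la) (nodes la) {1..n}"
    using tlam_bij by (rule bij_betw_trans[rotated])
  then show "tableau n la (tact u (tlam la))"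
    using eq by (auto simp: tableau_def tact_def tlam_outside cong: bij_betw_cong)
  show "dperm n la (tact u (tlam la)) = u"
  proof
    fix i
    show "dperm n la (tact u (tlam la)) i = u i"
    proof (cases "i \<in> {1..n}")
      case True
      then have "inv_into (nodes la) (tlam la) i \<in> nodes la" "tlam la (inv_into (nodes la) (tlam la) i) = i"
        using tlam_bij by (auto simp: bij_betw_def inv_into_into f_inv_into_f)
      then show ?thesis using True eq by (simp add: dperm_def)
    next
      case False
      then have "u i = i" using assms unfolding perms_def permutes_def by blast
      then show ?thesis using False by (auto simp: dperm_def)
    qed
  qed
qed

lemma tact_id [simp]: "tact id t = t"
  by (auto simp: tact_def)

lemma dperm_tlam: "dperm n la (tlam la) = id" and tableau_tlam: "tableau n la (tlam la)"
  using tact_tlam[of id] by simp_all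

lemma xst_eq:
  assumes "tableau n la s" "tableau n la t"
  shows "xst n la s t = mul_T n (hmul n (hbasis (inv (dperm n la s))) (xlam n la)) (dperm n la t)"
  unfolding xst_def using assms by (intro hmul_hbasis supp_hmul supp_hbasis inv_perms dperm_perms)

lemma etab_eq:
  assumes "u \<in> perms n"
  shows "etab n la (tact u (tlam la)) = mul_T n (xlam n la) u"
proof -
  have "hmul n (hbasis id) (xlam n la) = xlam n la"
    using hone_hmul[OF supp_xlam] by (simp add: hone_def)
  then show ?thesis
    using assms by (simp add: etab_def xst_eq tableau_tlam tact_tlam dperm_tlam)
qed

end

section \<open>The span N of the more dominant elements\<close>

definition Nbar_gens :: "nat \<Rightarrow> nat list \<Rightarrow> hecke set" where
  "Nbar_gens n la = {xst n mu s t | mu s t. is_partition n mu \<and> dominates mu la \<and> mu \<noteq> la \<and> tableau n mu s \<and> tableau n mu t}"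

lemma Nbar_span: "Nbar n la = hv.span (Nbar_gens n la)"
proof -
  define P where "P = {(mu, s, t). is_partition n mu \<and> dominates mu la \<and> mu \<noteq> la \<and> tableau n mu s \<and> tableau n mu t}"
  define X where "X = (\<lambda>(mu, s, t). xst n mu s t)"
  have gens: "Nbar_gens n la = X ` P"
    by (auto simp: Nbar_gens_def P_def X_def image_iff) blast+
  have N: "h \<in> Nbar n la \<longleftrightarrow> (\<exists>F g. finite F \<and> F \<subseteq> P \<and> h = (\<Sum>p\<in>F. hscale (g p) (X p)))" for h
    by (simp add: Nbar_def P_def X_def fun_eq_iff[of h] sum_apply hscale_def case_prod_unfold)
  show ?thesis
  proof (intro set_eqI iffI)
    fix h assume "h \<in> Nbar n la"
    then obtain F g where F: "F \<subseteq> P" "h = (\<Sum>p\<in>F. hscale (g p) (X p))"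
      unfolding N by blast
    show "h \<in> hv.span (Nbar_gens n la)"
      unfolding F(2) gens using F(1) by (intro hv.span_sum hv.span_scale hv.span_base) blast
  next
    fix h assume "h \<in> hv.span (Nbar_gens n la)"
    then obtain t r where t: "finite t" "t \<subseteq> X ` P" "h = (\<Sum>a\<in>t. hscale (r a) a)"
      unfolding gens hv.span_explicit by auto
    \<comment> \<open>\<open>Nbar\<close> sums over index triples, the span over elements; different
      triples may give the same element, so one triple is chosen for each.\<close>
    then obtain F where F: "F \<subseteq> P" "inj_on X F" "t = X ` F"
      by (auto simp: subset_image_inj)
    then have "finite F" using t(1) finite_imageD by blast
    moreover have "h = (\<Sum>p\<in>F. hscale (r (X p)) (X p))"
      using t(3) F by (simp add: sum.reindex)
    ultimately show "h \<in> Nbar n la"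
      unfolding N using F(1) by (intro exI[of _ F] exI[of _ "\<lambda>p. r (X p)"]) simp
  qed
qed

lemma subspace_Nbar: "hv.subspace (Nbar n la)"
  by (simp add: Nbar_span)

text \<open>For fixed s the elements x_st are y T_u with u ranging over all permutations, since t
  need not be standard; the span of these is closed under right multiplication.\<close>

lemma TR_Nbar:
  assumes i: "1 \<le> i" "i < n" and h: "h \<in> Nbar n la"
  shows "TR n i h \<in> Nbar n la"
proof -
  have base: "TR n i x \<in> hv.span (Nbar_gens n la)" if x: "x \<in> Nbar_gens n la" for x
  proof -
    obtain mu s t where mu: "x = xst n mu s t" "is_partition n mu" "dominates mu la" "mu \<noteq> la"
      "tableau n mu s" "tableau n mu t"
      using x by (auto simp: Nbar_gens_def)
    interpret mu: partition n mu by unfold_locales fact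
    define y where "y = hmul n (hbasis (inv (dperm n mu s))) (xlam n mu)"
    have y: "mul_T n y u \<in> hv.span (Nbar_gens n la)" if "u \<in> perms n" for u
    proof -
      have "mul_T n y u = xst n mu s (tact u (tlam mu))"
        using that mu by (simp add: mu.xst_eq mu.tact_tlam y_def)
      then show ?thesis
        using mu mu.tact_tlam[OF that] by (auto simp: Nbar_gens_def intro!: hv.span_base)
    qed
    define w where "w = dperm n mu t"
    have w: "w \<in> perms n" using mu by (simp add: w_def mu.dperm_perms)
    have wi: "lr w (sg i) \<in> perms n" using w i by (simp add: lr_sg_perms_iff)
    have x: "x = mul_T n y w" using mu by (simp add: mu.xst_eq y_def w_def)
    show ?thesis
    proof (cases "inv w i < inv w (Suc i)")
      case True
      then show ?thesis using y[OF wi] i w by (simp add: x mul_T_up)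
    next
      case False
      then have down: "inv w (Suc i) < inv w i"
        using perms_inj[OF inv_perms[OF w], of i "Suc i"] by simp
      show ?thesis
        unfolding x mul_T_down[OF w i down]
        by (intro hv.span_add hv.span_scale y w wi)
    qed
  qed
  show ?thesis
    using h unfolding Nbar_span
  proof (induction rule: hv.span_induct_alt)
    case (step c x y)
    then show ?case
      unfolding TR.T_add TR.T_scale by (intro hv.span_add hv.span_scale base[OF step(1)] step(2))
  qed (simp only: TR.T_0 hv.span_zero)
qed

text \<open>Likewise s ranges over all tableaux, so T_{d(s)^{-1}} is an arbitrary basis element, and
  N contains the whole left ideal generated by x_\<mu>.\<close>

lemma hmul_xlam_Nbar:
  assumes mu: "is_partition n mu" "dominates mu la" "mu \<noteq> la" and y: "supp n y"
  shows "hmul n y (xlam n mu) \<in> Nbar n la"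
proof -
  interpret mu: partition n mu by unfold_locales fact
  have basis: "hmul n (hbasis u) (xlam n mu) \<in> Nbar n la" if u: "u \<in> perms n" for u
  proof -
    have "hmul n (hbasis u) (xlam n mu) = xst n mu (tact (inv u) (tlam mu)) (tlam mu)"
      using u by (simp add: mu.xst_eq mu.tact_tlam mu.tableau_tlam mu.dperm_tlam inv_perms perms_inv_inv)
    then show ?thesis
      unfolding Nbar_span using mu mu.tact_tlam(1)[OF inv_perms[OF u]] mu.tableau_tlam
      by (auto simp: Nbar_gens_def intro!: hv.span_base)
  qed
  have "mul_T n y w = (\<Sum>u\<in>perms n. hscale (y u) (mul_T n (hbasis u) w))" for w
    unfolding mul_T_def by (subst supp_expand[OF y]) (simp add: TR.fold_T_sum TR.fold_T_scale)
  then have "hmul n y (xlam n mu) = (\<Sum>w\<in>perms n. \<Sum>u\<in>perms n. hscale (y u) (hscale (xlam n mu w) (mul_T n (hbasis u) w)))"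
    unfolding hmul_eq[OF y] by (simp add: hv.scale_sum_right mult.commute)
  also have "\<dots> = (\<Sum>u\<in>perms n. hscale (y u) (hmul n (hbasis u) (xlam n mu)))"
    by (subst sum.swap) (simp add: hmul_eq supp_hbasis hv.scale_sum_right)
  also have "\<dots> \<in> Nbar n la"
    unfolding Nbar_span using basis by (intro hv.span_sum hv.span_scale) (simp add: Nbar_span)
  finally show ?thesis .
qed

context partition
begin

text \<open>Moving a box upwards to a row of at least the same length gives a composition whose
  sorted version strictly dominates la.\<close>
lemma garnir_Nbar:
  assumes la: "la = us @ a # b # vs" and b: "1 \<le> b"
    and y: "supp n y" "TR.eig n 0 (us @ (a + 1) # (b - 1) # vs) y"
  shows "y \<in> Nbar n la"
proof -
  define xs where "xs = us @ (a + 1) # (b - 1) # vs"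
  define P where "P ks \<longleftrightarrow> sum_list ks = n \<longrightarrow> (\<forall>y. supp n y \<longrightarrow> TR.eig n 0 ks y \<longrightarrow> y \<in> Nbar n la)" for ks
  have "P (us @ a # b # vs)" if "a < b" "P (us @ b # a # vs)" for us a b vs
    unfolding P_def
  proof (intro impI allI)
    fix z assume sum: "sum_list (us @ a # b # vs) = n" and z: "supp n z" "TR.eig n 0 (us @ a # b # vs) z"
    have "TR.eig n 0 (us @ b # a # vs) (TR.swap n (sum_list us) a b z)"
      using TR.eig_swap[OF z(2) sum] that(1) by simp
    then have "TR.swap n (sum_list us) a b z \<in> Nbar n la"
      using that(2) supp_swap[OF z(1)] sum by (simp add: P_def)
    then show "z \<in> Nbar n la"
      using sum by (elim TR.swap_in_subspaceD[OF subspace_Nbar TR_Nbar, rotated -1]) auto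
  qed
  then obtain zs where zs: "sorted_wrt (\<ge>) zs" "mset zs = mset xs" "\<And>k. psum xs k \<le> psum zs k"
      "\<And>us. P (us @ zs) \<Longrightarrow> P (us @ xs)"
    using sort_descending[of P xs] by blast
  have ab: "b \<le> a"
    using parts_antimono[of "length us" "Suc (length us)"] la by (simp add: nth_append)
  have n: "sum_list la = n" using part by (simp add: is_partition_def)
  have sum_xs: "sum_list xs = n" using n b by (simp add: xs_def la)
  have sum_zs: "sum_list zs = n" using zs(2) sum_xs by (metis sum_mset_sum_list)
  \<comment> \<open>The part b - 1 may be 0; an empty block carries no condition, so dropping it
    does not affect eigenvectors.\<close>
  define mu where "mu = filter (\<lambda>x. 0 < x) zs"
  have psum_mu: "psum mu k = psum zs k" for k
    unfolding mu_def by (rule psum_filter_positive[OF zs(1)])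
  have mu: "is_partition n mu"
    using zs(1) psum_mu[of "max (length mu) (length zs)"] sum_zs
    by (auto simp: is_partition_def mu_def sorted_wrt_filter)
  have dom: "dominates mu la"
    unfolding dominates_def
  proof
    fix k
    have "psum la k \<le> psum xs k"
    proof (cases "k \<le> length us")
      case False
      then obtain k' where "k = Suc (length us + k')" by (metis Suc_leI add_Suc le_Suc_ex not_le)
      then show ?thesis using b by (cases k') (simp_all add: la xs_def)
    qed (simp add: la xs_def)
    then show "psum la k \<le> psum mu k" using zs(3)[of k] psum_mu[of k] by simp
  qed
  have neq: "mu \<noteq> la"
  proof
    assume eq: "mu = la"
    \<comment> \<open>Strictness of the dominance by an invariant of the multiset of parts: as b
      \<le> a, passing from a, b to a + 1, b - 1 raises the sum of squares.\<close>
    define sq where "sq = (\<lambda>x::nat. x * x)"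
    have "sum_list (map sq mu) = sum_list (map sq zs)"
      unfolding mu_def by (induction zs) (auto simp: sq_def)
    also have "\<dots> = sum_list (map sq xs)"
      using zs(2) by (metis mset_map sum_mset_sum_list)
    also have "\<dots> > sum_list (map sq la)"
    proof -
      obtain b' where "b = Suc b'" using b by (cases b) auto
      then show ?thesis using ab by (simp add: xs_def la sq_def algebra_simps)
    qed
    finally show False using eq by simp
  qed
  have "P mu"
    unfolding P_def
  proof (intro impI allI)
    fix z assume z: "supp n z" "TR.eig n 0 mu z"
    interpret mu: partition n mu by unfold_locales fact
    have "hmul n z (xlam n mu) \<in> Nbar n la"
      by (rule hmul_xlam_Nbar[OF mu dom neq z(1)])
    then show "z \<in> Nbar n la"
      by (subst mu.eig_imp_multiple[OF z]) (intro hv.subspace_scale subspace_Nbar)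
  qed
  have "TR.eig n 0 mu z" if "TR.eig n 0 zs z" for z
  proof -
    have "TR.eig n p (filter (\<lambda>x. 0 < x) ks) z" if "TR.eig n p ks z" for p ks
      using that by (induction ks arbitrary: p) auto
    then show ?thesis using that by (simp add: mu_def)
  qed
  then have "P zs"
    using \<open>P mu\<close> mu by (auto simp: P_def is_partition_def)
  then have "P xs" using zs(4)[of "[]"] by simp
  then show ?thesis using y sum_xs by (simp add: P_def xs_def)
qed

end

context partition
begin

lemma split_rows: "Suc r < length la \<Longrightarrow> la = take r la @ la ! r # la ! Suc r # drop (Suc (Suc r)) la"
  by (metis Cons_nth_drop_Suc Suc_lessD append_take_drop_id)

lemma eig_xlam_rows:
  assumes "Suc r < length la"
  shows "TR.eig n 0 (take r la) (xlam n la)" "TR.eig n (psum la (Suc (Suc r))) (drop (Suc (Suc r)) la) (xlam n la)"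
    "\<And>i. psum la r < i \<Longrightarrow> i < psum la (Suc r) \<Longrightarrow> TR n i (xlam n la) = hscale qq (xlam n la)"
    "\<And>i. psum la (Suc r) < i \<Longrightarrow> i < psum la (Suc (Suc r)) \<Longrightarrow> TR n i (xlam n la) = hscale qq (xlam n la)"
proof -
  have "TR.eig n 0 (take r la @ la ! r # la ! Suc r # drop (Suc (Suc r)) la) (xlam n la)"
    by (subst split_rows[OF assms, symmetric]) (rule eig_xlam)
  then show "TR.eig n 0 (take r la) (xlam n la)" "TR.eig n (psum la (Suc (Suc r))) (drop (Suc (Suc r)) la) (xlam n la)"
    "\<And>i. psum la r < i \<Longrightarrow> i < psum la (Suc r) \<Longrightarrow> TR n i (xlam n la) = hscale qq (xlam n la)"
    "\<And>i. psum la (Suc r) < i \<Longrightarrow> i < psum la (Suc (Suc r)) \<Longrightarrow> TR n i (xlam n la) = hscale qq (xlam n la)"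
    using assms by (simp_all add: TR.eig_append psum_Suc)
qed

lemma sum_drop_rows: "psum la r + sum_list (drop r la) = n"
  using part by (metis append_take_drop_id is_partition_def sum_list_append)

text \<open>The sum is an eigenvector for the composition in which the upper of the two rows has
  gained a box from the lower one; the remaining generators commute with all its words.\<close>

lemma garnir_down_Nbar:
  assumes r: "Suc r < length la"
  defines "m \<equiv> psum la (Suc r) + 1"
  shows "(\<Sum>j=psum la r + 1..m. fold (TR n) (rev [j..<m]) (xlam n la)) \<in> Nbar n la"
proof (rule garnir_Nbar[OF split_rows[OF r]])
  note x = eig_xlam_rows[OF r]
  let ?y = "\<Sum>j=psum la r + 1..m. fold (TR n) (rev [j..<m]) (xlam n la)"
  have b: "1 \<le> la ! Suc r" using parts_pos[OF r] by simp
  have ps: "psum la (Suc r) = psum la r + la ! r" "psum la (Suc (Suc r)) = psum la (Suc r) + la ! Suc r"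
    using r by (simp_all add: psum_Suc)
  have mn: "m \<le> n" using psum_le[of "Suc (Suc r)"] ps b by (simp add: m_def)
  have m: "m = psum la r + (la ! r + 1)" using ps by (simp add: m_def)
  show "1 \<le> la ! Suc r" by fact
  show "supp n ?y"
    by (intro supp_sum supp_fold_TR supp_xlam)
  have comm: "TR n i ?y = hscale qq ?y"
    if "1 \<le> i" "i < n" "i < psum la r \<or> m < i" "TR n i (xlam n la) = hscale qq (xlam n la)" for i
  proof -
    have "TR n i (fold (TR n) (rev [j..<m]) (xlam n la)) = hscale qq (fold (TR n) (rev [j..<m]) (xlam n la))"
      if "j \<in> {psum la r + 1..m}" for j
      using that \<open>1 \<le> i\<close> \<open>i < n\<close> \<open>i < psum la r \<or> m < i\<close> mn \<open>TR n i (xlam n la) = _\<close>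
      by (subst TR.T_fold_T_commute) (auto simp: TR.fold_T_scale)
    then show ?thesis by (simp only: TR.T_sum hv.scale_sum_right cong: sum.cong)
  qed
  have "TR.eig n 0 (take r la) ?y"
    by (rule TR.eig_mono[OF x(1)], rule comm) (use psum_le[of r] in auto)
  moreover have "TR n i ?y = hscale qq ?y" if "psum la r < i" "i < psum la r + (la ! r + 1)" for i
    by (rule TR.garnir_down_eigen) (use that mn m x(3) ps in auto)
  moreover have "TR n i ?y = hscale qq ?y" if "psum la r + (la ! r + 1) < i" "i < psum la r + (la ! r + 1) + (la ! Suc r - 1)" for i
    using that ps b m x(4)[of i] psum_le[of "Suc (Suc r)"] by (intro comm) auto
  moreover have "TR.eig n (psum la (Suc (Suc r))) (drop (Suc (Suc r)) la) ?y"
    by (rule TR.eig_mono[OF x(2)], rule comm) (use sum_drop_rows[of "Suc (Suc r)"] ps b m in auto)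
  moreover have "psum la (Suc (Suc r)) = psum la r + (la ! r + 1) + (la ! Suc r - 1)" using ps b by simp
  ultimately show "TR.eig n 0 (take r la @ (la ! r + 1) # (la ! Suc r - 1) # drop (Suc (Suc r)) la) ?y"
    by (simp add: TR.eig_append)
qed

text \<open>Here the lower row gains the box, giving l - 1, l + 1. After exchanging these two blocks
  the vector meets the condition of \<open>garnir_Nbar\<close>, and membership in N is pulled back
  through the exchange.\<close>

lemma garnir_up_Nbar:
  assumes r: "Suc r < length la" and eq: "la ! Suc r = la ! r"
  defines "a \<equiv> psum la (Suc r)" and "b \<equiv> psum la (Suc (Suc r))"
  shows "(\<Sum>j=a..b. fold (TR n) [a..<j] (xlam n la)) \<in> Nbar n la"
proof -
  note x = eig_xlam_rows[OF r]
  define y where "y = (\<Sum>j=a..b. fold (TR n) [a..<j] (xlam n la))"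
  let ?l = "la ! r"
  have l: "1 \<le> ?l" using parts_pos[of r] r by simp
  have ps: "a = psum la r + ?l" "b = a + ?l"
    using r eq by (simp_all add: psum_Suc a_def b_def)
  have bn: "b \<le> n" using psum_le by (simp add: b_def)
  have supp: "supp n y"
    unfolding y_def by (intro supp_sum supp_fold_TR supp_xlam)
  have comm: "TR n i y = hscale qq y"
    if "1 \<le> i" "Suc i < a \<or> b < i" "i < n" "TR n i (xlam n la) = hscale qq (xlam n la)" for i
  proof -
    have "TR n i (fold (TR n) [a..<j] (xlam n la)) = hscale qq (fold (TR n) [a..<j] (xlam n la))"
      if "j \<in> {a..b}" for j
      using that \<open>1 \<le> i\<close> \<open>i < n\<close> \<open>Suc i < a \<or> b < i\<close> bn ps l \<open>TR n i (xlam n la) = _\<close>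
      by (subst TR.T_fold_T_commute) (auto simp: TR.fold_T_scale)
    then show ?thesis by (simp only: y_def TR.T_sum hv.scale_sum_right cong: sum.cong)
  qed
  have "TR.eig n 0 (take r la) y"
    by (rule TR.eig_mono[OF x(1)], rule comm) (use psum_le[of r] ps l bn in auto)
  moreover have "TR n i y = hscale qq y" if "psum la r < i" "i < psum la r + (?l - 1)" for i
    using that ps bn x(3)[of i] by (intro comm) (auto simp: a_def[symmetric])
  moreover have "TR n i y = hscale qq y" if "psum la r + (?l - 1) < i" "i < psum la r + (?l - 1) + (?l + 1)" for i
    unfolding y_def by (rule TR.garnir_up_eigen) (use that bn x(4) ps l in \<open>auto simp: a_def[symmetric] b_def[symmetric]\<close>)
  moreover have "TR.eig n b (drop (Suc (Suc r)) la) y"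
    unfolding b_def
    by (rule TR.eig_mono[OF x(2)], rule comm[unfolded b_def])
       (use sum_drop_rows[of "Suc (Suc r)"] ps l in \<open>auto simp: b_def[symmetric]\<close>)
  moreover have "b = psum la r + (?l - 1) + (?l + 1)" using ps l by simp
  ultimately have eig: "TR.eig n 0 (take r la @ (?l - 1) # (?l + 1) # drop (Suc (Suc r)) la) y"
    by (auto simp: TR.eig_append)
  have sum: "sum_list (take r la @ (?l - 1) # (?l + 1) # drop (Suc (Suc r)) la) = n"
    using sum_drop_rows[of "Suc (Suc r)"] ps l by (simp add: b_def[symmetric])
  have "TR.swap n (psum la r) (?l - 1) (?l + 1) y \<in> Nbar n la"
  proof (rule garnir_Nbar)
    show "la = take r la @ ?l # ?l # drop (Suc (Suc r)) la"
      using split_rows[OF r] eq by simp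
    show "supp n (TR.swap n (psum la r) (?l - 1) (?l + 1) y)" by (rule supp_swap[OF supp])
    show "TR.eig n 0 (take r la @ (?l + 1) # (?l - 1) # drop (Suc (Suc r)) la) (TR.swap n (psum la r) (?l - 1) (?l + 1) y)"
      by (rule TR.eig_swap[OF eig sum]) simp
  qed (rule l)
  moreover have "psum la r + (?l - 1) + (?l + 1) \<le> n" using ps bn l by simp
  ultimately show ?thesis
    unfolding y_def[symmetric] by (elim TR.swap_in_subspaceD[OF subspace_Nbar TR_Nbar, rotated -1]) auto
qed

end

section \<open>The quotient by an invariant subspace\<close>

locale hecke_hom = A: hecke_rep scale n T + B: hecke_rep scale n T'
  for scale :: "K \<Rightarrow> 'v::ab_group_add \<Rightarrow> 'v" (infixr "*s" 75) and n T T' +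
  fixes p :: "'v \<Rightarrow> 'v"
  assumes p_add: "p (x + y) = p x + p y" and p_scale: "p (c *s x) = c *s p x"
    and p_T: "1 \<le> i \<Longrightarrow> i < n \<Longrightarrow> p (T i x) = T' i (p x)"
begin

lemma p_0: "p 0 = 0"
  using p_scale[of 0 0] by simp

lemma p_diff: "p (x - y) = p x - p y"
  using p_add[of "x - y" y] by (simp add: algebra_simps)

lemma p_sum: "p (\<Sum>i\<in>A. f i) = (\<Sum>i\<in>A. p (f i))"
  by (induction A rule: infinite_finite_induct) (auto simp: p_0 p_add)

lemma p_fold: "set w \<subseteq> {1..<n} \<Longrightarrow> p (fold T w x) = fold T' w (p x)"
  by (induction w arbitrary: x) (auto simp: p_T)

lemma p_act: "gens x \<subseteq> {1..<n} \<Longrightarrow> p (A.act x v) = B.act x (p v)"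
  by (induction x arbitrary: v) (auto simp: p_T p_add p_scale)

lemma p_L: "m \<le> n \<Longrightarrow> p (A.L m x) = B.L m (p x)"
proof (induction m arbitrary: x)
  case (Suc m)
  then show ?case
    by (cases "m = 0") (simp_all add: p_0 A.L_Suc B.L_Suc p_scale p_add p_T)
qed (simp add: p_0)

end

context hecke_rep
begin

text \<open>The quotient by an invariant subspace N is realised on a complement of N inside the same
  space; on N itself the generators are made to act by q.\<close>
lemma quotient_rep:
  assumes N: "subspace N" and stable: "\<And>i x. 1 \<le> i \<Longrightarrow> i < n \<Longrightarrow> x \<in> N \<Longrightarrow> T i x \<in> N"
  obtains p T' where "hecke_hom scale n T T' p" "\<And>x. p x = 0 \<longleftrightarrow> x \<in> N"
proof -
  interpret vp: vector_space_pair scale scale ..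
  obtain B where B: "B \<subseteq> N" "independent B" "N \<subseteq> span B"
    using maximal_independent_subset[of N] by blast
  define C where "C = extend_basis B"
  have C: "B \<subseteq> C" "independent C" "span C = UNIV"
    using extend_basis_superset[OF B(2)] independent_extend_basis[OF B(2)] span_extend_basis[OF B(2)]
    by (simp_all add: C_def)
  define p where "p = vp.construct C (\<lambda>b. if b \<in> B then 0 else b)"
  interpret p: Vector_Spaces.linear scale scale p
    unfolding p_def by (rule vp.linear_construct[OF C(2)])
  have p_basis: "p b = (if b \<in> B then 0 else b)" if "b \<in> C" for b
    unfolding p_def using vp.construct_basis[OF C(2) that] by simp
  have p_N: "p x = 0" if "x \<in> N" for x
  proof -
    have "x \<in> span B" using B that by blast
    then show ?thesis
      by (induction rule: span_induct_alt) (use p_basis C in \<open>auto simp: p.add p.scale p.zero\<close>)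
  qed
  have diff: "x - p x \<in> N" for x
  proof -
    have "x \<in> span C" using C by simp
    then show ?thesis
    proof (induction rule: span_induct_alt)
      case base
      show ?case using subspace_0[OF N] by (simp add: p.zero)
    next
      case (step c x y)
      have "x - p x \<in> N" using p_basis[OF step(1)] B subspace_0[OF N] by auto
      then have "c *s (x - p x) + (y - p y) \<in> N"
        using step(2) by (intro subspace_add subspace_scale N)
      moreover have "c *s x + y - p (c *s x + y) = c *s (x - p x) + (y - p y)"
        by (simp add: p.add p.scale scale_right_diff_distrib)
      ultimately show ?case by argo
    qed
  qed
  have ker: "p x = 0 \<longleftrightarrow> x \<in> N" for x
    using p_N diff[of x] by auto
  have idem: "p (p x) = p x" for x
    using p_N[OF diff[of x]] by (simp add: p.diff)
  \<comment> \<open>\<open>p x\<close> is the component of x in the complement and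
    \<open>x - p x\<close> the one in N. Multiplication by q on N satisfies all Hecke
    relations.\<close>
  define T' where "T' i x = (if 1 \<le> i \<and> i < n then p (T i x) + qq *s (x - p x) else x)" for i x
  have pT: "p (T i (p x)) = p (T i x)" if "1 \<le> i" "i < n" for i x
    using p_N[OF stable[OF that diff[of x]]] by (simp add: T_diff p.diff)
  have pT': "p (T' i x) = p (T i x)" if "1 \<le> i" "i < n" for i x
    using that by (simp add: T'_def p.add p.scale p.diff idem)
  have cT': "T' i x - p (T' i x) = qq *s (x - p x)" if "1 \<le> i" "i < n" for i x
    using pT'[OF that] that by (simp add: T'_def)
  \<comment> \<open>Each relation is checked on the two components separately: on the complement it
    comes from T, on N from the scalar q.\<close>
  have eqI: "x = y" if "p x = p y" "x - p x = y - p y" for x y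
    using that by simp
  have pTT': "p (T' j y) = p (T j x)" if "1 \<le> j" "j < n" "p y = p x" for j x y
    using pT'[OF that(1,2), of y] pT[OF that(1,2), of y] pT[OF that(1,2), of x] that(3) by simp
  have p2: "p (T' j (T' i x)) = p (T j (T i x))" if "1 \<le> i" "i < n" "1 \<le> j" "j < n" for i j x
    using that by (intro pTT' refl)
  have p3: "p (T' k (T' j (T' i x))) = p (T k (T j (T i x)))"
    if "1 \<le> i" "i < n" "1 \<le> j" "j < n" "1 \<le> k" "k < n" for i j k x
    using that by (intro pTT' refl)
  have "hecke_hom scale n T T' p"
  proof
    show "T' i (x + y) = T' i x + T' i y" for i x y
      by (simp add: T'_def T_add p.add vec_simps algebra_simps)
    show "T' i (c *s x) = c *s T' i x" for i c x
      by (simp add: T'_def T_scale p.scale vec_simps mult.commute)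
    show "T' i (T' i x) = (qq - 1) *s T' i x + qq *s x" if "1 \<le> i" "i < n" for i x
    proof (rule eqI)
      show "p (T' i (T' i x)) = p ((qq - 1) *s T' i x + qq *s x)"
        by (subst p2[OF that that]) (simp only: T_quad[OF that] p.add p.scale pT'[OF that])
      have "T' i (T' i x) - p (T' i (T' i x)) = qq *s qq *s (x - p x)"
        using that by (simp add: cT')
      also have "\<dots> = (qq - 1) *s (T' i x - p (T' i x)) + qq *s (x - p x)"
        using that by (simp only: cT') (simp add: vec_simps algebra_simps)
      also have "\<dots> = (qq - 1) *s T' i x + qq *s x - p ((qq - 1) *s T' i x + qq *s x)"
        by (simp only: p.add p.scale scale_right_diff_distrib) simp
      finally show "T' i (T' i x) - p (T' i (T' i x)) = (qq - 1) *s T' i x + qq *s x - p ((qq - 1) *s T' i x + qq *s x)" .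
    qed
    show "T' i (T' j x) = T' j (T' i x)" if "1 \<le> i" "Suc i < j" "j < n" for i j x
    proof (rule eqI)
      show "p (T' i (T' j x)) = p (T' j (T' i x))"
        using that p2[of i j x] p2[of j i x] T_comm[OF that, of x] by simp
      show "T' i (T' j x) - p (T' i (T' j x)) = T' j (T' i x) - p (T' j (T' i x))"
        using that by (simp add: cT')
    qed
    show "T' i (T' (Suc i) (T' i x)) = T' (Suc i) (T' i (T' (Suc i) x))" if "1 \<le> i" "Suc i < n" for i x
    proof (rule eqI)
      show "p (T' i (T' (Suc i) (T' i x))) = p (T' (Suc i) (T' i (T' (Suc i) x)))"
        using that p3[of i "Suc i" i x] p3[of "Suc i" i "Suc i" x] T_braid[OF that, of x] by simp
      show "T' i (T' (Suc i) (T' i x)) - p (T' i (T' (Suc i) (T' i x)))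
        = T' (Suc i) (T' i (T' (Suc i) x)) - p (T' (Suc i) (T' i (T' (Suc i) x)))"
        using that by (simp add: cT')
    qed
    show "p (x + y) = p x + p y" for x y by (rule p.add)
    show "p (c *s x) = c *s p x" for c x by (rule p.scale)
    show "p (T i x) = T' i (p x)" if "1 \<le> i" "i < n" for i x
      using that by (simp add: T'_def pT idem)
  qed
  then show thesis using that ker by blast
qed

end

section \<open>Removable nodes\<close>

lemma phi_eq_row_phi:
  assumes "fst (knode la k l j) = K" "snd (knode la k l (Suc j)) = L" "cc la k l j = psum la K"
  shows "phi la k l j i = row_phi la K L i"
  using assms by (induction la k l j i rule: phi.induct) simp_all

context partition
begin

text \<open>Rows are counted from 1, so \<open>la ! r\<close> is the length of the row below row
  \<open>r\<close>.\<close>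

definition corner :: "nat \<Rightarrow> bool" where
  "corner r \<longleftrightarrow> 1 \<le> r \<and> r \<le> length la \<and> (r = length la \<or> la ! r < la ! (r - 1))"

lemma removable_imp_corner:
  assumes "removable la (r, s)"
  shows "corner r" "s = la ! (r - 1)"
proof -
  obtain mu where x: "(r, s) \<in> nodes la" and sorted: "sorted_wrt (\<ge>) mu" and mu: "nodes mu = nodes la - {(r, s)}"
    using assms by (auto simp: removable_def)
  have rs: "1 \<le> r" "r \<le> length la" "1 \<le> s" "s \<le> la ! (r - 1)" using x by (auto simp: nodes_iff)
  have notin: "(r, s) \<notin> nodes mu" using mu by blast
  show s: "s = la ! (r - 1)"
  proof (rule ccontr)
    assume "s \<noteq> la ! (r - 1)"
    then have "(r, Suc s) \<in> nodes mu" using rs by (auto simp: mu nodes_iff)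
    then have "(r, s) \<in> nodes mu" using rs by (auto simp: nodes_def)
    then show False using notin by contradiction
  qed
  have "la ! r < la ! (r - 1)" if "r \<noteq> length la"
  proof (rule ccontr)
    assume "\<not> la ! r < la ! (r - 1)"
    then have "(Suc r, s) \<in> nodes mu" using that rs by (auto simp: mu nodes_iff)
    then have "Suc r \<le> length mu" "s \<le> mu ! r" by (auto simp: nodes_def)
    moreover have "mu ! r \<le> mu ! (r - 1)"
      using sorted rs \<open>Suc r \<le> length mu\<close> by (auto simp: sorted_wrt_iff_nth_less)
    ultimately have "(r, s) \<in> nodes mu" using rs by (auto simp: nodes_def)
    then show False using notin by contradiction
  qed
  then show "corner r" using rs by (auto simp: corner_def)
qed

text \<open>Deleting the last box of a row of length one must delete the part itself, since parts
  are positive; such a row can only be the last one.\<close>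

lemma corner_imp_removable:
  assumes "corner r"
  shows "removable la (r, la ! (r - 1))"
proof -
  have r: "1 \<le> r" "r \<le> length la" "r = length la \<or> la ! r < la ! (r - 1)"
    using assms by (auto simp: corner_def)
  define a where "a = la ! (r - 1)"
  have "r - 1 < length la" using r by auto
  then have a: "1 \<le> a" using parts_pos[of "r - 1"] by (simp add: a_def)
  have sorted: "sorted_wrt (\<ge>) la" and pos: "\<forall>x\<in>set la. 0 < x"
    using part by (auto simp: is_partition_def)
  define mu where "mu = (if a = 1 then butlast la else la[r - 1 := a - 1])"
  have last: "r = length la" if "a = 1"
    using r(2,3) parts_pos[of r] that by (cases "r < length la") (auto simp: a_def)
  have "sorted_wrt (\<ge>) mu \<and> (\<forall>y\<in>set mu. 0 < y) \<and> nodes mu = nodes la - {(r, a)}"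
  proof (cases "a = 1")
    case True
    have "(i, j) \<in> nodes mu \<longleftrightarrow> (i, j) \<in> nodes la - {(r, a)}" for i j
    proof (cases "1 \<le> i \<and> i < length la")
      case i: True
      then have "i - 1 < length (butlast la)" by auto
      then have "mu ! (i - 1) = la ! (i - 1)" using True by (simp add: mu_def nth_butlast)
      then show ?thesis using i True last by (auto simp: nodes_def mu_def)
    next
      case i: False
      then show ?thesis using True last[OF True] r by (cases "i = r") (auto simp: nodes_def mu_def a_def)
    qed
    then have "nodes mu = nodes la - {(r, a)}"
      by auto
    moreover have "sorted_wrt (\<ge>) mu"
      using True sorted by (auto simp: mu_def sorted_wrt_iff_nth_less nth_butlast)
    ultimately show ?thesis using True pos by (auto simp: mu_def dest: in_set_butlastD)
  next
    case False
    have mu: "length mu = length la" "\<And>i. i < length la \<Longrightarrow> mu ! i = (if i = r - 1 then a - 1 else la ! i)"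
      using False by (auto simp: mu_def nth_list_update)
    have "mu ! j \<le> mu ! i" if "i < j" "j < length la" for i j
    proof (cases "i = r - 1")
      case True
      then have "la ! j \<le> a - 1"
      proof -
        have "r \<le> j" using that True by auto
        then have "la ! j \<le> la ! r" using parts_antimono[of r j] that by auto
        moreover have "la ! r < a" using r \<open>r \<le> j\<close> that by (auto simp: a_def)
        ultimately show ?thesis by simp
      qed
      then show ?thesis using that True by (simp add: mu)
    next
      case False
      then show ?thesis using that parts_antimono[of i j] by (auto simp: mu a_def)
    qed
    then have "sorted_wrt (\<ge>) mu" by (auto simp: sorted_wrt_iff_nth_less mu)
    moreover have "\<forall>y\<in>set mu. 0 < y"
      using False a parts_pos by (auto simp: in_set_conv_nth mu)
    moreover have "(i, j) \<in> nodes mu \<longleftrightarrow> (i, j) \<in> nodes la - {(r, a)}" for i j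
    proof (cases "1 \<le> i \<and> i \<le> length la")
      case i: True
      then have "i - 1 < length la" "i - 1 = r - 1 \<longleftrightarrow> i = r" using r by auto
      then have "mu ! (i - 1) = (if i = r then a - 1 else la ! (i - 1))" by (simp add: mu)
      then show ?thesis using i a by (cases "i = r") (auto simp: nodes_def mu a_def)
    next
      case False
      then show ?thesis by (auto simp: nodes_def mu)
    qed
    ultimately show ?thesis by auto
  qed
  then show ?thesis
    using r a unfolding removable_def by (intro conjI exI[of _ mu]) (auto simp: nodes_iff a_def)
qed

lemma removable_iff: "removable la (r, s) \<longleftrightarrow> corner r \<and> s = la ! (r - 1)"
  using removable_imp_corner corner_imp_removable by blast

definition rows_below :: "nat \<Rightarrow> nat list" where
  "rows_below k = k # sorted_list_of_set {r. k < r \<and> corner r}"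

lemma finite_corners [simp]: "finite {r. k < r \<and> corner r}"
  by (rule finite_subset[of _ "{..length la}"]) (auto simp: corner_def)

lemma remb_eq: "remb la k = map (\<lambda>r. (r, la ! (r - 1))) (sorted_list_of_set {r. k < r \<and> corner r})"
proof -
  have "{r. k < r \<and> (\<exists>c. removable la (r, c))} = {r. k < r \<and> corner r}"
    by (auto simp: removable_iff)
  moreover have "(THE c. removable la (r, c)) = la ! (r - 1)" if "corner r" for r
    using that by (auto simp: removable_iff)
  ultimately show ?thesis by (simp add: remb_def)
qed

lemma length_remb: "length (remb la k) = length (rows_below k) - 1"
  by (simp add: remb_eq rows_below_def)

lemma knode_eq:
  assumes "j < length (rows_below k)"
  shows "knode la k (la ! (k - 1)) j = (rows_below k ! j, la ! (rows_below k ! j - 1))"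
  using assms by (cases j) (simp_all add: knode_def rows_below_def remb_eq)

lemma rows_below_sorted: "i < j \<Longrightarrow> j < length (rows_below k) \<Longrightarrow> rows_below k ! i < rows_below k ! j"
proof -
  have "sorted_wrt (<) (rows_below k)"
    by (simp add: rows_below_def)
  then show "i < j \<Longrightarrow> j < length (rows_below k) \<Longrightarrow> rows_below k ! i < rows_below k ! j"
    by (simp add: sorted_wrt_iff_nth_less)
qed

context
  fixes k
  assumes k: "corner k"
begin

lemma set_rows_below: "set (rows_below k) = {r. k \<le> r \<and> corner r}"
  using k by (auto simp: rows_below_def)

lemma corner_rows_below: "j < length (rows_below k) \<Longrightarrow> k \<le> rows_below k ! j \<and> corner (rows_below k ! j)"
  using nth_mem[of j "rows_below k"] by (auto simp: set_rows_below)

lemma cc_eq: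
  assumes "j < length (rows_below k)"
  shows "cc la k (la ! (k - 1)) j = psum la (rows_below k ! j)"
proof -
  obtain r where r: "rows_below k ! j = Suc r" "r < length la"
    using corner_rows_below[OF assms] by (cases "rows_below k ! j") (auto simp: corner_def)
  then show ?thesis
    using parts_pos[of r] knode_eq[OF assms] by (simp add: cc_def tlam_node nodes_iff psum_Suc)
qed

lemma cc_0: "cc la k (la ! (k - 1)) 0 = psum la k"
  using cc_eq[of 0] by (simp add: rows_below_def)

text \<open>A row that is not removable has the same length as the next. Hence rows k_j + 1, ...,
  k_{j+1} all have length l_{j+1}, which is why \<phi>_j needs only this one length.\<close>

lemma rows_between:
  assumes j: "Suc j < length (rows_below k)" and r: "rows_below k ! j \<le> r" "r < rows_below k ! Suc j"
  shows "la ! r = la ! (rows_below k ! Suc j - 1)"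
proof -
  define K' where "K' = rows_below k ! Suc j"
  have K': "1 \<le> K'" "K' \<le> length la"
    using corner_rows_below[OF j] by (auto simp: K'_def corner_def)
  have step: "la ! i = la ! (i - 1)" if i: "rows_below k ! j < i" "i < K'" for i
  proof -
    have "\<not> corner i"
    proof
      assume "corner i"
      moreover have "k \<le> rows_below k ! j" using corner_rows_below j by simp
      ultimately have "i \<in> set (rows_below k)" using i by (simp add: set_rows_below)
      then obtain m where m: "m < length (rows_below k)" "i = rows_below k ! m"
        by (auto simp: in_set_conv_nth)
      consider "m < j" | "m = j" | "m = Suc j" | "Suc j < m" by linarith
      then show False
        using rows_below_sorted[of m j k] rows_below_sorted[of "Suc j" m k] m i j by cases (auto simp: K'_def)
    qed
    then show ?thesis
      using i K' parts_antimono[of "i - 1" i] by (auto simp: corner_def)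
  qed
  have "la ! r = la ! i" if "r \<le> i" "i < K'" for i
    using that
  proof (induction i rule: dec_induct)
    case (step i)
    then show ?case using r \<open>\<And>i. _ \<Longrightarrow> _ \<Longrightarrow> la ! i = la ! (i - 1)\<close>[of "Suc i"] by simp
  qed simp
  from this[of "K' - 1"] show ?thesis using r K' by (simp add: K'_def)
qed

lemma rows_below_last: "rows_below k ! (length (rows_below k) - 1) = length la"
proof -
  have "corner (length la)" "k \<le> length la" using k by (auto simp: corner_def)
  then have "length la \<in> set (rows_below k)" by (simp add: set_rows_below)
  then obtain m where m: "m < length (rows_below k)" "rows_below k ! m = length la"
    by (auto simp: in_set_conv_nth)
  have "m = length (rows_below k) - 1"
  proof (rule ccontr)
    assume "m \<noteq> length (rows_below k) - 1"
    then have "rows_below k ! m < rows_below k ! (length (rows_below k) - 1)"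
      using m by (intro rows_below_sorted) auto
    moreover have "rows_below k ! (length (rows_below k) - 1) \<le> length la"
      using corner_rows_below[of "length (rows_below k) - 1"] m by (auto simp: corner_def)
    ultimately show False using m by simp
  qed
  then show ?thesis using m by simp
qed

lemma stage:
  assumes j: "Suc j < length (rows_below k)"
  defines "K \<equiv> rows_below k ! j" and "K' \<equiv> rows_below k ! Suc j"
  shows "K < K'" "K' \<le> length la" "k \<le> K" "psum la K' = psum la K + (K' - K) * la ! (K' - 1)"
    "Fj la k (la ! (k - 1)) j = row_phi la K (la ! (K' - 1)) (K' - K)"
    "cc la k (la ! (k - 1)) j = psum la K" "cc la k (la ! (k - 1)) (Suc j) = psum la K'"
    "rad la k (la ! (k - 1)) (Suc j) = (int (la ! (k - 1)) - int k) - (int (la ! (K' - 1)) - int K')"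
proof -
  show K: "K < K'" "K' \<le> length la" "k \<le> K"
    using rows_below_sorted[of j "Suc j" k] corner_rows_below[of j] corner_rows_below[of "Suc j"] j
    by (auto simp: K_def K'_def corner_def)
  show "psum la K' = psum la K + (K' - K) * la ! (K' - 1)"
  proof -
    have "psum la (K + (K' - K)) = psum la K + (K' - K) * la ! (K' - 1)"
    proof (rule psum_equal_rows)
      show "la ! r = la ! (K' - 1)" if "K \<le> r" "r < K + (K' - K)" for r
        using that K unfolding K_def K'_def by (intro rows_between[OF j]) auto
    qed (use K in simp)
    then show ?thesis using K by simp
  qed
  show "Fj la k (la ! (k - 1)) j = row_phi la K (la ! (K' - 1)) (K' - K)"
    using j knode_eq[of j k] knode_eq[of "Suc j" k] cc_eq[of j]
    by (simp add: Fj_def K_def K'_def phi_eq_row_phi)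
  show "cc la k (la ! (k - 1)) j = psum la K" "cc la k (la ! (k - 1)) (Suc j) = psum la K'"
    using j cc_eq[of j] cc_eq[of "Suc j"] by (simp_all add: K_def K'_def)
  show "rad la k (la ! (k - 1)) (Suc j) = (int (la ! (k - 1)) - int k) - (int (la ! (K' - 1)) - int K')"
    using j knode_eq[of "Suc j" k] by (simp add: rad_def K'_def)
qed

lemma gens_Xfac:
  assumes j: "Suc j < length (rows_below k)"
  shows "gens (Xfac la k (la ! (k - 1)) j) \<subseteq> {psum la (rows_below k ! j)..<psum la (rows_below k ! Suc j)}"
proof -
  note st = stage[OF j]
  let ?K = "rows_below k ! j" and ?K' = "rows_below k ! Suc j"
  have "gens (row_phi la ?K (la ! (?K' - 1)) (?K' - ?K)) \<subseteq> {i. psum la ?K \<le> i \<and> Suc i < psum la (?K + (?K' - ?K))}"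
  proof (rule gens_row_phi)
    show "la ! r = la ! (?K' - 1)" if "?K \<le> r" "r < ?K + (?K' - ?K)" for r
      using that st by (intro rows_between[OF j]) auto
    show "0 < la ! (?K' - 1)" using st(1,2) by (intro parts_pos) linarith
  qed (use st in simp)
  then show ?thesis
    using st by (auto simp: Xfac_def gens_fT)
qed

lemma gens_ftil: "gens (ftil_expr la k (la ! (k - 1))) \<subseteq> {1..<n}"
proof -
  have "gens (foldl FMul FOne (map (Xfac la k (la ! (k - 1))) [0..<m])) \<subseteq> {1..<n}" if "m < length (rows_below k)" for m
    using that
  proof (induction m)
    case (Suc m)
    have "1 \<le> psum la (rows_below k ! m)"
      using psum_strict_mono[of 0 "rows_below k ! m"] corner_rows_below[of m] Suc.prems by (auto simp: corner_def)
    then have "gens (Xfac la k (la ! (k - 1)) m) \<subseteq> {1..<n}"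
      using gens_Xfac[of m] Suc.prems psum_le[of "rows_below k ! Suc m"] by fastforce
    then show ?case using Suc by simp
  qed simp
  then show ?thesis
    by (simp add: ftil_expr_def length_remb rows_below_def)
qed

end

end

text \<open>After m factors the moving entry stands at the end of the m-th removable row, and
  \<open>G_rows\<close> supplies the next factor. The last removable row is the last row of
  \<lambda>, whose end is n.\<close>

lemma (in seminormal) act_ftil:
  assumes corner: "corner k"
  shows "act (ftil_expr la k (la ! (k - 1))) e = G (n - c) e"
proof -
  let ?rows = "rows_below k" and ?l = "la ! (k - 1)"
  have rho: "\<rho> = int ?l - int k"
    using econt_row_end[of "k - 1"] k by (simp add: \<rho>_def c_def)
  have "act (foldl FMul FOne (map (Xfac la k ?l) [0..<m])) e = G (psum la (?rows ! m) - c) e" if "m < length ?rows" for m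
    using that
  proof (induction m)
    case 0
    then show ?case by (simp add: rows_below_def c_def)
  next
    case (Suc m)
    note st = stage[OF corner Suc.prems]
    let ?K = "?rows ! m" and ?K' = "?rows ! Suc m"
    define j where "j = psum la ?K - c"
    have j: "c + j = psum la ?K"
      using psum_mono[OF st(3), of la] by (simp add: j_def c_def)
    have "G (j + (?K' - ?K) * la ! (?K' - 1)) e = act (Xfac la k ?l m) (G j e)"
    proof (subst G_rows[where K = ?K])
      show "la ! r = la ! (?K' - 1)" if "?K \<le> r" "r < ?K + (?K' - ?K)" for r
        using that st by (intro rows_between[OF corner Suc.prems]) auto
      show "0 < la ! (?K' - 1)" using st(1,2) by (intro parts_pos) linarith
      have "\<rho> - int (la ! (?K' - 1)) + int ?K + int (?K' - ?K) = rad la k ?l (Suc m)"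
        using st(1,8) rho by simp
      then show "fold T [c + j..<c + j + (?K' - ?K) * la ! (?K' - 1)] (G j e)
          + inverse (qint (\<rho> - int (la ! (?K' - 1)) + int ?K + int (?K' - ?K)))
            *s act (row_phi la ?K (la ! (?K' - 1)) (?K' - ?K)) (G j e) = act (Xfac la k ?l m) (G j e)"
        using st(4-7) j by (simp add: Xfac_def act_fT)
    qed (insert st(1-3) j, linarith+)
    moreover have "j + (?K' - ?K) * la ! (?K' - 1) = psum la ?K' - c"
      unfolding st(4) j[symmetric] by simp
    ultimately show ?case using Suc by (simp add: j_def)
  qed
  from this[of "length ?rows - 1"] show ?thesis
    using rows_below_last[OF corner] psum_length
    by (simp add: ftil_expr_def length_remb rows_below_def)
qed

section \<open>Transfer to the Hecke algebra\<close>

lemma perm_of_word_upt: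
  "c \<le> d \<Longrightarrow> perm_of_word [c..<d] x = (if x = c then d else if c < x \<and> x \<le> d then x - 1 else x)"
proof (induction d rule: dec_induct)
  case (step d)
  then show ?case by (auto simp: perm_of_word_append lr_apply sg_apply)
qed simp

lemma reduced_upt:
  assumes "1 \<le> c" "c \<le> d" "d \<le> n"
  shows "reduced n [c..<d]"
  using assms(2,3)
proof (induction d rule: dec_induct)
  case (step d)
  then have r: "reduced n [c..<d]" by simp
  then have p: "perm_of_word [c..<d] \<in> perms n"
    by (intro perm_of_word_perms) (simp add: reduced_def)
  have "inv (perm_of_word [c..<d]) d = c" "inv (perm_of_word [c..<d]) (Suc d) = Suc d"
    using step by (simp_all add: perms_inv_eq[OF p] perm_of_word_upt)
  then show ?case
    using reduced_snoc[OF r, of d] step assms by simp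
qed (simp add: reduced_Nil)

lemma supp_foldl_hmul: "supp n a \<Longrightarrow> supp n (foldl (hmul n) a fs)"
  by (induction fs arbitrary: a) (auto intro: supp_hmul)

lemma hmul_foldl:
  assumes "supp n a"
  shows "hmul n a (foldl (hmul n) hone fs) = foldl (hmul n) a fs"
  by (induction fs rule: rev_induct)
     (simp_all add: hmul_hone assms hmul_assoc[symmetric] supp_foldl_hmul supp_hone)

lemma hmul_Efac:
  assumes "supp n a" "m \<le> n"
  shows "hmul n a (Efac n la t m d)
    = hscale (inverse (resid la t m - qint d)) (TR.L n m a - hscale (qint d) a)"
  using assms by (simp only: Efac_def hsub_minus hmul_scale hmul_diff hmul_Lop hmul_hone)

context partition
begin

lemma resid_tact:
  assumes "u \<in> perms n" "1 \<le> m" "m \<le> n"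
  shows "resid la (tact u (tlam la)) m = qint (econt la (inv u m))"
proof -
  define x where "x = inv_into (nodes la) (tlam la) (inv u m)"
  have "inv u m \<in> {1..n}"
    using perms_in_iff[OF inv_perms[OF assms(1)], of m] assms by simp
  then have x: "x \<in> nodes la" "tlam la x = inv u m"
    using tlam_bij by (auto simp: x_def bij_betw_def inv_into_into f_inv_into_f)
  have "u (inv u m) = m"
    using perms_inv_eq[OF assms(1), of m "inv u m"] by simp
  then have "tact u (tlam la) x = m"
    using x tlam_nonzero[of x] by (simp add: tact_def)
  moreover have "inj_on (tact u (tlam la)) (nodes la)"
    using tact_tlam(1)[OF assms(1)] by (auto simp: tableau_def bij_betw_def)
  ultimately have "inv_into (nodes la) (tact u (tlam la)) m = x"
    using x(1) inv_into_f_f by metis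
  then show ?thesis
    by (simp add: resid_def res_def econt_def x_def Let_def)
qed

lemma content_Rcont: "(r, s) \<in> nodes la \<Longrightarrow> int s - int r \<in> Rcont n"
  using part by (auto simp: Rcont_def)

lemma length_le: "length la \<le> n"
proof -
  have "r \<le> length la \<Longrightarrow> r \<le> psum la r" for r
    by (induction r) (use psum_strict_mono in \<open>auto simp: Suc_le_eq intro: le_less_trans\<close>)
  from this[of "length la"] show ?thesis using psum_length by simp
qed

lemma node_le: "(r, s) \<in> nodes la \<Longrightarrow> r \<le> n \<and> s \<le> n"
  using length_le psum_Suc[of "r - 1" la] psum_le[of r] by (cases r) (auto simp: nodes_iff)

end

text \<open>\<open>sorted_list_of_set\<close> is empty on infinite sets, so finiteness ensures that
  \<open>Eidem\<close> really contains its factors.\<close>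

lemma finite_Rcont: "finite (Rcont n)"
proof (rule finite_subset)
  show "Rcont n \<subseteq> {- int n..int n}"
    using partition.node_le unfolding Rcont_def partition_def by fastforce
qed simp

text \<open>Equality modulo N is equality of images under a module map \<open>p\<close> with kernel
  N; both sides are shown to have the image g_n.\<close>

lemma (in partition) specht_ftil:
  assumes corner: "corner k"
  defines "c \<equiv> psum la k" and "l \<equiv> la ! (k - 1)"
  shows "specht_eq n la (hmul n (etab n la (tlam la)) (feval n (ftil_expr la k l)))
    (fsn n la (tact (perm_of_word [c..<n]) (tlam la)))"
proof -
  have k: "1 \<le> k" "k \<le> length la" using corner by (auto simp: corner_def)
  obtain p T' where hom: "hecke_hom hscale n (TR n) T' p" and ker: "\<And>x. p x = 0 \<longleftrightarrow> x \<in> Nbar n la"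
    using TR.quotient_rep[OF subspace_Nbar TR_Nbar, of n la] by blast
  interpret H: hecke_hom hscale n "TR n" T' p by (rule hom)
  define x where "x = xlam n la"
  define e where "e = p x"
  have x: "supp n x" by (simp add: x_def supp_xlam)
  have fold_sum: "(\<Sum>j\<in>A. fold T' (w j) e) = 0"
    if "(\<Sum>j\<in>A. fold (TR n) (w j) x) \<in> Nbar n la" "\<And>j. j \<in> A \<Longrightarrow> set (w j) \<subseteq> {1..<n}" for A w
  proof -
    have "(\<Sum>j\<in>A. fold T' (w j) e) = (\<Sum>j\<in>A. p (fold (TR n) (w j) x))"
      using that(2) by (intro sum.cong) (simp_all add: e_def H.p_fold)
    also have "\<dots> = 0" using ker that(1) by (simp add: H.p_sum[symmetric])
    finally show ?thesis .
  qed
  interpret S: seminormal hscale n T' la e k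
  proof
    fix r i assume ri: "r < length la" "psum la r < i" "i < psum la (Suc r)"
    have "TR n i x = hscale qq x"
      using ri TR.eigD[OF eig_xlam, of r i] by (simp add: x_def)
    then show "T' i e = hscale qq e"
      using H.p_T[of i x] ri psum_le[of "Suc r"] by (simp add: e_def H.p_scale)
  next
    fix r assume r: "Suc r < length la"
    have "psum la (Suc r) + 1 \<le> n"
      using psum_strict_mono[of "Suc r" "Suc (Suc r)"] psum_le[of "Suc (Suc r)"] r by simp
    then show "(\<Sum>j=psum la r + 1..psum la (Suc r) + 1. fold T' (rev [j..<psum la (Suc r) + 1]) e) = 0"
      using garnir_down_Nbar[OF r] by (intro fold_sum) (auto simp: x_def)
    assume eq: "la ! Suc r = la ! r"
    have "1 \<le> psum la (Suc r)" "psum la (Suc (Suc r)) \<le> n"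
      using psum_strict_mono[of 0 "Suc r"] psum_le[of "Suc (Suc r)"] r by simp_all
    then show "(\<Sum>j=psum la (Suc r)..psum la (Suc (Suc r)). fold T' [psum la (Suc r)..<j] e) = 0"
      using garnir_up_Nbar[OF r eq] by (intro fold_sum) (auto simp: x_def)
  qed (rule k)+
  have c: "S.c = c" by (simp add: S.c_def c_def)
  have cn: "1 \<le> c" "c \<le> n" using S.c_bounds by (simp_all add: c)
  define u where "u = perm_of_word [c..<n]"
  define t where "t = tact u (tlam la)"
  have red: "reduced n [c..<n]" using cn by (intro reduced_upt) auto
  then have u: "u \<in> perms n"
    unfolding u_def by (intro perm_of_word_perms) (simp add: reduced_def)
  have etab_t: "etab n la t = fold (TR n) [c..<n] x"
    using etab_eq[OF u] mul_T_word[OF red] by (simp add: t_def u_def x_def)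
  have etab_0: "etab n la (tlam la) = x"
    using etab_eq[of id] by (simp add: x_def)
  have inv_u: "inv u m = (if m = n then c else if c \<le> m \<and> m < n then Suc m else m)" for m
    using cn by (auto simp: perms_inv_eq[OF u]) (auto simp: u_def perm_of_word_upt)
  have resid: "resid la t m = qint (S.wt (n - S.c) m)" if "1 \<le> m" "m \<le> n" for m
    unfolding t_def resid_tact[OF u that] inv_u using cn by (auto simp: S.wt_def c S.\<rho>_def)
  define ds where "ds m = sorted_list_of_set {d \<in> Rcont n. qint d \<noteq> resid la t m}" for m
  have set_ds: "set (ds m) = {d \<in> Rcont n. qint d \<noteq> resid la t m}" for m
    using finite_Rcont[of n] by (simp add: ds_def)
  define es where "es = concat (map (\<lambda>m. map (Pair m) (ds m)) [1..<Suc n])"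
  have Eidem: "Eidem n la t = foldl (hmul n) hone (map (\<lambda>(m, d). Efac n la t m d) es)"
    by (simp add: Eidem_def es_def ds_def map_concat o_def)
  have fold_es: "p (foldl (hmul n) a (map (\<lambda>(m, d). Efac n la t m d) fs)) = fold S.Efac_op fs (p a)"
    if "supp n a" "\<forall>(m, d) \<in> set fs. 1 \<le> m \<and> m \<le> n" for a fs
    using that(2)
  proof (induction fs rule: rev_induct)
    case (snoc md fs)
    obtain m d where md: "md = (m, d)" by (cases md)
    define b where "b = foldl (hmul n) a (map (\<lambda>(m, d). Efac n la t m d) fs)"
    have b: "supp n b" unfolding b_def by (intro supp_foldl_hmul that)
    have m: "1 \<le> m" "m \<le> n" using snoc.prems md by auto
    have "p (hmul n b (Efac n la t m d)) = S.Efac_op (m, d) (p b)"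
      by (simp only: hmul_Efac[OF b m(2)] H.p_scale H.p_diff H.p_L[OF m(2)] S.Efac_op_def fst_conv snd_conv resid[OF m])
    moreover have "p b = fold S.Efac_op fs (p a)"
      unfolding b_def using snoc by auto
    ultimately show ?case by (simp add: md b_def)
  qed simp
  have "p (fsn n la t) = p (foldl (hmul n) (fold (TR n) [c..<n] x) (map (\<lambda>(m, d). Efac n la t m d) es))"
    using x by (simp only: fsn_def etab_t Eidem hmul_foldl supp_fold_TR)
  also have "\<dots> = fold S.Efac_op es (fold T' [c..<n] e)"
    using x cn by (subst fold_es) (auto simp: es_def supp_fold_TR H.p_fold e_def)
  also have "\<dots> = S.G (n - c) e"
    unfolding es_def c[symmetric]
  proof (rule S.seminormal_vector)
    show "S.wt (n - S.c) m \<notin> set (ds m)" if "1 \<le> m" "m \<le> n" for m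
      using resid[OF that] by (simp add: set_ds)
    show "econt la (psum la (Suc r)) \<in> set (ds n)" if r: "k \<le> r" "r < length la" for r
    proof -
      \<comment> \<open>Row ends below row k have content strictly below \<rho>, the content of n in
        t_n; being contents of nodes of \<lambda>, they occur among the factors of E_{t_n} for m =
        n.\<close>
      have "psum la k < psum la (Suc r)" using r by (intro psum_strict_mono) auto
      then have "econt la (psum la (Suc r)) < S.\<rho>"
        using psum_le by (intro S.rho_greater) (auto simp: c c_def)
      moreover have "resid la t n = qint S.\<rho>"
        using resid[of n] cn by (simp add: S.wt_def c)
      moreover have "econt la (psum la (Suc r)) = int (la ! r) - int (Suc r)"
        using econt_row_end r by simp
      then have "econt la (psum la (Suc r)) \<in> Rcont n"
        using content_Rcont[of "Suc r" "la ! r"] r parts_pos[of r] by (simp only: nodes_iff) auto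
      ultimately show ?thesis by (simp add: set_ds)
    qed
  qed
  finally have fsn: "p (fsn n la t) = S.G (n - c) e" .
  have gens: "gens (ftil_expr la k l) \<subseteq> {1..<n}"
    unfolding l_def by (rule gens_ftil[OF corner])
  have "p (hmul n (etab n la (tlam la)) (feval n (ftil_expr la k l))) = H.B.act (ftil_expr la k l) e"
    by (simp only: etab_0 hmul_feval(2)[OF x gens] H.p_act[OF gens] e_def)
  also have "\<dots> = S.G (n - c) e"
    unfolding l_def by (simp only: S.act_ftil[OF corner] c)
  finally have "p (hmul n (etab n la (tlam la)) (feval n (ftil_expr la k l)) - fsn n la t) = 0"
    by (simp only: H.p_diff fsn diff_self)
  then show ?thesis
    unfolding specht_eq_def hsub_minus ker t_def u_def .
qed

section \<open>Standardness of the tableaux\<close>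

text \<open>Letter y lowers the entry y + 1 to y, and no later letter touches y again. An entry x
  not lowered in this way is pushed up by each consecutive letter until the first gap z; x = z is a
  fixed point.\<close>

lemma perm_of_increasing_word:
  assumes "sorted_wrt (<) w"
  shows "(\<forall>y\<in>set w. perm_of_word w (Suc y) = y) \<and>
    (\<forall>x z. x \<notin> Suc ` set w \<longrightarrow> x \<le> z \<longrightarrow> {x..<z} \<subseteq> set w \<longrightarrow> z \<notin> set w \<longrightarrow> perm_of_word w x = z)"
  using assms
proof (induction w rule: rev_induct)
  case (snoc i w)
  have less: "\<And>y. y \<in> set w \<Longrightarrow> y < i" and sorted: "sorted_wrt (<) w"
    using snoc.prems by (auto simp: sorted_wrt_append)
  have step: "perm_of_word (w @ [i]) x = sg i (perm_of_word w x)" for x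
    by (simp add: perm_of_word_append lr_apply)
  have IH1: "perm_of_word w (Suc y) = y" if "y \<in> set w" for y
    using snoc.IH[OF sorted] that by blast
  have IH2: "perm_of_word w x = z" if "x \<notin> Suc ` set w" "x \<le> z" "{x..<z} \<subseteq> set w" "z \<notin> set w" for x z
    using snoc.IH[OF sorted] that by blast
  have "perm_of_word (w @ [i]) (Suc y) = y" if "y \<in> set (w @ [i])" for y
  proof (cases "y = i")
    case True
    have "perm_of_word w (Suc i) = Suc i"
      by (rule IH2) (use less in force)+
    then show ?thesis using True by (simp add: step sg_apply)
  next
    case False
    then have "y \<in> set w" using that by simp
    then show ?thesis using IH1[of y] less[of y] by (simp add: step sg_apply)
  qed
  moreover have "perm_of_word (w @ [i]) x = z"
    if x: "x \<notin> Suc ` set (w @ [i])" "x \<le> z" "{x..<z} \<subseteq> set (w @ [i])" "z \<notin> set (w @ [i])" for x z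
  proof (cases "i \<in> {x..<z}")
    case True
    have "z = Suc i"
    proof (rule ccontr)
      assume "z \<noteq> Suc i"
      then have "Suc i \<in> {x..<z}" using True by auto
      then have "Suc i \<in> set w" using x(3) by auto
      then show False using less[of "Suc i"] by simp
    qed
    moreover have "perm_of_word w x = i"
    proof (rule IH2)
      show "{x..<i} \<subseteq> set w"
      proof
        fix y assume "y \<in> {x..<i}"
        then have "y \<in> {x..<z}" "y \<noteq> i" using True by auto
        moreover from this have "y \<in> set (w @ [i])" using x(3) by blast
        ultimately show "y \<in> set w" by simp
      qed
    qed (use x True less in auto)
    ultimately show ?thesis by (simp add: step sg_apply)
  next
    case False
    have "perm_of_word w x = z"
      by (rule IH2) (use x False in auto)
    moreover have "z \<noteq> Suc i"
    proof
      assume "z = Suc i"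
      then have "x = Suc i" using False x(2) by auto
      then show False using x(1) by simp
    qed
    ultimately show ?thesis using x(4) by (simp add: step sg_apply)
  qed
  ultimately show ?case by blast
qed auto

text \<open>Only the start of a run moves up, and every other entry drops by at most one. Order can
  thus be lost only when x starts a run that passes y, which \<open>free\<close> forbids.\<close>

lemma increasing_word_less:
  assumes w: "sorted_wrt (<) w" and xy: "x < y" and free: "x \<notin> Suc ` set w \<Longrightarrow> \<not> {x..<y} \<subseteq> set w"
  shows "perm_of_word w x < perm_of_word w y"
proof -
  note pw = perm_of_increasing_word[OF w]
  have run: "\<exists>z\<ge>a. {a..<z} \<subseteq> set w \<and> z \<notin> set w" for a
  proof -
    have ex: "\<exists>z\<ge>a. z \<notin> set w"
      using infinite_nat_iff_unbounded_le[of "- set w"] by (auto intro: finite_subset)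
    define z where "z = (LEAST z. a \<le> z \<and> z \<notin> set w)"
    have "a \<le> z \<and> z \<notin> set w" unfolding z_def by (rule LeastI_ex) (use ex in blast)
    moreover have "{a..<z} \<subseteq> set w"
      unfolding z_def using not_less_Least by fastforce
    ultimately show ?thesis by blast
  qed
  have y: "y = Suc (perm_of_word w y) \<and> perm_of_word w y \<in> set w \<or> y \<le> perm_of_word w y"
  proof (cases "y \<in> Suc ` set w")
    case True
    then show ?thesis using pw by auto
  next
    case False
    then show ?thesis using run[of y] pw by metis
  qed
  show ?thesis
  proof (cases "x \<in> Suc ` set w")
    case True
    then show ?thesis using y xy pw by force
  next
    case False
    obtain z where z: "x \<le> z" "{x..<z} \<subseteq> set w" "z \<notin> set w" using run by blast
    then have "perm_of_word w x = z" using False pw by blast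
    moreover have "z < y"
      using free[OF False] z(2) by (meson atLeastLessThan_iff less_le_trans not_le subset_iff)
    ultimately show ?thesis using y z(3) by (metis less_SucE less_le_trans)
  qed
qed

lemma set_fwords: "w \<in> fwords x \<Longrightarrow> set w \<subseteq> gens x"
  by (induction x arbitrary: w) fastforce+

lemma fwords_fT: "fwords (fT w) = {w}"
  by (induction w) (auto simp: fT_def)

lemma fwords_fsum: "w \<in> fwords (fsum es) \<Longrightarrow> w = [] \<or> (\<exists>x\<in>set es. w \<in> fwords x)"
  by (induction es rule: fsum.induct) auto

context partition
begin

lemma fwords_Rrow:
  assumes "w \<in> fwords (Rrow la (Suc r))" "r < length la"
  shows "\<exists>m. psum la r \<le> m \<and> m < psum la (Suc r) \<and> w = [psum la r..<m]"
proof -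
  have "psum la r < psum la (Suc r)" using assms(2) by (intro psum_strict_mono) auto
  then show ?thesis
    using fwords_fsum[OF assms(1)[unfolded Rrow_def]] by (auto simp: fwords_fT arow_def brow_def)
qed

text \<open>A run of consecutive letters of an increasing word carries its first entry along; the
  resulting tableau is standard if every run starts at a row end and, unless that node is
  removable, stops before the entry below it.\<close>
definition "good_runs A w \<longleftrightarrow> sorted_wrt (<) w \<and>
  (\<forall>x\<in>set w. x \<notin> Suc ` set w \<longrightarrow> (\<exists>r. 1 \<le> r \<and> r \<le> length la \<and> x = psum la r \<and>
    (r \<in> A \<or> \<not> {x..<psum la (Suc r)} \<subseteq> set w)))"

text \<open>The letters cut off are larger than those kept, so no kept letter loses its predecessor:
  every run start of the prefix is one of the whole word, and its run can only become
  shorter.\<close>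

lemma good_runs_take:
  assumes "good_runs A w"
  shows "good_runs A (take i w)"
proof -
  have sorted: "sorted_wrt (<) w" using assms by (simp add: good_runs_def)
  then have "sorted_wrt (<) (take i w @ drop i w)" by simp
  then have less: "x < y" if "x \<in> set (take i w)" "y \<in> set (drop i w)" for x y
    using that unfolding sorted_wrt_append by blast
  have "x \<notin> Suc ` set w" if "x \<in> set (take i w)" "x \<notin> Suc ` set (take i w)" for x
  proof
    assume "x \<in> Suc ` set w"
    then obtain y where y: "x = Suc y" "y \<in> set w" by auto
    then have "y \<in> set (take i w) \<or> y \<in> set (drop i w)"
      by (metis Un_iff append_take_drop_id set_append)
    then show False using y that less[of x y] by auto
  qed
  moreover have sub: "set (take i w) \<subseteq> set w" by (rule set_take_subset)
  ultimately show ?thesis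
    using assms unfolding good_runs_def by (meson sorted_wrt_take subset_iff subset_trans)
qed

text \<open>Within a row, a run passing the right neighbour would start before a row end. Down a
  column, a passing run starts at a row end with a node below it; then the two rows have equal
  length, the row is no corner, and the run must have stopped earlier.\<close>

lemma good_runs_standard:
  assumes good: "good_runs (Collect corner) w" and w: "set w \<subseteq> {1..<n}"
  shows "standard la (tact (perm_of_word w) (tlam la))"
proof -
  have sorted: "sorted_wrt (<) w" using good by (simp add: good_runs_def)
  have less: "tact (perm_of_word w) (tlam la) a < tact (perm_of_word w) (tlam la) b"
    if "a \<in> nodes la" "b \<in> nodes la" "tlam la a < tlam la b"
      "tlam la a \<notin> Suc ` set w \<Longrightarrow> \<not> {tlam la a..<tlam la b} \<subseteq> set w" for a b
    using increasing_word_less[OF sorted that(3,4)] that(1,2) tlam_nonzero by (simp add: tact_def)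
  have start: "\<exists>r. 1 \<le> r \<and> r \<le> length la \<and> x = psum la r \<and> (corner r \<or> \<not> {x..<psum la (Suc r)} \<subseteq> set w)"
    if "x < y" "x \<notin> Suc ` set w" "{x..<y} \<subseteq> set w" for x y
  proof -
    have "x \<in> set w" using that by auto
    then show ?thesis using good that by (auto simp: good_runs_def)
  qed
  show ?thesis
    unfolding standard_def
  proof (intro conjI allI impI)
    fix r s assume a: "(r, s) \<in> nodes la" "(r, Suc s) \<in> nodes la"
    obtain q where q: "r = Suc q" "q < length la" using a by (cases r) (auto simp: nodes_iff)
    have ta: "tlam la (r, s) = psum la q + s" "tlam la (r, Suc s) = psum la q + Suc s"
      using a q by (simp_all add: tlam_node)
    show "tact (perm_of_word w) (tlam la) (r, s) < tact (perm_of_word w) (tlam la) (r, Suc s)"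
    proof (rule less[OF a])
      assume *: "tlam la (r, s) \<notin> Suc ` set w"
      show "\<not> {tlam la (r, s)..<tlam la (r, Suc s)} \<subseteq> set w"
      proof
        assume "{tlam la (r, s)..<tlam la (r, Suc s)} \<subseteq> set w"
        then obtain r' where "r' \<le> length la" "psum la q + s = psum la r'"
          using start[of "tlam la (r, s)" "tlam la (r, Suc s)"] * ta by auto
        moreover have "psum la q < psum la q + s" "psum la q + s < psum la (Suc q)"
          using a q by (auto simp: nodes_iff psum_Suc)
        ultimately show False
          using psum_less_iff[of q r'] psum_less_iff[of r' "Suc q"] q by simp
      qed
    qed (use ta in simp)
  next
    fix r s assume a: "(r, s) \<in> nodes la" "(Suc r, s) \<in> nodes la"
    obtain q where q: "r = Suc q" "Suc q < length la" using a by (cases r) (auto simp: nodes_iff)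
    have sl: "1 \<le> s" "s \<le> la ! q" "s \<le> la ! Suc q" using a q by (auto simp: nodes_iff)
    have ta: "tlam la (r, s) = psum la q + s" "tlam la (Suc r, s) = psum la (Suc q) + s"
      using a q by (simp_all add: tlam_node)
    have ps: "psum la (Suc q) = psum la q + la ! q" "psum la (Suc (Suc q)) = psum la (Suc q) + la ! Suc q"
      using q by (simp_all add: psum_Suc)
    have lt: "tlam la (r, s) < tlam la (Suc r, s)" using ta ps sl by simp
    show "tact (perm_of_word w) (tlam la) (r, s) < tact (perm_of_word w) (tlam la) (Suc r, s)"
    proof (rule less[OF a lt])
      assume *: "tlam la (r, s) \<notin> Suc ` set w"
      show "\<not> {tlam la (r, s)..<tlam la (Suc r, s)} \<subseteq> set w"
      proof
        assume run: "{tlam la (r, s)..<tlam la (Suc r, s)} \<subseteq> set w"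
        from start[OF lt * run] obtain r' where r'_run: "r' \<le> length la" "tlam la (r, s) = psum la r'"
          "corner r' \<or> \<not> {tlam la (r, s)..<psum la (Suc r')} \<subseteq> set w"
          by blast
        then have r': "r' \<le> length la" "psum la q + s = psum la r'" using ta by simp_all
        have "psum la q < psum la r'" "psum la r' < psum la (Suc (Suc q))"
          using r' ps sl by linarith+
        then have "r' = Suc q"
          using psum_less_iff[of q r'] psum_less_iff[of r' "Suc (Suc q)"] r' q by simp
        moreover from this have "s = la ! q" using r' ps by simp
        moreover have "la ! Suc q = la ! q"
          using \<open>s = la ! q\<close> sl parts_antimono[of q "Suc q"] q by simp
        ultimately show False
          using r'_run(3) run ta ps q by (auto simp: corner_def)
      qed
    qed
  qed
qed

text \<open>Of all the runs only one starting at the end of row \<open>K\<close> may pass the entry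
  below its start, and in the application \<open>K\<close> is a corner. The gap expressed by
  \<open>Suc x\<close> keeps a run of a later factor R from merging with earlier letters.\<close>

lemma good_runs_row_phi:
  assumes K: "1 \<le> K" "K + i \<le> length la" "1 \<le> i" and eq: "\<And>r. K \<le> r \<Longrightarrow> r < K + i \<Longrightarrow> la ! r = l" and l: "0 < l"
    and w: "w \<in> fwords (row_phi la K l i)"
  shows "good_runs {K} w \<and> (\<forall>x\<in>set w. psum la K \<le> x \<and> Suc x < psum la (K + i))"
  using K(3,2) eq w
proof (induction i arbitrary: w rule: dec_induct)
  case base
  then obtain m where "psum la K \<le> m" "m < psum la (Suc K)" "w = [psum la K..<m]"
    using fwords_Rrow[of w K] by auto
  then show ?case
    using K base.prems by (auto simp: good_runs_def sorted_wrt_upt intro!: exI[of _ K])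
next
  case (step i)
  define a where "a = psum la (K + i)"
  obtain i' where i': "i = Suc i'" using step by (cases i) auto
  have aK: "psum la K + i * l = a"
    unfolding a_def using step by (intro psum_equal_rows[symmetric]) auto
  have ai: "psum la K < a"
    unfolding a_def using step by (intro psum_strict_mono) auto
  have "row_phi la K l (Suc i) = FMul (FAdd (fT [psum la K..<a]) (FScal (- qq) (row_phi la K l i))) (Rrow la (Suc (K + i)))"
    unfolding aK[symmetric] by (simp add: i')
  then obtain u v where uv: "w = u @ v" "v \<in> fwords (Rrow la (Suc (K + i)))"
    and u: "u = [psum la K..<a] \<or> u \<in> fwords (row_phi la K l i)"
    using step.prems(3) by (auto simp: fwords_fT)
  obtain m where m: "a \<le> m" "m < psum la (Suc (K + i))" "w = u @ [a..<m]"
    using fwords_Rrow[OF uv(2)] step.prems(1) uv(1) unfolding a_def by auto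
  show ?case
    using u
  proof
    assume "u = [psum la K..<a]"
    then have "w = [psum la K..<m]"
      using m ai upt_add_eq_append[of "psum la K" a "m - a"] by simp
    then show ?thesis
      using m ai K step.prems(1) by (auto simp: good_runs_def sorted_wrt_upt intro!: exI[of _ K])
  next
    assume "u \<in> fwords (row_phi la K l i)"
    then have IH: "good_runs {K} u" "\<And>x. x \<in> set u \<Longrightarrow> psum la K \<le> x \<and> Suc x < a"
      using step by (auto simp: a_def)
    have "sorted_wrt (<) w"
      using IH by (force simp: good_runs_def m(3) sorted_wrt_append sorted_wrt_upt)
    moreover have "\<exists>r. 1 \<le> r \<and> r \<le> length la \<and> x = psum la r \<and> (r \<in> {K} \<or> \<not> {x..<psum la (Suc r)} \<subseteq> set w)"
      if x: "x \<in> set w" "x \<notin> Suc ` set w" for x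
    proof (cases "x \<in> set u")
      case True
      moreover have "x \<notin> Suc ` set u" using x m(3) by auto
      ultimately obtain r where r: "1 \<le> r" "r \<le> length la" "x = psum la r" "r \<in> {K} \<or> \<not> {x..<psum la (Suc r)} \<subseteq> set u"
        using IH(1) unfolding good_runs_def by blast
      have "psum la r < psum la (K + i)"
        using IH(2)[OF True] r by (simp add: a_def)
      then have "Suc r \<le> K + i"
        using psum_less_iff[of r "K + i"] r step.prems(1) by simp
      then have "psum la (Suc r) \<le> a" unfolding a_def by (rule psum_mono)
      then have "{x..<psum la (Suc r)} \<subseteq> set w \<Longrightarrow> {x..<psum la (Suc r)} \<subseteq> set u"
        by (auto simp: m(3))
      then show ?thesis using r by blast
    next
      case False
      then have "x \<in> {a..<m}" using x m(3) by auto
      moreover have "x \<le> a"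
      proof (rule ccontr)
        assume "\<not> x \<le> a"
        then have "x - 1 \<in> set w" "x = Suc (x - 1)" using \<open>x \<in> {a..<m}\<close> m(3) by auto
        then show False using x(2) by blast
      qed
      ultimately have "x = a" by simp
      \<comment> \<open>The summand of R ends before the last entry of its row, so the run starting
        at \<open>a\<close> stops short of the entry below it.\<close>
      moreover have "m \<notin> set w" using IH(2) m by force
      moreover have "m \<in> {a..<psum la (Suc (K + i))}" using m by simp
      ultimately show ?thesis
        using K step.prems(1) by (intro exI[of _ "K + i"]) (auto simp: a_def)
    qed
    ultimately have "good_runs {K} w" unfolding good_runs_def by blast
    moreover have "psum la K \<le> x \<and> Suc x < psum la (K + Suc i)" if "x \<in> set w" for x
      using that IH(2)[of x] m ai by auto
    ultimately show ?thesis by blast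
  qed
qed

text \<open>Successive factors use disjoint ranges of letters separated at the ends of removable
  rows. Whether a run from a row end covers the next row involves letters of one range only, so the
  condition can be checked factor by factor even if runs join at a boundary.\<close>

lemma good_runs_ftil:
  assumes corner: "corner k" and w: "w \<in> fwords (ftil_expr la k (la ! (k - 1)))"
  shows "good_runs (Collect corner) w"
proof -
  let ?rows = "rows_below k" and ?l = "la ! (k - 1)"
  have "good_runs (Collect corner) w \<and> (\<forall>x\<in>set w. x < psum la (?rows ! m))"
    if "m < length ?rows" "w \<in> fwords (foldl FMul FOne (map (Xfac la k ?l) [0..<m]))" for m w
    using that
  proof (induction m arbitrary: w)
    case (Suc m)
    note st = stage[OF corner Suc.prems(1)]
    define K where "K = ?rows ! m"
    define K' where "K' = ?rows ! Suc m"
    obtain u v where uv: "w = u @ v" "u \<in> fwords (foldl FMul FOne (map (Xfac la k ?l) [0..<m]))"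
        "v \<in> fwords (Xfac la k ?l m)"
      using Suc.prems(2) by auto
    have u: "good_runs (Collect corner) u" "\<And>x. x \<in> set u \<Longrightarrow> x < psum la K"
      using Suc.IH[of u] Suc.prems(1) uv(2) by (auto simp: K_def)
    have cK: "corner K" using corner_rows_below[OF corner, of m] Suc.prems(1) by (simp add: K_def)
    have K1: "1 \<le> K" using cK by (simp add: corner_def)
    have KK: "K < K'" "K' \<le> length la" using st by (simp_all add: K_def K'_def)
    have psKK: "psum la K < psum la K'" using KK by (intro psum_strict_mono)
    have v: "good_runs {K} v \<and> (\<forall>x\<in>set v. psum la K \<le> x \<and> x < psum la K')"
    proof -
      have "v = [psum la K..<psum la K'] \<or> v \<in> fwords (row_phi la K (la ! (K' - 1)) (K' - K))"
        using uv(3) st(5-7) by (auto simp: Xfac_def fwords_fT K_def K'_def)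
      then show ?thesis
      proof
        assume "v = [psum la K..<psum la K']"
        then show ?thesis
          using K1 KK by (auto simp: good_runs_def sorted_wrt_upt intro!: exI[of _ K])
      next
        assume v: "v \<in> fwords (row_phi la K (la ! (K' - 1)) (K' - K))"
        have "good_runs {K} v \<and> (\<forall>x\<in>set v. psum la K \<le> x \<and> Suc x < psum la (K + (K' - K)))"
        proof (rule good_runs_row_phi[OF K1 _ _ _ _ v])
          show "la ! r = la ! (K' - 1)" if "K \<le> r" "r < K + (K' - K)" for r
            using that KK unfolding K_def K'_def by (intro rows_between[OF corner Suc.prems(1)]) auto
          show "0 < la ! (K' - 1)" using KK by (intro parts_pos) linarith
        qed (use KK in auto)
        then show ?thesis using KK by auto
      qed
    qed
    have "sorted_wrt (<) w"
      using u v by (force simp: good_runs_def uv(1) sorted_wrt_append)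
    moreover have "\<exists>r. 1 \<le> r \<and> r \<le> length la \<and> x = psum la r \<and> (r \<in> Collect corner \<or> \<not> {x..<psum la (Suc r)} \<subseteq> set w)"
      if x: "x \<in> set w" "x \<notin> Suc ` set w" for x
    proof (cases "x \<in> set u")
      case True
      moreover have "x \<notin> Suc ` set u" using x uv(1) by auto
      ultimately obtain r where r: "1 \<le> r" "r \<le> length la" "x = psum la r"
          "corner r \<or> \<not> {x..<psum la (Suc r)} \<subseteq> set u"
        using u(1) unfolding good_runs_def by blast
      have "psum la r < psum la K" using u(2)[OF True] r by simp
      then have "Suc r \<le> K" using psum_less_iff[of r K] r KK by simp
      then have "psum la (Suc r) \<le> psum la K" by (rule psum_mono)
      then have "{x..<psum la (Suc r)} \<subseteq> set w \<Longrightarrow> {x..<psum la (Suc r)} \<subseteq> set u"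
        using v uv(1) by fastforce
      then show ?thesis using r by blast
    next
      case False
      then have xv: "x \<in> set v" using x uv(1) by simp
      moreover have "x \<notin> Suc ` set v" using x uv(1) by auto
      ultimately obtain r where r: "1 \<le> r" "r \<le> length la" "x = psum la r"
          "r = K \<or> \<not> {x..<psum la (Suc r)} \<subseteq> set v"
        using v unfolding good_runs_def by blast
      have "{x..<psum la (Suc r)} \<subseteq> set w \<Longrightarrow> {x..<psum la (Suc r)} \<subseteq> set v"
        using u(2) v xv uv(1) by fastforce
      then show ?thesis using r cK by blast
    qed
    ultimately have "good_runs (Collect corner) w" unfolding good_runs_def by blast
    moreover have "x < psum la K'" if "x \<in> set w" for x
      using that u(2)[of x] v psKK uv(1) by auto
    ultimately show ?case by (simp add: K'_def)
  qed (simp add: good_runs_def)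
  from this[of "length ?rows - 1"] show ?thesis
    using w by (simp add: ftil_expr_def length_remb rows_below_def)
qed

end

theorem theorem1:
  fixes n k l :: nat and la :: "nat list"
  assumes "is_partition n la"
    and "removable la (k, l)"
  shows "specht_eq n la
           (hmul n (etab n la (tlam la)) (feval n (ftil_expr la k l)))
           (fsn n la (tact (perm_of_word [cc la k l 0..<n]) (tlam la)))
       \<and> (\<forall>w \<in> fwords (ftil_expr la k l). \<forall>i \<le> length w.
            standard la (tact (perm_of_word (take i w)) (tlam la)))"
proof -
  interpret partition n la by unfold_locales fact
  have corner: "corner k" and l: "l = la ! (k - 1)"
    using assms(2) removable_iff by auto
  have c: "cc la k l 0 = psum la k"
    unfolding l by (rule cc_0[OF corner])
  have gens: "gens (ftil_expr la k l) \<subseteq> {1..<n}"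
    unfolding l by (rule gens_ftil[OF corner])
  \<comment> \<open>Evaluating e_t T_i as e_{ts_i} along a word visits exactly the tableaux of its
    prefixes.\<close>
  have "standard la (tact (perm_of_word (take i w)) (tlam la))" if "w \<in> fwords (ftil_expr la k l)" for w i
  proof (rule good_runs_standard)
    show "good_runs (Collect corner) (take i w)"
      using good_runs_ftil[OF corner] that unfolding l by (intro good_runs_take) blast
    show "set (take i w) \<subseteq> {1..<n}"
      using set_fwords[OF that] gens set_take_subset[of i w] by blast
  qed
  then show ?thesis
    using specht_ftil[OF corner] unfolding l[symmetric] c by blast
qed

end
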